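(* Let $(X_\sigma,f_\sigma)_{\sigma\in A}$ be a combinatorial Seshadri stratification on $X_P$ with quasi-valuation $\nu$, let $\theta:\mathbb K[x_1,\ldots,x_p]\to\mathbb K[\hat X_P]$ and $\bar\theta:\mathbb K[x_1,\ldots,x_p]\to\mathrm{gr}_\nu\mathbb K[\hat X_P]$ be the surjections defined in the context, and let $\lambda\in\mathbb Z^p$ be an integral vector with $\mathrm{in}_\nu(\ker\theta)=\mathrm{in}_\lambda(\ker\theta)$. View $X_P=V(\ker\theta)$ and $X_0=V(\ker\bar\theta)$ as weighted algebraic subsets of $\mathbb P(m_1,\ldots,m_p)$. Then $X_0\subseteq\mathbb P(m_1,\ldots,m_p)$ is a toric degeneration of $X_P$ inside the weighted projective space $\mathbb P(m_1,\ldots,m_p)$: $$\lim_{s\to0}s\cdot X_P=X_0 .$$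
   Context: Toric variety. $\mathbb K$ is an algebraically closed field of characteristic zero, $T\simeq(\mathbb K^* )^n$ is a torus with character lattice $M$, $M_{\mathbb R}=M\otimes_{\mathbb Z}\mathbb R$. $P\subseteq M_{\mathbb R}$ is a full dimensional normal lattice polytope, $\Lambda=P\cap M$, $V=\mathbb K^\Lambda$ with standard basis $\{e_\chi\}_{\chi\in\Lambda}$ and dual coordinates $x_\chi$. $X_P\subseteq\mathbb P(V)$ is the Zariski closure of the image of $T\to\mathbb P(V)$, $t\mapsto[\sum_{\chi\in\Lambda}\chi(t)e_\chi]$; $\hat X_P\subseteq V$ is its affine cone and $\mathbb K[\hat X_P]$ the coordinate ring of the cone (the homogeneous coordinate ring of $X_P$), graded by degree. $\hat T=\mathbb K^*\times T$, with character lattice $\hat M=\mathbb Z\oplus M$, acts on $V$ by $(c,t)\cdot e_\chi=c\chi(t)e_\chi$ and on functions by $(\hat t\cdot g)(x)=g(\hat t^{-1}x)$; so $x_\chi|_{\hat X_P}$ has weight $(-1,-\chi)$. A (nonzero) $\hat T$-eigenfunction $g$ is homogeneous and its weight $\lambda_g$ has first entry $-\deg g$. $M_{\mathbb R}$ is identified with $\{1\}\times M_{\mathbb R}\subset\mathbb R\oplus M_{\mathbb R}$. Stratification. $A$ is the set of (nonempty) faces of $P$, including $P$, ordered by inclusion; $\sigma^o$ is the relative interior of $\sigma$; $X_\sigma$ is the Zariski closure of the $T$-orbit $\{[\sum_{\chi\in\Lambda\cap\sigma}\chi(t)e_\chi]\mid t\in T\}$. A combinatorial Seshadri stratification on $X_P$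 is a collection $(X_\sigma,f_\sigma)_{\sigma\in A}$ where each $f_\sigma\in\mathbb K[\hat X_P]\setminus\{0\}$ is a $\hat T$-eigenfunction with $\deg f_\sigma\ge1$ whose $\hat T$-weight $\mu_\sigma$ satisfies $\frac{-\mu_\sigma}{\deg f_\sigma}\in\sigma^o$. Quasi-valuation. For a maximal chain $\mathfrak C=\{\sigma_r>\dots>\sigma_0\}$ in $A$ the weights $\mu_{\sigma_r},\dots,\mu_{\sigma_0}$ form a $\mathbb Q$-basis of $\hat M_{\mathbb Q}$. $\mathbb Q^{\mathfrak C}$ is the subspace of $\mathbb Q^A$ (standard basis $e_\sigma$, $\sigma\in A$) spanned by $e_\sigma$, $\sigma\in\mathfrak C$. For a $\hat T$-eigenfunction $g$ of weight $\lambda_g=\sum_i a_i\mu_{\sigma_i}$ put $\nu_{\mathfrak C}(g)=\sum_i a_ie_{\sigma_i}$; for general $g\ne0$ take the minimum of the values on the $\hat T$-weight components of $g$. The minimum is with respect to the lexicographic order on $\mathbb Q^A$ induced by a fixed total order $>^t$ on $A$ refining the partial order (the coordinate at the $>^t$-largest element is compared first). The quasi-valuation is $\nu(g)=\min\{\nu_{\mathfrak C}(g)\mid\mathfrak C\text{ a maximal chain in }A\}$; it takes values in $\mathbb Q^A_{\ge0}$; let $\Gamma$ be its image. $\mathrm{gr}_\nu\mathbb K[\hat X_P]=\bigoplus_{\underline a\in\Gamma}\mathbb K[\hat X_P]_{\ge\underline a}/\mathbb K[\hat X_P]_{>\underline a}$, with $\mathbb K[\hat X_P]_{\ge\underline a}=\{g\mid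 g=0\text{ or }\nu(g)\ge^t\underline a\}$ and similarly for $>\underline a$; the summand for $\underline a$ has degree $\sum_\sigma a_\sigma\deg f_\sigma$. $\bar g$ is the class of $g$ in degree $\nu(g)$. Generators. $S\subseteq\hat M$ is the monoid generated by $(1,\chi)$, $\chi\in\Lambda$. For $(m,\eta)=\sum_\chi a_\chi(1,\chi)\in S$ set $f_{m,\eta}=\prod_\chi x_\chi^{a_\chi}|_{\hat X_P}$ (independent of the decomposition); these form a basis of $\mathbb K[\hat X_P]$. Fix a finite set $\{f_{m_1,\chi_1},\dots,f_{m_p,\chi_p}\}$ of basis elements consisting of all degree one elements $f_{1,\chi}$, $\chi\in\Lambda$ (the first $r=|\Lambda|$ ones) and further elements such that the classes $\bar f_{m_i,\chi_i}$ generate $\mathrm{gr}_\nu\mathbb K[\hat X_P]$. Define surjective algebra morphisms by $\theta(x_i)=f_{m_i,\chi_i}$ and $\bar\theta(x_i)=\bar f_{m_i,\chi_i}$. Grade $\mathbb K[\underline x]=\mathbb K[x_1,\dots,x_p]$ by $\deg_{\underline m}x_i=m_i$; $\mathbb P(m_1,\dots,m_p)=(\mathbb K^p\setminus\{0\})/\mathbb K^*$ is the weighted projective space ($\xi\cdot(a_i)=(\xi^{m_i}a_i)$). Both kernels are $\deg_{\underline m}$-homogeneous radical ideals; $V(I)$ is the vanishing set in $\mathbb P(m_1,\dots,m_p)$ of a homogeneous ideal $I$ and $I(Y)$ the homogeneous vanishing ideal of $Y$. The weighted algebraic sets $V(\ker\theta)$ and $V(\ker\bar\theta)$ are isomorphic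 to $X_P$ and to $X_0=\mathrm{Proj}(\mathrm{gr}_\nu\mathbb K[\hat X_P])$. Initial ideals. Order $\mathbb N\times\mathbb Q^A_{\ge0}$ by $(m',\underline a')\preceq(m,\underline a)$ iff $m'<m$, or $m'=m$ and $\underline a'\ge^t\underline a$. Put $\deg_Ax^\alpha=\sum_i\alpha_i(m_i,\nu(f_{m_i,\chi_i}))$. For $g\ne0$, $\mathrm{in}_\nu g$ is the sum of the terms of $g$ of $\preceq$-maximal $\deg_A$; for an ideal $I$, $\mathrm{in}_\nu I$ is the ideal generated by all $\mathrm{in}_\nu g$, $g\in I\setminus\{0\}$. For $\lambda\in\mathbb Z^p$, $\mathrm{in}_\lambda g$ is the sum of the terms $c_\alpha x^\alpha$ of $g$ with $\lambda\cdot\alpha$ maximal and $\mathrm{in}_\lambda I$ the ideal generated by all $\mathrm{in}_\lambda g$, $g\in I\setminus\{0\}$. An integral vector $\lambda$ as in the claim exists by a known theorem of Kemper, Trung and van Anh. It defines a $\mathbb G_m$-action $s\cdot(\sum c_ie_i)=\sum s^{\lambda_i}c_ie_i$ on $\mathbb K^p$ and hence on $\mathbb P(m_1,\dots,m_p)$. Definition of toric degeneration: for a weighted projective subvariety $Y\subseteq\mathbb P(m_1,\dots,m_p)$, a weighted algebraic set $Y_0$ is a toric degeneration of $Y$ inside $\mathbb P(m_1,\dots,m_p)$, written $\lim_{s\to0}s\cdot Y=Y_0$, if $Y_0=V(\mathrm{in}_\lambda I(Y))$. *)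

theory Defs
  imports "HOL-Analysis.Analysis" "HOL-Algebra.Ideal" "HOL-Algebra.RingHom" "HOL-Algebra.Module"
    "HOL-Computational_Algebra.Polynomial" "HOL-Library.Poly_Mapping"
begin

section \<open>Polynomial rings and weighted projective spaces\<close>

text \<open>A polynomial in variables \<open>x\<^sub>i\<close> is a finitely supported map from exponent vectors to
  coefficients. The variables of \<open>poly_ring I\<close> are those with index in \<open>I\<close>; correspondingly the
  affine space \<open>K\<^sup>I\<close> consists of the functions vanishing off \<open>I\<close>.\<close>

type_synonym ('i, 'k) mpoly = "('i \<Rightarrow>\<^sub>0 nat) \<Rightarrow>\<^sub>0 'k"

definition poly_ring :: "'i set \<Rightarrow> ('i, 'k::comm_ring_1) mpoly ring" where
  "poly_ring I = \<lparr>carrier = {g. \<forall>\<alpha>\<in>Poly_Mapping.keys g. Poly_Mapping.keys \<alpha> \<subseteq> I},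
     mult = (*), one = 1, zero = 0, add = (+)\<rparr>"

definition peval :: "('i, 'k::comm_ring_1) mpoly \<Rightarrow> ('i \<Rightarrow> 'k) \<Rightarrow> 'k" where
  "peval g a = (\<Sum>\<alpha>\<in>Poly_Mapping.keys g. Poly_Mapping.lookup g \<alpha> *
     (\<Prod>i\<in>Poly_Mapping.keys \<alpha>. a i ^ Poly_Mapping.lookup \<alpha> i))"

definition select_terms :: "(('i \<Rightarrow>\<^sub>0 nat) \<Rightarrow> bool) \<Rightarrow> ('i, 'k::comm_ring_1) mpoly \<Rightarrow> ('i, 'k) mpoly"
  where
  "select_terms Q g =
     (\<Sum>\<alpha>\<in>{\<alpha>\<in>Poly_Mapping.keys g. Q \<alpha>}. Poly_Mapping.single \<alpha> (Poly_Mapping.lookup g \<alpha>))"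

definition wdeg :: "('i \<Rightarrow> nat) \<Rightarrow> ('i \<Rightarrow>\<^sub>0 nat) \<Rightarrow> nat" where
  "wdeg m \<alpha> = (\<Sum>i\<in>Poly_Mapping.keys \<alpha>. Poly_Mapping.lookup \<alpha> i * m i)"

definition whomogeneous :: "('i \<Rightarrow> nat) \<Rightarrow> nat \<Rightarrow> ('i, 'k::comm_ring_1) mpoly \<Rightarrow> bool" where
  "whomogeneous m d g \<longleftrightarrow> (\<forall>\<alpha>\<in>Poly_Mapping.keys g. wdeg m \<alpha> = d)"

definition homogeneous_ideal ::
  "'i set \<Rightarrow> ('i \<Rightarrow> nat) \<Rightarrow> ('i, 'k::comm_ring_1) mpoly set \<Rightarrow> bool" where
  "homogeneous_ideal I m J \<longleftrightarrow>
     ideal J (poly_ring I) \<and> (\<forall>g\<in>J. \<forall>d. select_terms (\<lambda>\<alpha>. wdeg m \<alpha> = d) g \<in> J)"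

definition affine_space :: "'i set \<Rightarrow> ('i \<Rightarrow> 'k::field) set" where
  "affine_space I = {a. \<forall>i. i \<notin> I \<longrightarrow> a i = 0}"

text \<open>Points of \<open>(K\<^sup>I - {0})/K\<^sup>*\<close> are the orbits themselves. The ordinary projective space of \<open>K\<^sup>I\<close>
  is the case where all weights are one.\<close>

definition wpoint :: "('i \<Rightarrow> nat) \<Rightarrow> ('i \<Rightarrow> 'k::field) \<Rightarrow> ('i \<Rightarrow> 'k) set" where
  "wpoint m a = {\<lambda>i. \<xi> ^ m i * a i | \<xi>. \<xi> \<noteq> 0}"

definition wproj :: "'i set \<Rightarrow> ('i \<Rightarrow> nat) \<Rightarrow> ('i \<Rightarrow> 'k::field) set set" where
  "wproj I m = wpoint m ` (affine_space I - {\<lambda>i. 0})"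

definition vanishing_locus ::
  "'i set \<Rightarrow> ('i \<Rightarrow> nat) \<Rightarrow> ('i, 'k::field) mpoly set \<Rightarrow> ('i \<Rightarrow> 'k) set set" where
  "vanishing_locus I m J = {y\<in>wproj I m. \<forall>a\<in>y. \<forall>g\<in>J. peval g a = 0}"

definition vanishing_ideal ::
  "'i set \<Rightarrow> ('i \<Rightarrow> nat) \<Rightarrow> ('i \<Rightarrow> 'k::field) set set \<Rightarrow> ('i, 'k) mpoly set" where
  "vanishing_ideal I m Y = genideal (poly_ring I)
     {g\<in>carrier (poly_ring I). (\<exists>d. whomogeneous m d g) \<and> (\<forall>y\<in>Y. \<forall>a\<in>y. peval g a = 0)}"

definition weighted_algebraic_set ::
  "'i set \<Rightarrow> ('i \<Rightarrow> nat) \<Rightarrow> ('i \<Rightarrow> 'k::field) set set \<Rightarrow> bool" where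
  "weighted_algebraic_set I m Y \<longleftrightarrow> (\<exists>J. homogeneous_ideal I m J \<and> Y = vanishing_locus I m J)"

definition weighted_subvariety ::
  "'i set \<Rightarrow> ('i \<Rightarrow> nat) \<Rightarrow> ('i \<Rightarrow> 'k::field) set set \<Rightarrow> bool" where
  "weighted_subvariety I m Y \<longleftrightarrow> weighted_algebraic_set I m Y \<and> Y \<noteq> {} \<and>
     (\<forall>Z1 Z2. weighted_algebraic_set I m Z1 \<and> weighted_algebraic_set I m Z2 \<and> Y = Z1 \<union> Z2
        \<longrightarrow> Y = Z1 \<or> Y = Z2)"

definition zariski_closure ::
  "'i set \<Rightarrow> ('i \<Rightarrow> nat) \<Rightarrow> ('i \<Rightarrow> 'k::field) set set \<Rightarrow> ('i \<Rightarrow> 'k) set set" where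
  "zariski_closure I m Y = vanishing_locus I m (vanishing_ideal I m Y)"


section \<open>Initial ideals and toric degenerations\<close>

text \<open>\<open>leq \<beta> \<alpha>\<close> says that the degree of \<open>x\<^sup>\<beta>\<close> is at most the degree of \<open>x\<^sup>\<alpha>\<close>.\<close>

definition initial_form ::
  "(('i \<Rightarrow>\<^sub>0 nat) \<Rightarrow> ('i \<Rightarrow>\<^sub>0 nat) \<Rightarrow> bool) \<Rightarrow> ('i, 'k::comm_ring_1) mpoly \<Rightarrow> ('i, 'k) mpoly" where
  "initial_form leq g = select_terms (\<lambda>\<alpha>. \<forall>\<beta>\<in>Poly_Mapping.keys g. leq \<beta> \<alpha>) g"

definition initial_ideal ::
  "'i set \<Rightarrow> (('i \<Rightarrow>\<^sub>0 nat) \<Rightarrow> ('i \<Rightarrow>\<^sub>0 nat) \<Rightarrow> bool) \<Rightarrow> ('i, 'k::comm_ring_1) mpoly set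
     \<Rightarrow> ('i, 'k) mpoly set" where
  "initial_ideal I leq J = genideal (poly_ring I) (initial_form leq ` (J - {0}))"

definition weight_vector_le :: "('i \<Rightarrow> int) \<Rightarrow> ('i \<Rightarrow>\<^sub>0 nat) \<Rightarrow> ('i \<Rightarrow>\<^sub>0 nat) \<Rightarrow> bool" where
  "weight_vector_le l \<beta> \<alpha> \<longleftrightarrow>
     (\<Sum>i\<in>Poly_Mapping.keys \<beta>. l i * int (Poly_Mapping.lookup \<beta> i))
       \<le> (\<Sum>i\<in>Poly_Mapping.keys \<alpha>. l i * int (Poly_Mapping.lookup \<alpha> i))"

definition toric_degeneration ::
  "'i set \<Rightarrow> ('i \<Rightarrow> nat) \<Rightarrow> ('i \<Rightarrow> int) \<Rightarrow> ('i \<Rightarrow> 'k::field) set set \<Rightarrow> ('i \<Rightarrow> 'k) set set \<Rightarrow> bool" where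
  "toric_degeneration I m l Y Y0 \<longleftrightarrow>
     weighted_subvariety I m Y \<and> weighted_algebraic_set I m Y0 \<and>
     Y0 = vanishing_locus I m (initial_ideal I (weight_vector_le l) (vanishing_ideal I m Y))"


section \<open>The toric variety of a normal lattice polytope\<close>

text \<open>The character lattice is \<open>M = int^'n\<close>, and the torus \<open>T\<close> is \<open>(K\<^sup>*)\<^sup>n\<close>.\<close>

definition real_vec :: "int^'n \<Rightarrow> real^'n" where
  "real_vec \<eta> = (\<chi> i. real_of_int (\<eta> $ i))"

definition lattice_points :: "(real^'n) set \<Rightarrow> (int^'n) set" where
  "lattice_points Q = {\<eta>. real_vec \<eta> \<in> Q}"

definition lattice_polytope :: "(real^'n) set \<Rightarrow> bool" where
  "lattice_polytope P \<longleftrightarrow> (\<exists>F. finite F \<and> P = convex hull (real_vec ` F))"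

definition normal_polytope :: "(real^'n) set \<Rightarrow> bool" where
  "normal_polytope P \<longleftrightarrow> (\<forall>k\<ge>1. \<forall>l\<ge>1.
     {\<eta> + \<zeta> | \<eta> \<zeta>. \<eta> \<in> lattice_points ((*\<^sub>R) (real k) ` P) \<and> \<zeta> \<in> lattice_points ((*\<^sub>R) (real l) ` P)}
       = lattice_points ((*\<^sub>R) (real (k + l)) ` P))"

definition full_dim_normal_lattice_polytope :: "(real^'n) set \<Rightarrow> bool" where
  "full_dim_normal_lattice_polytope P \<longleftrightarrow>
     lattice_polytope P \<and> aff_dim P = int CARD('n) \<and> normal_polytope P"

definition faces :: "(real^'n) set \<Rightarrow> (real^'n) set set" where
  "faces P = {\<sigma>. \<sigma> face_of P \<and> \<sigma> \<noteq> {}}"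

definition torus :: "(('k::field^'n)) set" where
  "torus = {t. \<forall>i. t $ i \<noteq> 0}"

definition torus_char :: "int^'n \<Rightarrow> ('k::field^'n) \<Rightarrow> 'k" where
  "torus_char \<eta> t = (\<Prod>i\<in>UNIV. (t $ i) powi (\<eta> $ i))"

definition orbit_closure :: "(real^'n) set \<Rightarrow> (real^'n) set \<Rightarrow> (int^'n \<Rightarrow> 'k::field) set set" where
  "orbit_closure P \<sigma> = zariski_closure (lattice_points P) (\<lambda>_. 1)
     {wpoint (\<lambda>_. 1) (\<lambda>\<eta>. if \<eta> \<in> lattice_points P \<inter> lattice_points \<sigma> then torus_char \<eta> t else 0)
       | t. t \<in> torus}"

definition toric_variety :: "(real^'n) set \<Rightarrow> (int^'n \<Rightarrow> 'k::field) set set" where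
  "toric_variety P = zariski_closure (lattice_points P) (\<lambda>_. 1)
     {wpoint (\<lambda>_. 1) (\<lambda>\<eta>. if \<eta> \<in> lattice_points P then torus_char \<eta> t else 0) | t. t \<in> torus}"

definition affine_cone :: "(real^'n) set \<Rightarrow> (int^'n \<Rightarrow> 'k::field) set" where
  "affine_cone P = {v\<in>affine_space (lattice_points P).
     v = (\<lambda>_. 0) \<or> wpoint (\<lambda>_. 1) v \<in> toric_variety P}"

text \<open>The coordinate ring of the cone consists of the polynomial functions on it. They are
  represented as functions on the ambient type that are zero off the cone.\<close>

type_synonym ('n, 'k) cfun = "(int^'n \<Rightarrow> 'k) \<Rightarrow> 'k"

definition on_cone :: "(real^'n) set \<Rightarrow> ('n, 'k::field) cfun \<Rightarrow> ('n, 'k) cfun" where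
  "on_cone P g = (\<lambda>v. if v \<in> affine_cone P then g v else 0)"

definition cone_ring :: "(real^'n) set \<Rightarrow> ('k::field, ('n, 'k) cfun) module" where
  "cone_ring P = \<lparr>carrier = {on_cone P (peval G) | G. G \<in> carrier (poly_ring (lattice_points P))},
     mult = (\<lambda>g h v. g v * h v), one = on_cone P (\<lambda>v. 1), zero = (\<lambda>v. 0),
     add = (\<lambda>g h v. g v + h v), smult = (\<lambda>c g v. c * g v)\<rparr>"

definition homogeneous_of_degree :: "(real^'n) set \<Rightarrow> nat \<Rightarrow> ('n, 'k::field) cfun \<Rightarrow> bool" where
  "homogeneous_of_degree P d g \<longleftrightarrow>
     (\<exists>G\<in>carrier (poly_ring (lattice_points P)). whomogeneous (\<lambda>_. 1) d G \<and> g = on_cone P (peval G))"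

text \<open>Only meaningful for nonzero homogeneous functions.\<close>

definition fun_degree :: "(real^'n) set \<Rightarrow> ('n, 'k::field) cfun \<Rightarrow> nat" where
  "fun_degree P g = (THE d. homogeneous_of_degree P d g)"


section \<open>The action of the extended torus\<close>

definition ext_torus :: "('k::field \<times> ('k^'n)) set" where
  "ext_torus = {(c, t). c \<noteq> 0 \<and> t \<in> torus}"

definition ext_char :: "int \<times> (int^'n) \<Rightarrow> 'k::field \<times> ('k^'n) \<Rightarrow> 'k" where
  "ext_char w s = fst s powi fst w * torus_char (snd w) (snd s)"

definition ext_inverse :: "'k::field \<times> ('k^'n) \<Rightarrow> 'k \<times> ('k^'n)" where
  "ext_inverse s = (inverse (fst s), \<chi> i. inverse (snd s $ i))"

definition ext_act :: "'k::field \<times> ('k^'n) \<Rightarrow> (int^'n \<Rightarrow> 'k) \<Rightarrow> (int^'n \<Rightarrow> 'k)" where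
  "ext_act s v = (\<lambda>\<eta>. fst s * torus_char \<eta> (snd s) * v \<eta>)"

definition ext_act_fun :: "'k::field \<times> ('k^'n) \<Rightarrow> ('n, 'k) cfun \<Rightarrow> ('n, 'k) cfun" where
  "ext_act_fun s g = (\<lambda>v. g (ext_act (ext_inverse s) v))"

definition eigenfunction :: "(real^'n) set \<Rightarrow> ('n, 'k::field) cfun \<Rightarrow> int \<times> (int^'n) \<Rightarrow> bool" where
  "eigenfunction P g w \<longleftrightarrow> g \<in> carrier (cone_ring P) \<and> g \<noteq> \<zero>\<^bsub>cone_ring P\<^esub> \<and>
     (\<forall>s\<in>ext_torus. ext_act_fun s g = ext_char w s \<odot>\<^bsub>cone_ring P\<^esub> g)"

definition weight_of :: "(real^'n) set \<Rightarrow> ('n, 'k::field) cfun \<Rightarrow> int \<times> (int^'n)" where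
  "weight_of P g = (THE w. eigenfunction P g w)"

definition weight_decomposition ::
  "(real^'n) set \<Rightarrow> (int \<times> (int^'n) \<Rightarrow> ('n, 'k::field) cfun) \<Rightarrow> ('n, 'k) cfun \<Rightarrow> bool" where
  "weight_decomposition P c g \<longleftrightarrow>
     finite {w. c w \<noteq> \<zero>\<^bsub>cone_ring P\<^esub>} \<and>
     (\<forall>w. c w \<noteq> \<zero>\<^bsub>cone_ring P\<^esub> \<longrightarrow> eigenfunction P (c w) w) \<and>
     g = (\<Oplus>\<^bsub>cone_ring P\<^esub>w\<in>{w. c w \<noteq> \<zero>\<^bsub>cone_ring P\<^esub>}. c w)"

definition weight_components :: "(real^'n) set \<Rightarrow> ('n, 'k::field) cfun \<Rightarrow> ('n, 'k) cfun set" where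
  "weight_components P g =
     range (THE c. weight_decomposition P c g) - {\<zero>\<^bsub>cone_ring P\<^esub>}"


section \<open>Combinatorial Seshadri stratifications and the quasi-valuation\<close>

definition combinatorial_seshadri_stratification ::
  "(real^'n) set \<Rightarrow> ((real^'n) set \<Rightarrow> (int^'n \<Rightarrow> 'k::field) set set) \<Rightarrow>
     ((real^'n) set \<Rightarrow> ('n, 'k) cfun) \<Rightarrow> bool" where
  "combinatorial_seshadri_stratification P X f \<longleftrightarrow> (\<forall>\<sigma>\<in>faces P.
     X \<sigma> = orbit_closure P \<sigma> \<and>
     (\<exists>\<mu>. eigenfunction P (f \<sigma>) \<mu> \<and> fun_degree P (f \<sigma>) \<ge> 1 \<and>
        (real_of_int (- fst \<mu>), real_vec (- snd \<mu>)) /\<^sub>R real (fun_degree P (f \<sigma>))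
          \<in> {1} \<times> rel_interior \<sigma>))"

text \<open>A relation \<open>r\<close> with \<open>(\<sigma>, \<tau>) \<in> r\<close> iff \<open>\<sigma> \<le>\<^sup>t \<tau>\<close> encodes the total order on the faces. Vectors in
  \<open>\<rat>\<^sup>A\<close> are rational-valued functions vanishing off \<open>A\<close>.\<close>

definition refines_face_order :: "(real^'n) set \<Rightarrow> (real^'n) set rel \<Rightarrow> bool" where
  "refines_face_order P r \<longleftrightarrow> linear_order_on (faces P) r \<and>
     (\<forall>\<sigma>\<in>faces P. \<forall>\<tau>\<in>faces P. \<sigma> \<subseteq> \<tau> \<longrightarrow> (\<sigma>, \<tau>) \<in> r)"

type_synonym 'n qvec = "(real^'n) set \<Rightarrow> rat"

definition lex_less :: "(real^'n) set rel \<Rightarrow> 'n qvec \<Rightarrow> 'n qvec \<Rightarrow> bool" where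
  "lex_less r a b \<longleftrightarrow> (\<exists>\<sigma>\<in>Field r. a \<sigma> < b \<sigma> \<and> (\<forall>\<tau>. (\<sigma>, \<tau>) \<in> r \<and> \<tau> \<noteq> \<sigma> \<longrightarrow> a \<tau> = b \<tau>))"

definition lex_le :: "(real^'n) set rel \<Rightarrow> 'n qvec \<Rightarrow> 'n qvec \<Rightarrow> bool" where
  "lex_le r a b \<longleftrightarrow> lex_less r a b \<or> a = b"

definition lex_min :: "(real^'n) set rel \<Rightarrow> 'n qvec set \<Rightarrow> 'n qvec" where
  "lex_min r B = (THE a. a \<in> B \<and> (\<forall>b\<in>B. lex_le r a b))"

text \<open>The coordinates of a weight \<open>w\<close> in the rational basis \<open>\<mu>\<^sub>\<sigma>\<close>, \<open>\<sigma> \<in> C\<close>.\<close>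

definition chain_coords ::
  "((real^'n) set \<Rightarrow> int \<times> (int^'n)) \<Rightarrow> (real^'n) set set \<Rightarrow> int \<times> (int^'n) \<Rightarrow> 'n qvec" where
  "chain_coords \<mu> C w = (THE a. (\<forall>\<sigma>. \<sigma> \<notin> C \<longrightarrow> a \<sigma> = 0) \<and>
     rat_of_int (fst w) = (\<Sum>\<sigma>\<in>C. a \<sigma> * rat_of_int (fst (\<mu> \<sigma>))) \<and>
     (\<forall>i. rat_of_int (snd w $ i) = (\<Sum>\<sigma>\<in>C. a \<sigma> * rat_of_int (snd (\<mu> \<sigma>) $ i))))"

definition chain_valuation ::
  "(real^'n) set \<Rightarrow> (real^'n) set rel \<Rightarrow> ((real^'n) set \<Rightarrow> ('n, 'k::field) cfun) \<Rightarrow>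
     (real^'n) set set \<Rightarrow> ('n, 'k) cfun \<Rightarrow> 'n qvec" where
  "chain_valuation P r f C g = lex_min r
     ((\<lambda>h. chain_coords (\<lambda>\<sigma>. weight_of P (f \<sigma>)) C (weight_of P h)) ` weight_components P g)"

definition quasi_valuation ::
  "(real^'n) set \<Rightarrow> (real^'n) set rel \<Rightarrow> ((real^'n) set \<Rightarrow> ('n, 'k::field) cfun) \<Rightarrow>
     ('n, 'k) cfun \<Rightarrow> 'n qvec" where
  "quasi_valuation P r f g =
     lex_min r {chain_valuation P r f C g | C. subset.maxchain (faces P) C}"


section \<open>The associated graded algebra\<close>

definition val_image ::
  "(real^'n) set \<Rightarrow> (real^'n) set rel \<Rightarrow> ((real^'n) set \<Rightarrow> ('n, 'k::field) cfun) \<Rightarrow> 'n qvec set" where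
  "val_image P r f = quasi_valuation P r f ` (carrier (cone_ring P) - {\<zero>\<^bsub>cone_ring P\<^esub>})"

definition filt_ge ::
  "(real^'n) set \<Rightarrow> (real^'n) set rel \<Rightarrow> ((real^'n) set \<Rightarrow> ('n, 'k::field) cfun) \<Rightarrow>
     'n qvec \<Rightarrow> ('n, 'k) cfun set" where
  "filt_ge P r f a =
     {g\<in>carrier (cone_ring P). g = \<zero>\<^bsub>cone_ring P\<^esub> \<or> lex_le r a (quasi_valuation P r f g)}"

definition filt_gt ::
  "(real^'n) set \<Rightarrow> (real^'n) set rel \<Rightarrow> ((real^'n) set \<Rightarrow> ('n, 'k::field) cfun) \<Rightarrow>
     'n qvec \<Rightarrow> ('n, 'k) cfun set" where
  "filt_gt P r f a =
     {g\<in>carrier (cone_ring P). g = \<zero>\<^bsub>cone_ring P\<^esub> \<or> lex_less r a (quasi_valuation P r f g)}"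

definition gr_class ::
  "(real^'n) set \<Rightarrow> (real^'n) set rel \<Rightarrow> ((real^'n) set \<Rightarrow> ('n, 'k::field) cfun) \<Rightarrow>
     ('n, 'k) cfun \<Rightarrow> 'n qvec \<Rightarrow> ('n, 'k) cfun set" where
  "gr_class P r f g = (\<lambda>a\<in>val_image P r f.
     if a = quasi_valuation P r f g then filt_gt P r f a +>\<^bsub>cone_ring P\<^esub> g else filt_gt P r f a)"

definition gr_support ::
  "(real^'n) set \<Rightarrow> (real^'n) set rel \<Rightarrow> ((real^'n) set \<Rightarrow> ('n, 'k::field) cfun) \<Rightarrow>
     ('n qvec \<Rightarrow> ('n, 'k) cfun set) \<Rightarrow> 'n qvec set" where
  "gr_support P r f F = {a\<in>val_image P r f. F a \<noteq> filt_gt P r f a}"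

text \<open>An element of the direct sum is a family of cosets, indexed by the values of the
  quasi-valuation and almost everywhere zero. In each operation the union over representatives is a
  single coset; \<open>(F G)\<^sub>c\<close> is the sum of the products \<open>F\<^sub>a G\<^sub>b\<close> with \<open>a + b = c\<close>.\<close>

definition gr_ring ::
  "(real^'n) set \<Rightarrow> (real^'n) set rel \<Rightarrow> ((real^'n) set \<Rightarrow> ('n, 'k::field) cfun) \<Rightarrow>
     ('k, 'n qvec \<Rightarrow> ('n, 'k) cfun set) module" where
  "gr_ring P r f =
    \<lparr>carrier = {F \<in> (\<Pi>\<^sub>E a\<in>val_image P r f. {filt_gt P r f a +>\<^bsub>cone_ring P\<^esub> g | g. g \<in> filt_ge P r f a}).
        finite (gr_support P r f F)},
     mult = (\<lambda>F G. \<lambda>c\<in>val_image P r f.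
        \<Union>u\<in>Pi (val_image P r f) F. \<Union>v\<in>Pi (val_image P r f) G.
          filt_gt P r f c +>\<^bsub>cone_ring P\<^esub>
            (\<Oplus>\<^bsub>cone_ring P\<^esub>ab\<in>{ab\<in>gr_support P r f F \<times> gr_support P r f G.
                c = (\<lambda>\<sigma>. fst ab \<sigma> + snd ab \<sigma>)}. u (fst ab) \<otimes>\<^bsub>cone_ring P\<^esub> v (snd ab))),
     one = gr_class P r f \<one>\<^bsub>cone_ring P\<^esub>,
     zero = (\<lambda>a\<in>val_image P r f. filt_gt P r f a),
     add = (\<lambda>F G. \<lambda>a\<in>val_image P r f. F a <+>\<^bsub>cone_ring P\<^esub> G a),
     smult = (\<lambda>c F. \<lambda>a\<in>val_image P r f.
        \<Union>u\<in>F a. filt_gt P r f a +>\<^bsub>cone_ring P\<^esub> (c \<odot>\<^bsub>cone_ring P\<^esub> u))\<rparr>"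


section \<open>The generators and the two presentations\<close>

definition decomposes :: "(real^'n) set \<Rightarrow> (int^'n \<Rightarrow> nat) \<Rightarrow> int \<times> (int^'n) \<Rightarrow> bool" where
  "decomposes P a w \<longleftrightarrow> w = (\<Sum>\<eta>\<in>lattice_points P. (int (a \<eta>), int (a \<eta>) *s \<eta>))"

definition weight_monoid :: "(real^'n) set \<Rightarrow> (int \<times> (int^'n)) set" where
  "weight_monoid P = {w. \<exists>a. decomposes P a w}"

definition basis_fun :: "(real^'n) set \<Rightarrow> int \<times> (int^'n) \<Rightarrow> ('n, 'k::field) cfun" where
  "basis_fun P w =
     on_cone P (\<lambda>v. \<Prod>\<eta>\<in>lattice_points P. v \<eta> ^ (SOME a. decomposes P a w) \<eta>)"

text \<open>The value of the algebra morphism from \<open>poly_ring I\<close> that sends each \<open>x\<^sub>i\<close> to \<open>y i\<close>.\<close>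

definition alg_eval ::
  "('k, 'b) module \<Rightarrow> 'i set \<Rightarrow> ('i \<Rightarrow> 'b) \<Rightarrow> ('i, 'k::field) mpoly \<Rightarrow> 'b" where
  "alg_eval R I y g = (\<Oplus>\<^bsub>R\<^esub>\<alpha>\<in>Poly_Mapping.keys g. Poly_Mapping.lookup g \<alpha> \<odot>\<^bsub>R\<^esub>
     (\<Otimes>\<^bsub>R\<^esub>i\<in>I. y i [^]\<^bsub>R\<^esub> Poly_Mapping.lookup \<alpha> i))"

definition theta ::
  "(real^'n) set \<Rightarrow> nat \<Rightarrow> (nat \<Rightarrow> nat) \<Rightarrow> (nat \<Rightarrow> int^'n) \<Rightarrow> (nat, 'k::field) mpoly \<Rightarrow> ('n, 'k) cfun"
  where
  "theta P p m \<eta> = alg_eval (cone_ring P) {..<p} (\<lambda>i. basis_fun P (int (m i), \<eta> i))"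

definition theta_bar ::
  "(real^'n) set \<Rightarrow> (real^'n) set rel \<Rightarrow> ((real^'n) set \<Rightarrow> ('n, 'k::field) cfun) \<Rightarrow>
     nat \<Rightarrow> (nat \<Rightarrow> nat) \<Rightarrow> (nat \<Rightarrow> int^'n) \<Rightarrow> (nat, 'k) mpoly \<Rightarrow> 'n qvec \<Rightarrow> ('n, 'k) cfun set" where
  "theta_bar P r f p m \<eta> = alg_eval (gr_ring P r f) {..<p}
     (\<lambda>i. gr_class P r f (basis_fun P (int (m i), \<eta> i)))"

definition ker_theta ::
  "(real^'n) set \<Rightarrow> nat \<Rightarrow> (nat \<Rightarrow> nat) \<Rightarrow> (nat \<Rightarrow> int^'n) \<Rightarrow> (nat, 'k::field) mpoly set" where
  "ker_theta P p m \<eta> = a_kernel (poly_ring {..<p}) (cone_ring P) (theta P p m \<eta>)"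

definition ker_theta_bar ::
  "(real^'n) set \<Rightarrow> (real^'n) set rel \<Rightarrow> ((real^'n) set \<Rightarrow> ('n, 'k::field) cfun) \<Rightarrow>
     nat \<Rightarrow> (nat \<Rightarrow> nat) \<Rightarrow> (nat \<Rightarrow> int^'n) \<Rightarrow> (nat, 'k) mpoly set" where
  "ker_theta_bar P r f p m \<eta> =
     a_kernel (poly_ring {..<p}) (gr_ring P r f) (theta_bar P r f p m \<eta>)"

text \<open>The generators are pairwise distinct, the first ones are exactly those of degree one. The
  degrees are positive, as required for weights of a weighted projective space; this excludes the
  constant \<open>f\<^sub>0\<^sub>,\<^sub>0 = 1\<close>.\<close>

definition admissible_generators ::
  "(real^'n) set \<Rightarrow> (real^'n) set rel \<Rightarrow> ((real^'n) set \<Rightarrow> ('n, 'k::field) cfun) \<Rightarrow>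
     nat \<Rightarrow> (nat \<Rightarrow> nat) \<Rightarrow> (nat \<Rightarrow> int^'n) \<Rightarrow> bool" where
  "admissible_generators P r f p m \<eta> \<longleftrightarrow>
     card (lattice_points P) \<le> p \<and>
     (\<forall>i<card (lattice_points P). m i = 1) \<and>
     bij_betw \<eta> {..<card (lattice_points P)} (lattice_points P) \<and>
     (\<forall>i<p. m i \<ge> 1 \<and> (int (m i), \<eta> i) \<in> weight_monoid P) \<and>
     inj_on (\<lambda>i. (m i, \<eta> i)) {..<p} \<and>
     theta_bar P r f p m \<eta> ` carrier (poly_ring {..<p}) = carrier (gr_ring P r f)"

text \<open>\<open>nu_le \<beta> \<alpha>\<close> compares the degrees \<open>deg\<^sub>A\<close> of \<open>x\<^sup>\<beta>\<close> and \<open>x\<^sup>\<alpha>\<close>. The order on the second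
  component is reversed.\<close>

definition nu_exponent ::
  "(real^'n) set \<Rightarrow> (real^'n) set rel \<Rightarrow> ((real^'n) set \<Rightarrow> ('n, 'k::field) cfun) \<Rightarrow>
     (nat \<Rightarrow> nat) \<Rightarrow> (nat \<Rightarrow> int^'n) \<Rightarrow> (nat \<Rightarrow>\<^sub>0 nat) \<Rightarrow> 'n qvec" where
  "nu_exponent P r f m \<eta> \<alpha> = (\<lambda>\<sigma>. \<Sum>i\<in>Poly_Mapping.keys \<alpha>.
     of_nat (Poly_Mapping.lookup \<alpha> i) * quasi_valuation P r f (basis_fun P (int (m i), \<eta> i)) \<sigma>)"

definition nu_le ::
  "(real^'n) set \<Rightarrow> (real^'n) set rel \<Rightarrow> ((real^'n) set \<Rightarrow> ('n, 'k::field) cfun) \<Rightarrow>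
     (nat \<Rightarrow> nat) \<Rightarrow> (nat \<Rightarrow> int^'n) \<Rightarrow> (nat \<Rightarrow>\<^sub>0 nat) \<Rightarrow> (nat \<Rightarrow>\<^sub>0 nat) \<Rightarrow> bool" where
  "nu_le P r f m \<eta> \<beta> \<alpha> \<longleftrightarrow> wdeg m \<beta> < wdeg m \<alpha> \<or>
     (wdeg m \<beta> = wdeg m \<alpha> \<and> lex_le r (nu_exponent P r f m \<eta> \<alpha>) (nu_exponent P r f m \<eta> \<beta>))"

end

theory Submission
  imports Defs "HOL-Algebra.QuotRing"
begin

text \<open>The coordinate ring of the cone over \<open>X\<^sub>P\<close> is the monoid algebra \<open>K[S]\<close>: its elements are finite
  sums \<open>\<Sum> d\<^sub>w f\<^sub>w\<close> over weights \<open>w\<close>, and such a sum vanishes on the extended torus only if all \<open>d\<^sub>w\<close>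
  do (\<open>cone_fun_inj\<close>). Both this and the irreducibility of the torus come from restricting sums of
  characters to a generic one-parameter subgroup (\<open>char_sum_common_nonzero\<close>). The eigenfunctions are the
  multiples of the \<open>f\<^sub>w\<close>, so the quasi-valuation of a sum is the least value \<open>mval w\<close> over its support
  (\<open>quasi_valuation_cone_fun\<close>). Along a maximal chain of faces the weights \<open>\<mu>\<^sub>\<sigma>\<close> form a basis
  (\<open>chain_coords_ex1\<close>); each chain therefore gives an additive function of \<open>w\<close>, and \<open>mval\<close>, being the
  minimum of these, is superadditive.

  A monomial \<open>x\<^sup>\<alpha>\<close> has a weight \<open>w\<close>, which is the weight of its image, and a formal value, the sum of
  the values of its factors. The formal value is at most \<open>mval w\<close>; call the monomial sharp in case of
  equality. In the graded ring a monomial maps to the class of \<open>f\<^sub>w\<close> if it is sharp and to zero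
  otherwise. Surjectivity of the second presentation says that every weight in \<open>S\<close> is the weight of a
  sharp monomial (\<open>sharp_monomial_exists\<close>).

  The heart of the matter is the equality of \<open>in\<^sub>\<nu> (ker \<theta>)\<close> with the kernel of the second presentation
  (\<open>initial_ideal_ker_theta\<close>). The kernel of \<open>\<theta>\<close> is spanned by differences of monomials of equal weight.
  If one of the two is sharp and the other is not, the initial form is the one that is not sharp, as
  smaller formal values are leading; if both are sharp, the difference is its own initial form; if
  neither is, the initial form consists of monomials that are not sharp. These are exactly the
  relations of the graded ring.

  It remains to see that \<open>ker \<theta>\<close> is the vanishing ideal of its variety
  (\<open>vanishing_ideal_variety\<close>). This holds because \<open>ker \<theta>\<close> is the ideal of polynomials vanishing at the
  images of torus points, and these lie on the variety. By the hypothesis on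
  \<open>\<lambda>\<close>, the ideals \<open>in\<^sub>\<lambda> (ker \<theta>)\<close> and \<open>in\<^sub>\<nu> (ker \<theta>)\<close> agree, and the two varieties coincide.\<close>

section \<open>Polynomials as finitely supported maps\<close>

abbreviation coef :: "('a \<Rightarrow>\<^sub>0 'b::zero) \<Rightarrow> 'a \<Rightarrow> 'b" where "coef \<equiv> Poly_Mapping.lookup"
abbreviation supp :: "('a \<Rightarrow>\<^sub>0 'b::zero) \<Rightarrow> 'a set" where "supp \<equiv> Poly_Mapping.keys"
abbreviation trm :: "'a \<Rightarrow> 'b \<Rightarrow> 'a \<Rightarrow>\<^sub>0 'b::zero" where "trm \<equiv> Poly_Mapping.single"

lemma supp_sum_superset:
  assumes "finite B" "supp g \<subseteq> B" "\<And>\<alpha>. \<phi> \<alpha> 0 = 0"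
  shows "(\<Sum>\<alpha>\<in>supp g. \<phi> \<alpha> (coef g \<alpha>)) = (\<Sum>\<alpha>\<in>B. \<phi> \<alpha> (coef g \<alpha>))"
  using assms by (intro sum.mono_neutral_left) (auto simp: in_keys_iff)

lemma supp_sum_add:
  fixes \<phi> :: "'a \<Rightarrow> 'b::monoid_add \<Rightarrow> 'c::comm_monoid_add"
  assumes "\<And>\<alpha>. \<phi> \<alpha> 0 = 0" "\<And>\<alpha> x y. \<phi> \<alpha> (x + y) = \<phi> \<alpha> x + \<phi> \<alpha> y"
  shows "(\<Sum>\<alpha>\<in>supp (f + g). \<phi> \<alpha> (coef (f + g) \<alpha>))
    = (\<Sum>\<alpha>\<in>supp f. \<phi> \<alpha> (coef f \<alpha>)) + (\<Sum>\<alpha>\<in>supp g. \<phi> \<alpha> (coef g \<alpha>))"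
proof -
  have B: "finite (supp f \<union> supp g)" "supp (f + g) \<subseteq> supp f \<union> supp g"
    using keys_add[of f g] by auto
  have "(\<Sum>\<alpha>\<in>supp (f + g). \<phi> \<alpha> (coef (f + g) \<alpha>)) = (\<Sum>\<alpha>\<in>supp f \<union> supp g. \<phi> \<alpha> (coef (f + g) \<alpha>))"
    using B assms(1) by (intro supp_sum_superset) auto
  also have "\<dots> = (\<Sum>\<alpha>\<in>supp f \<union> supp g. \<phi> \<alpha> (coef f \<alpha>)) + (\<Sum>\<alpha>\<in>supp f \<union> supp g. \<phi> \<alpha> (coef g \<alpha>))"
    by (simp add: lookup_add assms(2) sum.distrib)
  also have "(\<Sum>\<alpha>\<in>supp f \<union> supp g. \<phi> \<alpha> (coef f \<alpha>)) = (\<Sum>\<alpha>\<in>supp f. \<phi> \<alpha> (coef f \<alpha>))"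
    using assms(1) by (intro supp_sum_superset[symmetric]) auto
  also have "(\<Sum>\<alpha>\<in>supp f \<union> supp g. \<phi> \<alpha> (coef g \<alpha>)) = (\<Sum>\<alpha>\<in>supp g. \<phi> \<alpha> (coef g \<alpha>))"
    using assms(1) by (intro supp_sum_superset[symmetric]) auto
  finally show ?thesis .
qed

lemma supp_sum_term:
  assumes "\<And>\<alpha>. \<phi> \<alpha> 0 = 0"
  shows "(\<Sum>\<beta>\<in>supp (trm \<alpha> c). \<phi> \<beta> (coef (trm \<alpha> c) \<beta>)) = \<phi> \<alpha> c"
  using assms by (cases "c = 0") auto

lemma sum_of_terms: "(\<Sum>\<alpha>\<in>supp g. trm \<alpha> (coef g \<alpha>)) = g"
  by (rule poly_mapping_eqI) (auto simp: lookup_sum lookup_single when_def in_keys_iff sum.delta')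

text \<open>Both the evaluation of polynomials and the change of exponents along an additive map are of
  the form treated here: additive on coefficients and multiplicative on terms.\<close>

lemma supp_sum_mult:
  fixes \<phi> :: "'a::comm_monoid_add \<Rightarrow> 'b::comm_semiring_0 \<Rightarrow> 'c::comm_semiring_0"
  assumes z: "\<And>\<alpha>. \<phi> \<alpha> 0 = 0" and a: "\<And>\<alpha> x y. \<phi> \<alpha> (x + y) = \<phi> \<alpha> x + \<phi> \<alpha> y"
    and m: "\<And>\<alpha> \<beta> x y. \<phi> (\<alpha> + \<beta>) (x * y) = \<phi> \<alpha> x * \<phi> \<beta> y"
  shows "(\<Sum>\<alpha>\<in>supp (f * g). \<phi> \<alpha> (coef (f * g) \<alpha>))
    = (\<Sum>\<alpha>\<in>supp f. \<phi> \<alpha> (coef f \<alpha>)) * (\<Sum>\<alpha>\<in>supp g. \<phi> \<alpha> (coef g \<alpha>))"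
proof -
  define L where "L h = (\<Sum>\<alpha>\<in>supp h. \<phi> \<alpha> (coef h \<alpha>))" for h
  have L0: "L 0 = 0" by (simp add: L_def)
  have Ladd: "L (h + k) = L h + L k" for h k unfolding L_def using z a by (rule supp_sum_add)
  have Lsum: "L (sum h B) = (\<Sum>b\<in>B. L (h b))" for h and B :: "'z set"
    by (induction B rule: infinite_finite_induct) (auto simp: L0 Ladd)
  have Lsum2: "L (sum h B) = (\<Sum>b\<in>B. L (h b))" for h and B :: "'a set"
    by (induction B rule: infinite_finite_induct) (auto simp: L0 Ladd)
  have Lterm: "L (trm \<alpha> c) = \<phi> \<alpha> c" for \<alpha> c unfolding L_def using z by (rule supp_sum_term)
  have "f * g = (\<Sum>\<alpha>\<in>supp f. trm \<alpha> (coef f \<alpha>)) * (\<Sum>\<beta>\<in>supp g. trm \<beta> (coef g \<beta>))"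
    by (simp add: sum_of_terms)
  also have "\<dots> = (\<Sum>\<alpha>\<in>supp f. \<Sum>\<beta>\<in>supp g. trm (\<alpha> + \<beta>) (coef f \<alpha> * coef g \<beta>))"
    by (simp add: sum_product mult_single)
  finally have "L (f * g) = (\<Sum>\<alpha>\<in>supp f. \<Sum>\<beta>\<in>supp g. \<phi> \<alpha> (coef f \<alpha>) * \<phi> \<beta> (coef g \<beta>))"
    by (simp add: Lsum2 Lterm m)
  thus ?thesis by (simp add: L_def sum_product)
qed

text \<open>The linear extension of a map \<open>h\<close> of exponents. For additive \<open>h\<close> it is the homomorphism of monoid
  algebras induced by \<open>h\<close>.\<close>

definition push :: "('a \<Rightarrow> 'b) \<Rightarrow> ('a \<Rightarrow>\<^sub>0 'k::comm_monoid_add) \<Rightarrow> 'b \<Rightarrow>\<^sub>0 'k" where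
  "push h g = (\<Sum>\<alpha>\<in>supp g. trm (h \<alpha>) (coef g \<alpha>))"

lemma push_0 [simp]: "push h 0 = 0" by (simp add: push_def)

lemma push_add: "push h (f + g) = push h f + push h g"
  unfolding push_def by (rule supp_sum_add) (auto simp: single_add)

lemma push_term [simp]: "push h (trm \<alpha> c) = trm (h \<alpha>) c"
  unfolding push_def by (rule supp_sum_term) auto

lemma push_sum: "push h (sum g B) = (\<Sum>b\<in>B. push h (g b))"
  by (induction B rule: infinite_finite_induct) (auto simp: push_add)

lemma push_uminus: "push h (- g) = - push h (g :: 'a \<Rightarrow>\<^sub>0 'k::ab_group_add)"
  using push_add[of h "- g" g] by (simp add: eq_neg_iff_add_eq_0)

lemma push_diff: "push h (f - g) = push h f - push h (g :: 'a \<Rightarrow>\<^sub>0 'k::ab_group_add)"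
  using push_add[of h f "- g"] by (simp add: push_uminus)

lemma push_mult:
  fixes f g :: "'a::comm_monoid_add \<Rightarrow>\<^sub>0 'k::comm_semiring_0" and h :: "'a \<Rightarrow> 'b::comm_monoid_add"
  assumes "\<And>\<alpha> \<beta>. h (\<alpha> + \<beta>) = h \<alpha> + h \<beta>"
  shows "push h (f * g) = push h f * push h g"
  unfolding push_def
  by (rule supp_sum_mult[where \<phi> = "\<lambda>\<alpha>. trm (h \<alpha>)"]) (auto simp: single_add mult_single assms)

lemma supp_push: "supp (push h g) \<subseteq> h ` supp g"
proof -
  have "supp (push h g) \<subseteq> (\<Union>\<alpha>\<in>supp g. supp (trm (h \<alpha>) (coef g \<alpha>)))"
    unfolding push_def by (rule keys_sum)
  also have "\<dots> \<subseteq> h ` supp g" by auto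
  finally show ?thesis .
qed

subsection \<open>Selecting terms\<close>

text \<open>The operation \<open>select_terms\<close>, but for arbitrary exponents: it is needed for Laurent
  polynomials as well.\<close>

definition restr :: "('a \<Rightarrow> bool) \<Rightarrow> ('a \<Rightarrow>\<^sub>0 'b::comm_monoid_add) \<Rightarrow> 'a \<Rightarrow>\<^sub>0 'b" where
  "restr Q g = (\<Sum>\<alpha>\<in>{\<alpha>\<in>supp g. Q \<alpha>}. trm \<alpha> (coef g \<alpha>))"

lemma select_terms_eq_restr: "select_terms Q g = restr Q g"
  by (simp add: select_terms_def restr_def)

lemma coef_restr: "coef (restr Q g) \<alpha> = (if Q \<alpha> then coef g \<alpha> else 0)"
  unfolding restr_def
  by (auto simp: lookup_sum lookup_single when_def in_keys_iff sum.delta')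

lemma supp_restr [simp]: "supp (restr Q g) = {\<alpha>\<in>supp g. Q \<alpha>}"
  by (auto simp: in_keys_iff coef_restr split: if_splits)

lemma restr_add: "restr Q (f + g) = restr Q f + restr Q g"
  by (rule poly_mapping_eqI) (auto simp: coef_restr lookup_add)

lemma restr_0 [simp]: "restr Q 0 = 0"
  by (rule poly_mapping_eqI) (auto simp: coef_restr)

lemma restr_sum: "restr Q (sum g B) = (\<Sum>b\<in>B. restr Q (g b))"
  by (induction B rule: infinite_finite_induct) (auto simp: restr_add)

lemma restr_trm: "restr Q (trm \<alpha> c) = (if Q \<alpha> then trm \<alpha> c else 0)"
  by (rule poly_mapping_eqI) (auto simp: coef_restr lookup_single when_def)

lemma restr_restr: "restr Q (restr Q' g) = restr (\<lambda>\<alpha>. Q \<alpha> \<and> Q' \<alpha>) g"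
  by (rule poly_mapping_eqI) (auto simp: coef_restr)

lemma sum_restr:
  assumes "finite B" "d ` supp g \<subseteq> B"
  shows "(\<Sum>b\<in>B. restr (\<lambda>\<alpha>. d \<alpha> = b) g) = g"
proof (rule poly_mapping_eqI)
  fix \<alpha>
  have "(\<Sum>b\<in>B. if d \<alpha> = b then coef g \<alpha> else 0) = coef g \<alpha>"
    using assms by (cases "\<alpha> \<in> supp g") (auto simp: in_keys_iff sum.delta')
  thus "coef (\<Sum>b\<in>B. restr (\<lambda>\<alpha>. d \<alpha> = b) g) \<alpha> = coef g \<alpha>"
    by (simp add: lookup_sum coef_restr)
qed

lemma push_restr:
  "push h (restr (\<lambda>\<alpha>. Q (h \<alpha>)) g) = restr Q (push h g)"
proof -
  have "restr Q (push h g) = (\<Sum>\<alpha>\<in>supp g. if Q (h \<alpha>) then trm (h \<alpha>) (coef g \<alpha>) else 0)"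
    by (simp add: push_def restr_sum restr_trm)
  also have "\<dots> = (\<Sum>\<alpha>\<in>{\<alpha>\<in>supp g. Q (h \<alpha>)}. trm (h \<alpha>) (coef g \<alpha>))"
    by (simp add: sum.inter_filter)
  also have "\<dots> = push h (restr (\<lambda>\<alpha>. Q (h \<alpha>)) g)"
    unfolding push_def by (rule sum.cong) (auto simp: coef_restr)
  finally show ?thesis by simp
qed

subsection \<open>Evaluation\<close>

lemma prod_supp_superset:
  fixes a :: "'i \<Rightarrow> 'k::comm_ring_1"
  assumes "finite B" "supp \<alpha> \<subseteq> B"
  shows "(\<Prod>i\<in>supp \<alpha>. a i ^ coef \<alpha> i) = (\<Prod>i\<in>B. a i ^ coef \<alpha> i)"
  using assms by (intro prod.mono_neutral_left) (auto simp: in_keys_iff)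

lemma prod_supp_add:
  fixes a :: "'i \<Rightarrow> 'k::comm_ring_1"
  shows "(\<Prod>i\<in>supp (\<alpha> + \<beta>). a i ^ coef (\<alpha> + \<beta>) i)
    = (\<Prod>i\<in>supp \<alpha>. a i ^ coef \<alpha> i) * (\<Prod>i\<in>supp \<beta>. a i ^ coef \<beta> i)"
proof -
  let ?B = "supp \<alpha> \<union> supp \<beta>"
  have "(\<Prod>i\<in>supp (\<alpha> + \<beta>). a i ^ coef (\<alpha> + \<beta>) i) = (\<Prod>i\<in>?B. a i ^ coef (\<alpha> + \<beta>) i)"
    using keys_add[of \<alpha> \<beta>] by (intro prod_supp_superset) auto
  also have "\<dots> = (\<Prod>i\<in>?B. a i ^ coef \<alpha> i) * (\<Prod>i\<in>?B. a i ^ coef \<beta> i)"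
    by (simp add: lookup_add power_add prod.distrib)
  also have "(\<Prod>i\<in>?B. a i ^ coef \<alpha> i) = (\<Prod>i\<in>supp \<alpha>. a i ^ coef \<alpha> i)"
    by (intro prod_supp_superset[symmetric]) auto
  also have "(\<Prod>i\<in>?B. a i ^ coef \<beta> i) = (\<Prod>i\<in>supp \<beta>. a i ^ coef \<beta> i)"
    by (intro prod_supp_superset[symmetric]) auto
  finally show ?thesis .
qed

lemma peval_0 [simp]: "peval 0 a = 0" by (simp add: peval_def)

lemma peval_add: "peval (f + g) a = peval f a + peval g a"
  unfolding peval_def by (rule supp_sum_add) (auto simp: algebra_simps)

lemma peval_mult: "peval (f * g) a = peval f a * peval g a"
  unfolding peval_def by (rule supp_sum_mult) (auto simp: algebra_simps prod_supp_add)

lemma peval_term: "peval (trm \<alpha> c) a = c * (\<Prod>i\<in>supp \<alpha>. a i ^ coef \<alpha> i)"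
  unfolding peval_def by (rule supp_sum_term) auto

lemma peval_1 [simp]: "peval 1 a = 1"
  using peval_term[of 0 1 a] by simp

lemma peval_sum: "peval (sum g B) a = (\<Sum>b\<in>B. peval (g b) a)"
  by (induction B rule: infinite_finite_induct) (auto simp: peval_add)

lemma peval_uminus: "peval (- g) a = - peval g a"
  using peval_add[of "- g" g a] by (simp add: eq_neg_iff_add_eq_0)

lemma peval_diff: "peval (f - g) a = peval f a - peval g a"
  using peval_add[of f "- g" a] by (simp add: peval_uminus)

definition mon_weight :: "('i \<Rightarrow> int \<times> (int^'n)) \<Rightarrow> ('i \<Rightarrow>\<^sub>0 nat) \<Rightarrow> int \<times> (int^'n)" where
  "mon_weight u \<alpha> = (\<Sum>i\<in>supp \<alpha>. (int (coef \<alpha> i) * fst (u i), int (coef \<alpha> i) *s snd (u i)))"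

lemma mon_weight_add: "mon_weight u (\<alpha> + \<beta>) = mon_weight u \<alpha> + mon_weight u \<beta>"
  unfolding mon_weight_def
  by (rule supp_sum_add) (auto simp: algebra_simps zero_prod_def vector_sadd_rdistrib)

lemma mon_weight_0 [simp]: "mon_weight u 0 = 0" by (simp add: mon_weight_def)

lemma mon_weight_term: "mon_weight u (trm i n) = (int n * fst (u i), int n *s snd (u i))"
  unfolding mon_weight_def by (rule supp_sum_term) (auto simp: zero_prod_def)

lemma fst_mon_weight: "fst (mon_weight (\<lambda>i. (int (m i), \<eta> i)) \<alpha>) = int (wdeg m \<alpha>)"
  by (simp add: mon_weight_def wdeg_def fst_sum)

lemma peval_whomogeneous_scale:
  assumes "whomogeneous m d g"
  shows "peval g (\<lambda>i. \<xi> ^ m i * a i) = \<xi> ^ d * peval g a"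
proof -
  have "(\<Prod>i\<in>supp \<alpha>. (\<xi> ^ m i * a i) ^ coef \<alpha> i) = \<xi> ^ wdeg m \<alpha> * (\<Prod>i\<in>supp \<alpha>. a i ^ coef \<alpha> i)" for \<alpha>
    by (simp add: power_mult_distrib prod.distrib wdeg_def power_sum power_mult[symmetric] mult.commute)
  thus ?thesis using assms
    by (auto simp: peval_def whomogeneous_def sum_distrib_left intro!: sum.cong)
qed

lemma whomogeneous_restr [simp]: "whomogeneous m d (restr (\<lambda>\<alpha>. wdeg m \<alpha> = d) g)"
  by (auto simp: whomogeneous_def)

section \<open>The polynomial ring and its vanishing ideals\<close>

lemma poly_ring_simps [simp]:
  "mult (poly_ring I) = (*)" "one (poly_ring I) = 1" "zero (poly_ring I) = 0" "add (poly_ring I) = (+)"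
  by (simp_all add: poly_ring_def)

lemma poly_ring_carrier_iff: "g \<in> carrier (poly_ring I) \<longleftrightarrow> (\<forall>\<alpha>\<in>supp g. supp \<alpha> \<subseteq> I)"
  by (simp add: poly_ring_def)

lemma poly_ring_add_closed:
  "f \<in> carrier (poly_ring I) \<Longrightarrow> g \<in> carrier (poly_ring I) \<Longrightarrow> f + g \<in> carrier (poly_ring I)"
  using keys_add[of f g] by (auto simp: poly_ring_carrier_iff)

lemma poly_ring_mult_closed:
  assumes "f \<in> carrier (poly_ring I)" "g \<in> carrier (poly_ring I)"
  shows "f * g \<in> carrier (poly_ring I)"
  unfolding poly_ring_carrier_iff
proof
  fix \<gamma> assume "\<gamma> \<in> supp (f * g)"
  then obtain \<alpha> \<beta> where "\<gamma> = \<alpha> + \<beta>" "\<alpha> \<in> supp f" "\<beta> \<in> supp g" using keys_mult[of f g] by blast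
  thus "supp \<gamma> \<subseteq> I" using assms keys_add[of \<alpha> \<beta>] unfolding poly_ring_carrier_iff by blast
qed

lemma poly_ring_0_closed: "0 \<in> carrier (poly_ring I)"
  by (simp add: poly_ring_carrier_iff)

lemma poly_ring_1_closed: "1 \<in> carrier (poly_ring I)"
  by (simp add: poly_ring_carrier_iff)

lemma poly_ring_uminus_closed: "f \<in> carrier (poly_ring I) \<Longrightarrow> - f \<in> carrier (poly_ring I)"
  by (simp add: poly_ring_carrier_iff in_keys_iff)

lemma poly_ring_diff_closed:
  "f \<in> carrier (poly_ring I) \<Longrightarrow> g \<in> carrier (poly_ring I) \<Longrightarrow> f - g \<in> carrier (poly_ring I)"
  using poly_ring_add_closed[of f I "- g"] poly_ring_uminus_closed[of g I] by simp

lemma poly_ring_sum_closed: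
  "(\<And>b. b \<in> B \<Longrightarrow> g b \<in> carrier (poly_ring I)) \<Longrightarrow> sum g B \<in> carrier (poly_ring I)"
  by (induction B rule: infinite_finite_induct) (auto simp: poly_ring_0_closed poly_ring_add_closed)

lemma poly_ring_term_closed: "supp \<alpha> \<subseteq> I \<Longrightarrow> trm \<alpha> c \<in> carrier (poly_ring I)"
  by (auto simp: poly_ring_carrier_iff split: if_splits)

lemma poly_ring_restr_closed:
  "g \<in> carrier (poly_ring I) \<Longrightarrow> restr Q g \<in> carrier (poly_ring I)"
  by (auto simp: poly_ring_carrier_iff)

lemmas poly_ring_closed = poly_ring_add_closed poly_ring_mult_closed poly_ring_0_closed
  poly_ring_1_closed poly_ring_uminus_closed poly_ring_diff_closed poly_ring_sum_closed
  poly_ring_term_closed poly_ring_restr_closed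

lemma cring_poly_ring: "cring (poly_ring I :: ('i, 'k::comm_ring_1) mpoly ring)"
proof (rule cringI)
  show "abelian_group (poly_ring I :: ('i, 'k) mpoly ring)"
  proof (rule abelian_groupI)
    fix x :: "('i, 'k) mpoly" assume "x \<in> carrier (poly_ring I)"
    thus "\<exists>y\<in>carrier (poly_ring I). y \<oplus>\<^bsub>poly_ring I\<^esub> x = \<zero>\<^bsub>poly_ring I\<^esub>"
      by (intro bexI[of _ "- x"]) (auto intro: poly_ring_closed)
  qed (auto intro: poly_ring_closed simp: algebra_simps)
  show "Group.comm_monoid (poly_ring I :: ('i, 'k) mpoly ring)"
    by (rule comm_monoidI) (auto intro: poly_ring_closed simp: algebra_simps)
qed (simp add: algebra_simps)

lemma poly_ring_finsum:
  fixes g :: "'b \<Rightarrow> ('i, 'k::comm_ring_1) mpoly"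
  assumes "\<And>b. b \<in> B \<Longrightarrow> g b \<in> carrier (poly_ring I)"
  shows "finsum (poly_ring I) g B = sum g B"
proof -
  interpret cring "poly_ring I :: ('i, 'k) mpoly ring" by (rule cring_poly_ring)
  show ?thesis using assms
  proof (induction B rule: infinite_finite_induct)
    case (insert x F)
    have "finsum (poly_ring I) g (insert x F) = g x + finsum (poly_ring I) g F"
      using insert by (subst finsum_insert) (auto simp: Pi_def)
    thus ?case using insert by simp
  qed (auto simp: finsum_infinite)
qed

lemma poly_ring_pow: "g [^]\<^bsub>poly_ring I\<^esub> (n::nat) = g ^ n"
  for g :: "('i, 'k::comm_ring_1) mpoly"
proof -
  interpret cring "poly_ring I :: ('i, 'k) mpoly ring" by (rule cring_poly_ring)
  show ?thesis by (induction n) (auto simp: nat_pow_def mult.commute)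
qed

lemma pow_var: "(trm (trm i 1) 1 :: ('i, 'k::comm_ring_1) mpoly) ^ n = trm (trm i n) 1"
  by (induction n) (auto simp: mult_single single_add[symmetric])

text \<open>This links the type-class monomials to the products that \<open>alg_eval\<close> forms in the ring record.\<close>

lemma monomial_finprod:
  assumes "finite I" "supp \<alpha> \<subseteq> I"
  shows "(\<Otimes>\<^bsub>poly_ring I\<^esub>i\<in>I. (trm (trm i 1) 1) [^]\<^bsub>poly_ring I\<^esub> coef \<alpha> i)
    = (trm \<alpha> 1 :: ('i, 'k::comm_ring_1) mpoly)"
proof -
  interpret cring "poly_ring I :: ('i, 'k) mpoly ring" by (rule cring_poly_ring)
  let ?x = "\<lambda>i. trm (trm i (coef \<alpha> i)) 1 :: ('i, 'k) mpoly"
  have "(\<Otimes>\<^bsub>poly_ring I\<^esub>i\<in>B. ?x i) = trm (\<Sum>i\<in>B. trm i (coef \<alpha> i)) 1" if "finite B" "B \<subseteq> I" for B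
    using that
  proof (induction B rule: finite_induct)
    case (insert i B)
    have "(\<Otimes>\<^bsub>poly_ring I\<^esub>i\<in>insert i B. ?x i) = ?x i * (\<Otimes>\<^bsub>poly_ring I\<^esub>i\<in>B. ?x i)"
      using insert by (subst finprod_insert) (auto intro!: poly_ring_closed split: if_splits)
    thus ?case using insert by (simp add: mult_single)
  qed auto
  moreover have "(\<Sum>i\<in>I. trm i (coef \<alpha> i)) = \<alpha>"
    using supp_sum_superset[OF assms, of trm] by (simp add: sum_of_terms)
  ultimately show ?thesis using assms by (simp add: poly_ring_pow pow_var del: One_nat_def)
qed

text \<open>Both the coordinate ring of the cone and the graded ring are recognised as commutative rings by
  mapping a polynomial ring onto them.\<close>

lemma cring_hom_image:
  fixes R :: "('a, 'c) ring_scheme" and S :: "('b, 'd) ring_scheme"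
  assumes "cring R" and h: "h \<in> ring_hom R S"
    and onto: "carrier S = h ` carrier R" and zero: "\<zero>\<^bsub>S\<^esub> = h \<zero>\<^bsub>R\<^esub>"
  shows "cring S"
proof -
  interpret R: cring R by fact
  have "S\<lparr>carrier := h ` carrier R, zero := h \<zero>\<^bsub>R\<^esub>\<rparr> = S" by (simp add: onto[symmetric] zero[symmetric])
  hence ring: "ring S" using R.ring_hom_imp_img_ring[OF h] by simp
  have "x \<otimes>\<^bsub>S\<^esub> y = y \<otimes>\<^bsub>S\<^esub> x" if xy: "x \<in> carrier S" "y \<in> carrier S" for x y
  proof -
    obtain a b where ab: "a \<in> carrier R" "x = h a" "b \<in> carrier R" "y = h b"
      using xy unfolding onto by (elim imageE)
    show ?thesis
      unfolding ab(2,4) ring_hom_mult[OF h ab(1,3), symmetric] ring_hom_mult[OF h ab(3,1), symmetric]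
      by (simp only: R.m_comm[OF ab(1,3)])
  qed
  with ring show ?thesis
    by (intro cring.intro monoid.monoid_comm_monoidI ring.is_monoid)
qed

text \<open>The definition of \<open>alg_eval\<close> uses finite sums and products in the target, which can be computed
  only when the target is known to be a commutative ring. This turns both presentations into explicit
  maps on polynomials.\<close>

lemma alg_eval_hom:
  fixes h :: "('i, 'k::field) mpoly \<Rightarrow> 'b" and R :: "('k, 'b) module"
  assumes "cring R" and hom: "h \<in> ring_hom (poly_ring I) R" and fin: "finite I"
    and smult: "\<And>\<alpha> c. supp \<alpha> \<subseteq> I \<Longrightarrow> h (trm \<alpha> c) = c \<odot>\<^bsub>R\<^esub> h (trm \<alpha> 1)"
    and vars: "\<And>i. i \<in> I \<Longrightarrow> y i = h (trm (trm i 1) 1)"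
    and g: "g \<in> carrier (poly_ring I)"
  shows "alg_eval R I y g = h g"
proof -
  interpret P: cring "poly_ring I :: ('i, 'k) mpoly ring" by (rule cring_poly_ring)
  interpret R: cring R by fact
  interpret ring_hom_cring "poly_ring I" R h
    using hom by (intro ring_hom_cring.intro ring_hom_cring_axioms.intro P.is_cring R.is_cring)
  have v: "trm (trm i 1) 1 \<in> carrier (poly_ring I)" if "i \<in> I" for i
    using that by (auto intro: poly_ring_closed)
  have hom_pow: "h (a [^]\<^bsub>poly_ring I\<^esub> (n::nat)) = h a [^]\<^bsub>R\<^esub> n" if "a \<in> carrier (poly_ring I)" for a n
    using that by (induction n) (simp_all add: poly_ring_pow[symmetric] del: poly_ring_simps)
  have mon: "(\<Otimes>\<^bsub>R\<^esub>i\<in>I. y i [^]\<^bsub>R\<^esub> coef \<alpha> i) = h (trm \<alpha> 1)" if "supp \<alpha> \<subseteq> I" for \<alpha>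
  proof -
    have "(\<Otimes>\<^bsub>R\<^esub>i\<in>I. y i [^]\<^bsub>R\<^esub> coef \<alpha> i)
        = (\<Otimes>\<^bsub>R\<^esub>i\<in>I. h (trm (trm i 1) 1 [^]\<^bsub>poly_ring I\<^esub> coef \<alpha> i))"
      using v vars
      by (intro R.finprod_cong') (auto simp: hom_pow Pi_def simp del: One_nat_def intro!: hom_closed)
    also have "\<dots> = h (\<Otimes>\<^bsub>poly_ring I\<^esub>i\<in>I. trm (trm i 1) 1 [^]\<^bsub>poly_ring I\<^esub> coef \<alpha> i)"
      using v by (subst hom_finprod) (auto simp: Pi_def o_def simp del: poly_ring_pow)
    also have "\<dots> = h (trm \<alpha> 1)" by (simp only: monomial_finprod[OF fin that])
    finally show ?thesis .
  qed
  have s: "supp \<alpha> \<subseteq> I" if "\<alpha> \<in> supp g" for \<alpha> using g that by (auto simp: poly_ring_carrier_iff)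
  have "alg_eval R I y g = (\<Oplus>\<^bsub>R\<^esub>\<alpha>\<in>supp g. h (trm \<alpha> (coef g \<alpha>)))"
    unfolding alg_eval_def using s
    by (intro R.finsum_cong') (auto simp: mon smult[symmetric] intro!: hom_closed poly_ring_closed)
  also have "\<dots> = h (\<Oplus>\<^bsub>poly_ring I\<^esub>\<alpha>\<in>supp g. trm \<alpha> (coef g \<alpha>))"
    using s by (subst hom_finsum) (auto simp: o_def intro!: poly_ring_closed)
  also have "(\<Oplus>\<^bsub>poly_ring I\<^esub>\<alpha>\<in>supp g. trm \<alpha> (coef g \<alpha>)) = g"
    using s by (subst poly_ring_finsum) (auto simp: sum_of_terms intro!: poly_ring_closed)
  finally show ?thesis .
qed

lemma ideal_sum_closed:
  assumes "ideal J (poly_ring I)" "\<And>b. b \<in> B \<Longrightarrow> g b \<in> J"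
  shows "sum g B \<in> (J :: ('i, 'k::comm_ring_1) mpoly set)"
proof -
  interpret ideal J "poly_ring I" by fact
  have "0 \<in> J" using additive_subgroup.zero_closed[OF additive_subgroup_axioms] by simp
  moreover have "a + b \<in> J" if "a \<in> J" "b \<in> J" for a b using additive_subgroup.a_closed[OF additive_subgroup_axioms that] by simp
  ultimately show ?thesis using assms(2) by (induction B rule: infinite_finite_induct) auto
qed

lemma ideal_of_homogeneous_components:
  assumes "ideal J (poly_ring I)" "\<And>d. restr (\<lambda>\<alpha>. wdeg m \<alpha> = d) g \<in> J"
  shows "g \<in> J"
proof -
  have "(\<Sum>d\<in>wdeg m ` supp g. restr (\<lambda>\<alpha>. wdeg m \<alpha> = d) g) \<in> J"
    using assms by (intro ideal_sum_closed)
  thus ?thesis by (subst (asm) sum_restr) auto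
qed

text \<open>The hypothesis \<open>sep\<close> holds as soon as \<open>J\<close> consists of all polynomials that vanish on some set of
  points representing elements of \<open>V(J)\<close>. Then \<open>J\<close> is recovered from \<open>V(J)\<close>, because a
  homogeneous ideal is generated by its homogeneous elements.\<close>

lemma vanishing_ideal_vanishing_locus:
  fixes J :: "('i, 'k::field) mpoly set"
  assumes J: "homogeneous_ideal I m J"
    and sep: "\<And>g d. g \<in> carrier (poly_ring I) \<Longrightarrow> whomogeneous m d g \<Longrightarrow>
       \<forall>y\<in>vanishing_locus I m J. \<forall>a\<in>y. peval g a = 0 \<Longrightarrow> g \<in> J"
  shows "vanishing_ideal I m (vanishing_locus I m J) = J"
proof
  interpret P: cring "poly_ring I :: ('i, 'k) mpoly ring" by (rule cring_poly_ring)
  let ?G = "{g\<in>carrier (poly_ring I). (\<exists>d. whomogeneous m d g) \<and>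
    (\<forall>y\<in>vanishing_locus I m J. \<forall>a\<in>y. peval g a = 0)}"
  have idJ: "ideal J (poly_ring I)" using J by (simp add: homogeneous_ideal_def select_terms_eq_restr)
  show "vanishing_ideal I m (vanishing_locus I m J) \<subseteq> J"
    unfolding vanishing_ideal_def using sep by (intro P.genideal_minimal[OF idJ]) auto
  have sub: "?G \<subseteq> carrier (poly_ring I)" by blast
  have idG: "ideal (genideal (poly_ring I) ?G) (poly_ring I)" by (rule P.genideal_ideal[OF sub])
  show "J \<subseteq> vanishing_ideal I m (vanishing_locus I m J)"
  proof
    fix g assume g: "g \<in> J"
    interpret J: ideal J "poly_ring I" by (rule idJ)
    have comp: "restr (\<lambda>\<alpha>. wdeg m \<alpha> = d) g \<in> J" for d
      using J g by (simp add: homogeneous_ideal_def select_terms_eq_restr)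
    have hom: "h \<in> ?G" if "h \<in> J" "whomogeneous m d h" for h d
      using that J.Icarr by (auto simp: vanishing_locus_def)
    have "restr (\<lambda>\<alpha>. wdeg m \<alpha> = d) g \<in> ?G" for d
      by (rule hom[OF comp whomogeneous_restr])
    hence "restr (\<lambda>\<alpha>. wdeg m \<alpha> = d) g \<in> genideal (poly_ring I) ?G" for d
      using subsetD[OF P.genideal_self[OF sub]] by blast
    thus "g \<in> vanishing_ideal I m (vanishing_locus I m J)"
      unfolding vanishing_ideal_def by (rule ideal_of_homogeneous_components[OF idG])
  qed
qed

section \<open>Characters of the extended torus\<close>

definition pairing :: "int \<times> (int^'n) \<Rightarrow> int \<times> (int^'n) \<Rightarrow> int" where
  "pairing k w = fst k * fst w + (\<Sum>i\<in>UNIV. snd k $ i * snd w $ i)"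

lemma pairing_add_left: "pairing (k + k') w = pairing k w + pairing k' w"
  by (simp add: pairing_def algebra_simps sum.distrib)

lemma pairing_diff_right: "pairing k (w - w') = pairing k w - pairing k w'"
  by (simp add: pairing_def algebra_simps sum_subtractf)

lemma pairing_scale: "pairing (N * fst k, N *s snd k) w = N * pairing k w"
  by (simp add: pairing_def algebra_simps sum_distrib_left)

lemma pairing_self: "d \<noteq> 0 \<Longrightarrow> pairing d d \<noteq> 0"
proof -
  assume d: "d \<noteq> 0"
  have n: "0 \<le> (\<Sum>i\<in>UNIV. snd d $ i * snd d $ i)" by (intro sum_nonneg) auto
  have "pairing d d > 0"
  proof (cases "fst d = 0")
    case True
    then obtain i where "snd d $ i \<noteq> 0" using d by (auto simp: prod_eq_iff vec_eq_iff)
    hence "0 < (\<Sum>i\<in>UNIV. snd d $ i * snd d $ i)"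
      by (intro sum_pos2[of UNIV i]) (auto simp: not_square_less_zero zero_less_mult_iff)
    thus ?thesis using True by (simp add: pairing_def)
  next
    case False
    hence "0 < fst d * fst d" by (auto simp: zero_less_mult_iff)
    thus ?thesis using n by (simp add: pairing_def)
  qed
  thus ?thesis by simp
qed

text \<open>A one-parameter subgroup avoiding finitely many hyperplanes: a large multiple of a solution for
  the smaller set is perturbed in the direction of the new vector.\<close>

lemma ex_generic_pairing:
  assumes "finite D" "0 \<notin> D"
  shows "\<exists>k. \<forall>d\<in>D. pairing k d \<noteq> 0"
  using assms
proof (induction D rule: finite_induct)
  case (insert d D)
  then obtain k where k: "\<forall>x\<in>D. pairing k x \<noteq> 0" by auto
  define N where "N = 1 + (\<Sum>x\<in>insert d D. \<bar>pairing d x\<bar>)"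
  have N: "\<bar>pairing d x\<bar> < N" if "x \<in> insert d D" for x
    using member_le_sum[OF that, of "\<lambda>x. \<bar>pairing d x\<bar>"] insert(1) by (simp add: N_def)
  let ?k = "(N * fst k, N *s snd k) + d"
  have "pairing ?k x \<noteq> 0" if "x \<in> insert d D" for x
  proof (cases "pairing k x = 0")
    case True
    hence "x = d" using that k by auto
    thus ?thesis using True pairing_self[of d] insert.prems by (auto simp: pairing_add_left pairing_scale)
  next
    case False
    have "N \<le> \<bar>N * pairing k x\<bar>"
      using False N[OF that] by (simp add: abs_mult) (smt (verit, best) mult_le_cancel_left1)
    thus ?thesis using N[OF that] by (simp add: pairing_add_left pairing_scale)
  qed
  thus ?case by blast
qed auto

lemma torus_char_add: "t \<in> torus \<Longrightarrow> torus_char (\<eta> + \<zeta>) t = torus_char \<eta> t * torus_char \<zeta> t"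
  by (simp add: torus_char_def torus_def power_int_add prod.distrib)

lemma torus_char_0 [simp]: "torus_char 0 t = 1"
  by (simp add: torus_char_def)

lemma ext_char_add: "s \<in> ext_torus \<Longrightarrow> ext_char (u + w) s = ext_char u s * ext_char w s"
  by (auto simp: ext_char_def ext_torus_def torus_char_add power_int_add)

lemma ext_char_0 [simp]: "ext_char 0 s = 1"
  by (simp add: ext_char_def)

lemma ext_char_nonzero: "s \<in> ext_torus \<Longrightarrow> ext_char w s \<noteq> 0"
  by (auto simp: ext_char_def ext_torus_def torus_def torus_char_def)

lemma ext_char_uminus: "s \<in> ext_torus \<Longrightarrow> ext_char (- w) s = inverse (ext_char w s)"
  using ext_char_add[of s w "- w"] ext_char_nonzero[of s w] by (simp add: field_simps)

lemma ext_char_ext_inverse: "ext_char w (ext_inverse s) = inverse (ext_char w s)"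
  by (simp add: ext_char_def ext_inverse_def torus_char_def power_int_inverse prod_inversef[symmetric])

lemma ext_inverse_in_torus: "s \<in> ext_torus \<Longrightarrow> ext_inverse s \<in> ext_torus"
  by (auto simp: ext_inverse_def ext_torus_def torus_def)

lemma power_int_sum: "z \<noteq> 0 \<Longrightarrow> z powi (\<Sum>i\<in>B. h i) = (\<Prod>i\<in>B. (z::'k::field) powi h i)"
  by (induction B rule: infinite_finite_induct) (auto simp: power_int_add)

lemma ext_char_one_parameter:
  assumes "z \<noteq> 0"
  shows "ext_char w (z powi fst k, \<chi> i. z powi (snd k $ i)) = z powi pairing k w"
  using assms by (simp add: ext_char_def torus_char_def pairing_def power_int_add power_int_sum power_int_mult)

text \<open>Elements of the group algebra of \<open>\<int> \<times> M\<close> as functions on the extended torus.\<close>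

definition char_sum :: "(int \<times> (int^'n) \<Rightarrow>\<^sub>0 'k::field) \<Rightarrow> 'k \<times> ('k^'n) \<Rightarrow> 'k" where
  "char_sum c s = (\<Sum>w\<in>supp c. coef c w * ext_char w s)"

lemma char_sum_0 [simp]: "char_sum 0 s = 0" by (simp add: char_sum_def)

lemma char_sum_add: "char_sum (c + d) s = char_sum c s + char_sum d s"
  unfolding char_sum_def by (rule supp_sum_add) (auto simp: algebra_simps)

lemma char_sum_diff: "char_sum (c - d) s = char_sum c s - char_sum d s"
  using char_sum_add[of "c - d" d s] by simp

lemma char_sum_term: "char_sum (trm w x) s = x * ext_char w s"
  unfolding char_sum_def by (rule supp_sum_term) auto

lemma char_sum_sum: "char_sum (sum c B) s = (\<Sum>b\<in>B. char_sum (c b) s)"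
  by (induction B rule: infinite_finite_induct) (auto simp: char_sum_add)

text \<open>Along a generic one-parameter subgroup the exponents stay distinct, so that a nonzero sum of
  characters becomes a nonzero Laurent polynomial in one variable, with finitely many zeros. Two such
  sums can be treated at once; this gives both the independence of characters and the irreducibility
  of the torus.\<close>

lemma char_sum_common_nonzero:
  fixes c d :: "int \<times> (int^'n) \<Rightarrow>\<^sub>0 'k::field_char_0"
  assumes "c \<noteq> 0" "d \<noteq> 0"
  shows "\<exists>s\<in>ext_torus. char_sum c s \<noteq> 0 \<and> char_sum d s \<noteq> 0"
proof -
  define U where "U = supp c \<union> supp d"
  have finU: "finite U" by (simp add: U_def)
  define D where "D = (\<lambda>(u, v). u - v) ` {(u, v)\<in>U \<times> U. u \<noteq> v}"
  have "finite {(u, v)\<in>U \<times> U. u \<noteq> v}" using finU by (auto intro: finite_subset[of _ "U \<times> U"])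
  hence "finite D" "0 \<notin> D" by (auto simp: D_def zero_prod_def)
  then obtain k where k: "\<forall>x\<in>D. pairing k x \<noteq> 0" using ex_generic_pairing by blast
  have inj: "pairing k u \<noteq> pairing k v" if "u \<in> U" "v \<in> U" "u \<noteq> v" for u v
  proof -
    have "u - v \<in> D" using that by (force simp: D_def)
    hence "pairing k (u - v) \<noteq> 0" using k by blast
    thus ?thesis by (simp add: pairing_diff_right)
  qed
  \<comment> \<open>multiplication by \<open>z\<^sup>N\<close> clears the negative exponents\<close>
  define N where "N = nat (\<Sum>u\<in>U. \<bar>pairing k u\<bar>)"
  have N: "0 \<le> pairing k u + int N" if "u \<in> U" for u
    using member_le_sum[OF that, of "\<lambda>x. \<bar>pairing k x\<bar>"] finU by (simp add: N_def)
  define Q where "Q e = (\<Sum>w\<in>supp e. monom (coef e w) (nat (pairing k w + int N)))"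
    for e :: "int \<times> (int^'n) \<Rightarrow>\<^sub>0 'k"
  have Q0: "Q e \<noteq> 0" if "e \<noteq> 0" "supp e \<subseteq> U" for e
  proof -
    from that(1) obtain w where w: "w \<in> supp e" by (metis ex_in_conv keys_eq_empty)
    have "coeff (Q e) (nat (pairing k w + int N)) = (\<Sum>v\<in>supp e. if v = w then coef e v else 0)"
      unfolding Q_def coeff_sum
    proof (rule sum.cong[OF refl])
      fix v assume v: "v \<in> supp e"
      have vU: "v \<in> U" and wU: "w \<in> U" using v w that(2) by auto
      have "nat (pairing k v + int N) = nat (pairing k w + int N) \<longleftrightarrow> pairing k v = pairing k w"
        using N[OF vU] N[OF wU] by (simp add: eq_nat_nat_iff)
      also have "\<dots> \<longleftrightarrow> v = w" using inj[OF vU wU] by blast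
      finally have "nat (pairing k v + int N) = nat (pairing k w + int N) \<longleftrightarrow> v = w" .
      thus "coeff (monom (coef e v) (nat (pairing k v + int N))) (nat (pairing k w + int N))
          = (if v = w then coef e v else 0)" by auto
    qed
    also have "\<dots> = coef e w" using w by simp
    finally show ?thesis using w by (auto simp: in_keys_iff)
  qed
  have Qz: "poly (Q e) z = z ^ N * char_sum e (z powi fst k, \<chi> i. z powi (snd k $ i))"
    if "z \<noteq> 0" "supp e \<subseteq> U" for e z
  proof -
    have "z ^ nat (pairing k w + int N) = z ^ N * z powi pairing k w" if "w \<in> supp e" for w
    proof -
      have "z ^ nat (pairing k w + int N) = z powi (pairing k w + int N)"
        using N[of w] that \<open>supp e \<subseteq> U\<close> by (auto simp: power_int_def)
      thus ?thesis using \<open>z \<noteq> 0\<close> by (simp add: power_int_add)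
    qed
    thus ?thesis using \<open>z \<noteq> 0\<close>
      by (simp add: Q_def poly_sum poly_monom char_sum_def ext_char_one_parameter sum_distrib_left mult_ac)
  qed
  have "Q c * Q d * [:0, 1:] \<noteq> 0" using assms Q0 by (auto simp: U_def)
  hence "finite {z. poly (Q c * Q d * [:0, 1:]) z = 0}" by (rule poly_roots_finite)
  hence "{z. poly (Q c * Q d * [:0, 1:]) z = 0} \<noteq> (UNIV :: 'k set)"
    using infinite_UNIV_char_0[where 'a = 'k] by metis
  then obtain z where "poly (Q c * Q d * [:0, 1:]) z \<noteq> 0" by blast
  hence z: "z \<noteq> 0" "poly (Q c) z \<noteq> 0" "poly (Q d) z \<noteq> 0" by auto
  have "(z powi fst k, \<chi> i. z powi (snd k $ i)) \<in> ext_torus"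
    using z by (auto simp: ext_torus_def torus_def)
  moreover have "supp c \<subseteq> U" "supp d \<subseteq> U" by (auto simp: U_def)
  ultimately show ?thesis using z Qz[of z c] Qz[of z d] by force
qed

lemma char_sum_eq_0_imp:
  fixes c :: "int \<times> (int^'n) \<Rightarrow>\<^sub>0 'k::field_char_0"
  assumes "\<And>s. s \<in> ext_torus \<Longrightarrow> char_sum c s = 0"
  shows "c = 0"
  using char_sum_common_nonzero[of c c] assms by blast

section \<open>The coordinate ring of the cone as a monoid algebra\<close>

abbreviation cone_weight :: "(int^'n \<Rightarrow>\<^sub>0 nat) \<Rightarrow> int \<times> (int^'n)" where
  "cone_weight \<equiv> mon_weight (Pair 1)"

text \<open>The monoid algebra \<open>K[S]\<close>, as a subset of the group algebra of \<open>\<int> \<times> M\<close>.\<close>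

definition monoid_algebra :: "(real^'n) set \<Rightarrow> (int \<times> (int^'n) \<Rightarrow>\<^sub>0 'k::comm_ring_1) set" where
  "monoid_algebra P = {d. supp d \<subseteq> weight_monoid P}"

definition torus_point :: "(real^'n) set \<Rightarrow> 'k::field \<times> ('k^'n) \<Rightarrow> int^'n \<Rightarrow> 'k" where
  "torus_point P s = (\<lambda>\<eta>. if \<eta> \<in> lattice_points P then fst s * torus_char \<eta> (snd s) else 0)"

lemma ext_char_sum: "s \<in> ext_torus \<Longrightarrow> ext_char (\<Sum>i\<in>B. w i) s = (\<Prod>i\<in>B. ext_char (w i) s)"
  by (induction B rule: infinite_finite_induct) (auto simp: ext_char_add)

lemma ext_char_scale:
  assumes "s \<in> ext_torus"
  shows "ext_char (int n * fst w, int n *s snd w) s = ext_char w s ^ n"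
proof -
  have "(int n * fst w, int n *s snd w) = (\<Sum>i<n. w)"
  proof (induction n)
    case (Suc n)
    have "(int (Suc n) * fst w, int (Suc n) *s snd w) = (int n * fst w, int n *s snd w) + w"
      by (simp add: prod_eq_iff algebra_simps vector_sadd_rdistrib)
    thus ?case using Suc by simp
  qed (simp add: zero_prod_def)
  thus ?thesis using ext_char_sum[OF assms, of "\<lambda>_. w" "{..<n}"] by simp
qed

lemma ext_char_mon_weight:
  assumes "s \<in> ext_torus"
  shows "ext_char (mon_weight u \<alpha>) s = (\<Prod>i\<in>supp \<alpha>. ext_char (u i) s ^ coef \<alpha> i)"
  unfolding mon_weight_def by (simp add: ext_char_sum[OF assms] ext_char_scale[OF assms])

lemma ext_act_monomial:
  assumes "s \<in> ext_torus"
  shows "(\<Prod>i\<in>supp \<alpha>. ext_act s v i ^ coef \<alpha> i)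
    = ext_char (cone_weight \<alpha>) s * (\<Prod>i\<in>supp \<alpha>. v i ^ coef \<alpha> i)"
proof -
  have "ext_act s v i = ext_char (1, i) s * v i" for i
    by (simp add: ext_act_def ext_char_def)
  thus ?thesis by (simp add: power_mult_distrib prod.distrib ext_char_mon_weight[OF assms])
qed

text \<open>A polynomial in the coordinates \<open>x\<^sub>\<chi>\<close> becomes on the torus a sum of characters; collecting equal
  characters is exactly \<open>push cone_weight\<close>.\<close>

lemma peval_torus_point:
  assumes "G \<in> carrier (poly_ring (lattice_points P))" "s \<in> ext_torus"
  shows "peval G (torus_point P s) = char_sum (push cone_weight G) s"
proof -
  have "(\<Prod>i\<in>supp \<alpha>. torus_point P s i ^ coef \<alpha> i) = ext_char (cone_weight \<alpha>) s"
    if "\<alpha> \<in> supp G" for \<alpha>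
  proof -
    have "supp \<alpha> \<subseteq> lattice_points P" using that assms(1) by (auto simp: poly_ring_carrier_iff)
    hence "torus_point P s i = ext_char (1, i) s" if "i \<in> supp \<alpha>" for i
      using that by (auto simp: torus_point_def ext_char_def)
    thus ?thesis by (simp add: ext_char_mon_weight[OF assms(2)])
  qed
  thus ?thesis by (simp add: peval_def push_def char_sum_sum char_sum_term)
qed

subsection \<open>The ideal of the cone\<close>

lemma vanishing_ideal_vanishes:
  fixes Y :: "('i \<Rightarrow> 'k::field) set set"
  assumes "g \<in> vanishing_ideal I m Y"
    and "\<And>h d. h \<in> carrier (poly_ring I) \<Longrightarrow> whomogeneous m d h \<Longrightarrow> \<forall>y\<in>Y. \<forall>a\<in>y. peval h a = 0
      \<Longrightarrow> peval h b = 0"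
  shows "peval g b = 0"
proof -
  interpret cring "poly_ring I :: ('i, 'k) mpoly ring" by (rule cring_poly_ring)
  let ?J = "{h \<in> carrier (poly_ring I). peval h b = 0}"
  have "ideal ?J (poly_ring I)"
  proof (rule idealI)
    show "subgroup ?J (add_monoid (poly_ring I))"
    proof
      fix x assume x: "x \<in> ?J"
      hence "inv\<^bsub>add_monoid (poly_ring I)\<^esub> x = - x"
        using minus_equality[of "- x" x] by (auto simp: a_inv_def intro: poly_ring_closed)
      thus "inv\<^bsub>add_monoid (poly_ring I)\<^esub> x \<in> ?J"
        using x by (auto simp: peval_uminus intro: poly_ring_closed)
    qed (auto simp: peval_add intro: poly_ring_closed)
  qed (auto simp: peval_mult ring_axioms intro: poly_ring_closed)
  hence "vanishing_ideal I m Y \<subseteq> ?J"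
    unfolding vanishing_ideal_def using assms(2) by (intro genideal_minimal) auto
  thus ?thesis using assms(1) by auto
qed

lemma wpoint_self: "a \<in> wpoint m a"
  unfolding wpoint_def by (intro CollectI exI[of _ 1]) auto

lemma whomogeneous_degree_0:
  assumes "whomogeneous (\<lambda>_. 1) 0 g"
  shows "g = trm 0 (coef g 0)"
proof -
  have "\<alpha> = 0" if "\<alpha> \<in> supp g" for \<alpha>
  proof -
    have "(\<Sum>i\<in>supp \<alpha>. coef \<alpha> i) = 0" using assms that by (auto simp: whomogeneous_def wdeg_def)
    hence "\<forall>i\<in>supp \<alpha>. coef \<alpha> i = 0" by simp
    hence "supp \<alpha> = {}" by (meson all_not_in_conv in_keys_iff)
    thus ?thesis by simp
  qed
  thus ?thesis by (intro poly_mapping_eqI) (auto simp: lookup_single when_def in_keys_iff)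
qed

text \<open>The kernel of \<open>push cone_weight\<close> is stable under taking homogeneous components. A component of it
  vanishes on the torus orbit, hence belongs to the ideal that defines the closure; the origin has to
  be treated separately, since it lies on the cone but represents no projective point.\<close>

lemma toric_ideal_vanishes_on_cone:
  fixes G :: "(int^'n, 'k::field_char_0) mpoly"
  assumes G: "G \<in> carrier (poly_ring (lattice_points P))" and push: "push cone_weight G = 0"
    and v: "v \<in> affine_cone P"
  shows "peval G v = 0"
proof -
  let ?\<Lambda> = "lattice_points P"
  have cw: "fst (cone_weight \<alpha>) = int (wdeg (\<lambda>_. 1) \<alpha>)" for \<alpha> :: "int^'n \<Rightarrow>\<^sub>0 nat"
    using fst_mon_weight[of "\<lambda>_. 1" "\<lambda>i. i" \<alpha>] by simp
  have hom: "peval H v = 0" if H: "H \<in> carrier (poly_ring ?\<Lambda>)" "whomogeneous (\<lambda>_. 1) d H"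
    "push cone_weight H = 0" for H d
  proof (cases "v = (\<lambda>_. 0)")
    case True
    show ?thesis
    proof (cases "d = 0")
      case True
      hence H0: "H = trm 0 (coef H 0)" using H whomogeneous_degree_0 by blast
      hence "push cone_weight H = trm 0 (coef H 0)" by (metis push_term mon_weight_0)
      hence "coef H 0 = 0" using H(3) by (metis lookup_single_eq lookup_zero)
      thus ?thesis using H0 by (metis single_zero peval_0)
    next
      case False
      have "peval H v = 0 ^ d * peval H v"
        using peval_whomogeneous_scale[OF H(2), of 0 v] True by simp
      thus ?thesis using False by (simp add: power_0_left)
    qed
  next
    case False
    have "peval H a = 0" if t: "t \<in> torus"
      and a: "a \<in> wpoint (\<lambda>_. 1) (\<lambda>\<eta>. if \<eta> \<in> ?\<Lambda> then torus_char \<eta> t else 0)" for a t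
    proof -
      obtain \<xi> where "\<xi> \<noteq> 0" "a = torus_point P (\<xi>, t)"
        using a by (auto simp: wpoint_def torus_point_def fun_eq_iff)
      moreover have "(\<xi>, t) \<in> ext_torus" using \<open>\<xi> \<noteq> 0\<close> t by (simp add: ext_torus_def)
      ultimately show ?thesis using peval_torus_point[OF H(1)] H(3) by simp
    qed
    hence mem: "H \<in> {g \<in> carrier (poly_ring ?\<Lambda>). (\<exists>d. whomogeneous (\<lambda>_. 1) d g) \<and>
      (\<forall>y\<in>{wpoint (\<lambda>_. 1) (\<lambda>\<eta>. if \<eta> \<in> ?\<Lambda> then torus_char \<eta> t else 0) |t. t \<in> torus}.
         \<forall>a\<in>y. peval g a = 0)}"
      using H(1,2) by blast
    interpret cring "poly_ring ?\<Lambda> :: (int^'n, 'k) mpoly ring" by (rule cring_poly_ring)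
    have "H \<in> vanishing_ideal ?\<Lambda> (\<lambda>_. 1)
        {wpoint (\<lambda>_. 1) (\<lambda>\<eta>. if \<eta> \<in> ?\<Lambda> then torus_char \<eta> t else 0) |t. t \<in> torus}"
      unfolding vanishing_ideal_def by (rule subsetD[OF genideal_self mem]) auto
    thus ?thesis using False v wpoint_self[of v "\<lambda>_. 1"]
      by (auto simp: affine_cone_def toric_variety_def zariski_closure_def vanishing_locus_def)
  qed
  have "peval (restr (\<lambda>\<alpha>. wdeg (\<lambda>_. 1) \<alpha> = d) G) v = 0" for d
  proof (rule hom[where d = d])
    have "(\<lambda>\<alpha>. wdeg (\<lambda>_. 1) \<alpha> = d) = (\<lambda>\<alpha>::int^'n \<Rightarrow>\<^sub>0 nat. fst (cone_weight \<alpha>) = int d)"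
      by (auto simp: cw)
    thus "push cone_weight (restr (\<lambda>\<alpha>. wdeg (\<lambda>_. 1) \<alpha> = d) G) = 0"
      using push_restr[where h = cone_weight and g = G and Q = "\<lambda>w. fst w = int d"] push by simp
  qed (auto intro: poly_ring_closed G)
  hence "peval (\<Sum>d\<in>wdeg (\<lambda>_. 1) ` supp G. restr (\<lambda>\<alpha>. wdeg (\<lambda>_. 1) \<alpha> = d) G) v = 0"
    by (simp add: peval_sum)
  thus ?thesis by (subst (asm) sum_restr) auto
qed

text \<open>Points of the closure are defined through an ideal generated by homogeneous polynomials. Independence
  of characters shows that these generators lie in the kernel of \<open>push cone_weight\<close>, which gives a
  description of the cone that can be used weight by weight.\<close>

lemma affine_cone_iff:
  fixes v :: "int^'n \<Rightarrow> 'k::field_char_0"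
  shows "v \<in> affine_cone P \<longleftrightarrow> v \<in> affine_space (lattice_points P) \<and>
     (\<forall>G\<in>carrier (poly_ring (lattice_points P)). push cone_weight G = 0 \<longrightarrow> peval G v = 0)"
    (is "_ \<longleftrightarrow> ?R")
proof
  assume "v \<in> affine_cone P"
  thus ?R using toric_ideal_vanishes_on_cone by (auto simp: affine_cone_def)
next
  assume R: ?R
  let ?\<Lambda> = "lattice_points P"
  let ?Y = "{wpoint (\<lambda>_. 1) (\<lambda>\<eta>. if \<eta> \<in> ?\<Lambda> then torus_char \<eta> t else 0 :: 'k) |t. t \<in> torus}"
  have "peval g a = 0" if g: "g \<in> vanishing_ideal ?\<Lambda> (\<lambda>_. 1) ?Y" and a: "a \<in> wpoint (\<lambda>_. 1) v" for g a
    using g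
  proof (rule vanishing_ideal_vanishes)
    fix h d assume h: "h \<in> carrier (poly_ring ?\<Lambda>)" "whomogeneous (\<lambda>_. 1) d h"
      "\<forall>y\<in>?Y. \<forall>a\<in>y. peval h a = 0"
    have "char_sum (push cone_weight h) s = 0" if s: "s \<in> ext_torus" for s :: "'k \<times> ('k^'n)"
    proof -
      have "torus_point P s \<in> wpoint (\<lambda>_. 1) (\<lambda>\<eta>. if \<eta> \<in> ?\<Lambda> then torus_char \<eta> (snd s) else 0)"
        unfolding wpoint_def using s
        by (intro CollectI exI[of _ "fst s"]) (auto simp: torus_point_def ext_torus_def)
      moreover have "snd s \<in> torus" using s by (auto simp: ext_torus_def)
      ultimately have "peval h (torus_point P s) = 0" using h(3) by blast
      thus ?thesis using peval_torus_point[OF h(1) s] by simp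
    qed
    hence "push cone_weight h = 0" by (rule char_sum_eq_0_imp)
    hence "peval h v = 0" using R h by blast
    moreover obtain \<xi> where "a = (\<lambda>i. \<xi> ^ 1 * v i)" using a by (auto simp: wpoint_def)
    ultimately show "peval h a = 0" using peval_whomogeneous_scale[OF h(2), of \<xi> v] by simp
  qed
  thus "v \<in> affine_cone P" using R
    by (auto simp: affine_cone_def toric_variety_def zariski_closure_def vanishing_locus_def wproj_def)
qed

lemma torus_point_in_cone:
  fixes s :: "'k::field_char_0 \<times> ('k^'n)"
  assumes "s \<in> ext_torus"
  shows "torus_point P s \<in> affine_cone P"
  unfolding affine_cone_iff using peval_torus_point[OF _ assms]
  by (auto simp: affine_space_def torus_point_def)

text \<open>The defining polynomials of the cone split into weight components which are again defining
  polynomials, and the torus scales each component.\<close>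

lemma ext_act_cone:
  fixes v :: "int^'n \<Rightarrow> 'k::field_char_0"
  assumes s: "s \<in> ext_torus" and v: "v \<in> affine_cone P"
  shows "ext_act s v \<in> affine_cone P"
  unfolding affine_cone_iff
proof (intro conjI ballI impI)
  show "ext_act s v \<in> affine_space (lattice_points P)"
    using v by (auto simp: affine_cone_iff affine_space_def ext_act_def)
next
  fix G :: "(int^'n, 'k) mpoly"
  assume G: "G \<in> carrier (poly_ring (lattice_points P))" "push cone_weight G = 0"
  have "peval (restr (\<lambda>\<alpha>. cone_weight \<alpha> = w) G) (ext_act s v) = 0" for w
  proof -
    let ?H = "restr (\<lambda>\<alpha>. cone_weight \<alpha> = w) G"
    have "push cone_weight ?H = 0"
      using push_restr[where h = cone_weight and g = G and Q = "\<lambda>u. u = w"] G by simp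
    hence "peval ?H v = 0" using v G by (auto simp: affine_cone_iff intro: poly_ring_closed)
    moreover have "peval ?H (ext_act s v) = ext_char w s * peval ?H v"
      unfolding peval_def sum_distrib_left
      by (rule sum.cong) (auto simp: ext_act_monomial[OF s])
    ultimately show ?thesis by simp
  qed
  hence "peval (\<Sum>w\<in>cone_weight ` supp G. restr (\<lambda>\<alpha>. cone_weight \<alpha> = w) G) (ext_act s v) = 0"
    by (simp add: peval_sum)
  thus "peval G (ext_act s v) = 0" by (subst (asm) sum_restr) auto
qed

lemma ext_act_cone_iff:
  fixes v :: "int^'n \<Rightarrow> 'k::field_char_0"
  assumes s: "s \<in> ext_torus"
  shows "ext_act s v \<in> affine_cone P \<longleftrightarrow> v \<in> affine_cone P"
proof
  assume "ext_act s v \<in> affine_cone P"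
  hence "ext_act (ext_inverse s) (ext_act s v) \<in> affine_cone P"
    by (rule ext_act_cone[OF ext_inverse_in_torus[OF s]])
  moreover have "ext_act (ext_inverse s) (ext_act s v) = v"
  proof
    fix \<eta>
    have "ext_act t u \<eta> = ext_char (1, \<eta>) t * u \<eta>" for t and u :: "int^'n \<Rightarrow> 'k"
      by (simp add: ext_act_def ext_char_def)
    thus "ext_act (ext_inverse s) (ext_act s v) \<eta> = v \<eta>"
      using ext_char_nonzero[OF s, of "(1, \<eta>)"] by (simp add: ext_char_ext_inverse)
  qed
  ultimately show "v \<in> affine_cone P" by simp
qed (rule ext_act_cone[OF s])

subsection \<open>The monoid of weights\<close>

lemma decomposes_iff:
  assumes fin: "finite (lattice_points P)"
  shows "decomposes P a w \<longleftrightarrow> w = cone_weight (\<Sum>\<eta>\<in>lattice_points P. trm \<eta> (a \<eta>))"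
proof -
  have sum: "mon_weight u (sum \<alpha> B) = (\<Sum>b\<in>B. mon_weight u (\<alpha> b))" for u and \<alpha> :: "int^'n \<Rightarrow> int^'n \<Rightarrow>\<^sub>0 nat" and B
    by (induction B rule: infinite_finite_induct) (auto simp: mon_weight_add)
  show ?thesis by (simp add: decomposes_def sum mon_weight_term)
qed

lemma coef_sum_trm:
  "finite B \<Longrightarrow> coef (\<Sum>\<eta>\<in>B. trm \<eta> (a \<eta>)) \<zeta> = (if \<zeta> \<in> B then a \<zeta> else 0)"
  by (auto simp: lookup_sum lookup_single when_def sum.delta')

lemma supp_sum_trm: "finite B \<Longrightarrow> supp (\<Sum>\<eta>\<in>B. trm \<eta> (a \<eta>)) \<subseteq> B"
  by (auto simp: in_keys_iff coef_sum_trm split: if_splits)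

lemma decomposes_coef:
  assumes "finite (lattice_points P)" "supp \<alpha> \<subseteq> lattice_points P"
  shows "decomposes P (coef \<alpha>) (cone_weight \<alpha>)"
  using supp_sum_superset[OF assms, of trm] by (simp add: decomposes_iff[OF assms(1)] sum_of_terms)

lemma weight_monoid_eq:
  assumes "finite (lattice_points P)"
  shows "weight_monoid P = cone_weight ` {\<alpha>. supp \<alpha> \<subseteq> lattice_points P}"
proof
  show "weight_monoid P \<subseteq> cone_weight ` {\<alpha>. supp \<alpha> \<subseteq> lattice_points P}"
    using supp_sum_trm[OF assms] by (auto simp: weight_monoid_def decomposes_iff[OF assms] image_iff)
  show "cone_weight ` {\<alpha>. supp \<alpha> \<subseteq> lattice_points P} \<subseteq> weight_monoid P"
    using decomposes_coef[OF assms] unfolding weight_monoid_def by blast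
qed

lemma weight_monoid_add:
  assumes "finite (lattice_points P)" "u \<in> weight_monoid P" "w \<in> weight_monoid P"
  shows "u + w \<in> weight_monoid P"
proof -
  obtain \<alpha> \<beta> where ab: "supp \<alpha> \<subseteq> lattice_points P" "supp \<beta> \<subseteq> lattice_points P"
    "u = cone_weight \<alpha>" "w = cone_weight \<beta>"
    using assms by (auto simp: weight_monoid_eq)
  hence "supp (\<alpha> + \<beta>) \<subseteq> lattice_points P" using keys_add[of \<alpha> \<beta>] by blast
  thus ?thesis using ab by (auto simp: weight_monoid_eq[OF assms(1)] mon_weight_add[symmetric])
qed

lemma weight_monoid_0: "finite (lattice_points P) \<Longrightarrow> 0 \<in> weight_monoid P"
  unfolding weight_monoid_eq by (rule image_eqI[of _ _ 0]) auto

lemma mon_weight_in_monoid: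
  assumes "finite (lattice_points P)" "\<And>i. i \<in> supp \<alpha> \<Longrightarrow> u i \<in> weight_monoid P"
  shows "mon_weight u \<alpha> \<in> weight_monoid P"
proof -
  have scale: "(int n * fst w, int n *s snd w) \<in> weight_monoid P" if "w \<in> weight_monoid P" for n w
  proof (induction n)
    case 0 thus ?case using weight_monoid_0[OF assms(1)] by (simp add: zero_prod_def)
  next
    case (Suc n)
    have "(int (Suc n) * fst w, int (Suc n) *s snd w) = (int n * fst w, int n *s snd w) + w"
      by (simp add: prod_eq_iff algebra_simps vector_sadd_rdistrib)
    thus ?case using Suc that weight_monoid_add[OF assms(1)] by simp
  qed
  have "(\<Sum>i\<in>B. (int (coef \<alpha> i) * fst (u i), int (coef \<alpha> i) *s snd (u i))) \<in> weight_monoid P"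
    if "B \<subseteq> supp \<alpha>" for B
    using finite_subset[OF that finite_keys] that
    by (induction B rule: finite_induct)
      (auto intro!: weight_monoid_add weight_monoid_0 scale assms)
  thus ?thesis by (simp add: mon_weight_def)
qed

subsection \<open>Functions on the cone\<close>

text \<open>This map identifies the monoid algebra with the coordinate ring of the cone. All later arguments take
  place in the monoid algebra, whose ring operations are those of a type class.\<close>

definition cone_fun :: "(real^'n) set \<Rightarrow> (int \<times> (int^'n) \<Rightarrow>\<^sub>0 'k::field) \<Rightarrow> ('n, 'k) cfun" where
  "cone_fun P d = on_cone P (\<lambda>v. \<Sum>w\<in>supp d. coef d w * basis_fun P w v)"

text \<open>The decomposition chosen in \<open>basis_fun\<close> does not matter: two monomials of equal weight differ by an
  element of the toric ideal.\<close>

lemma basis_fun_eq: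
  fixes P :: "(real^'n) set"
  assumes fin: "finite (lattice_points P)" and \<alpha>: "supp \<alpha> \<subseteq> lattice_points P"
  shows "basis_fun P (cone_weight \<alpha>) = on_cone P (peval (trm \<alpha> (1::'k::field_char_0)))"
proof -
  define a where "a = (SOME a. decomposes P a (cone_weight \<alpha>))"
  define \<beta> where "\<beta> = (\<Sum>\<eta>\<in>lattice_points P. trm \<eta> (a \<eta>))"
  have "decomposes P a (cone_weight \<alpha>)"
    unfolding a_def by (rule someI[where P = "\<lambda>a. decomposes P a (cone_weight \<alpha>)"])
      (rule decomposes_coef[OF assms])
  hence w: "cone_weight \<beta> = cone_weight \<alpha>" by (simp add: decomposes_iff[OF fin] \<beta>_def)
  have \<beta>: "supp \<beta> \<subseteq> lattice_points P" unfolding \<beta>_def by (rule supp_sum_trm[OF fin])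
  have prod: "(\<Prod>\<eta>\<in>lattice_points P. v \<eta> ^ a \<eta>) = peval (trm \<beta> 1) v" for v :: "int^'n \<Rightarrow> 'k"
  proof -
    have "peval (trm \<beta> 1) v = (\<Prod>\<eta>\<in>lattice_points P. v \<eta> ^ coef \<beta> \<eta>)"
      using prod_supp_superset[OF fin \<beta>] by (simp add: peval_term)
    also have "\<dots> = (\<Prod>\<eta>\<in>lattice_points P. v \<eta> ^ a \<eta>)"
      by (rule prod.cong) (auto simp: \<beta>_def coef_sum_trm[OF fin])
    finally show ?thesis by simp
  qed
  have "peval (trm \<beta> 1) v = peval (trm \<alpha> 1) v" if "v \<in> affine_cone P" for v :: "int^'n \<Rightarrow> 'k"
  proof -
    have "peval (trm \<beta> 1 - trm \<alpha> 1) v = 0"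
      using \<alpha> \<beta> w that
      by (intro toric_ideal_vanishes_on_cone) (auto simp: push_diff intro!: poly_ring_closed)
    thus ?thesis by (simp add: peval_diff)
  qed
  thus ?thesis by (auto simp: basis_fun_def on_cone_def fun_eq_iff prod a_def[symmetric])
qed

lemma cone_fun_push:
  fixes G :: "(int^'n, 'k::field_char_0) mpoly"
  assumes fin: "finite (lattice_points P)" and G: "G \<in> carrier (poly_ring (lattice_points P))"
  shows "cone_fun P (push cone_weight G) = on_cone P (peval G)"
proof
  fix v :: "int^'n \<Rightarrow> 'k"
  define L where "L d = (\<Sum>w\<in>supp d. coef d w * basis_fun P w v)" for d :: "int \<times> (int^'n) \<Rightarrow>\<^sub>0 'k"
  have add: "L (d + e) = L d + L e" for d e
    unfolding L_def by (rule supp_sum_add) (auto simp: algebra_simps)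
  have L0: "L 0 = 0" by (simp add: L_def)
  have sum: "L (sum d B) = (\<Sum>b\<in>B. L (d b))" for d and B :: "(int^'n \<Rightarrow>\<^sub>0 nat) set"
    by (induction B rule: infinite_finite_induct) (auto simp: add L0)
  have trm: "L (trm w c) = c * basis_fun P w v" for w c
    unfolding L_def by (rule supp_sum_term) auto
  show "cone_fun P (push cone_weight G) v = on_cone P (peval G) v"
  proof (cases "v \<in> affine_cone P")
    case True
    have "L (push cone_weight G) = (\<Sum>\<alpha>\<in>supp G. coef G \<alpha> * basis_fun P (cone_weight \<alpha>) v)"
      by (simp add: push_def sum trm)
    also have "\<dots> = (\<Sum>\<alpha>\<in>supp G. coef G \<alpha> * peval (trm \<alpha> 1) v)"
      using G True by (intro sum.cong) (auto simp: poly_ring_carrier_iff basis_fun_eq[OF fin] on_cone_def)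
    also have "\<dots> = peval G v" by (simp add: peval_def peval_term)
    finally show ?thesis using True by (simp add: cone_fun_def on_cone_def L_def)
  qed (simp add: cone_fun_def on_cone_def)
qed

lemma monoid_algebra_lift:
  assumes fin: "finite (lattice_points P)" and d: "d \<in> monoid_algebra P"
  shows "\<exists>G\<in>carrier (poly_ring (lattice_points P)). push cone_weight G = d"
proof -
  have "\<forall>w\<in>supp d. \<exists>\<alpha>. supp \<alpha> \<subseteq> lattice_points P \<and> w = cone_weight \<alpha>"
    using d by (auto simp: monoid_algebra_def weight_monoid_eq[OF fin])
  then obtain A where A: "\<And>w. w \<in> supp d \<Longrightarrow> supp (A w) \<subseteq> lattice_points P \<and> w = cone_weight (A w)"
    by metis
  let ?G = "\<Sum>w\<in>supp d. trm (A w) (coef d w)"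
  have "push cone_weight ?G = (\<Sum>w\<in>supp d. trm w (coef d w))"
    unfolding push_sum push_term using A by (intro sum.cong) auto
  hence "push cone_weight ?G = d" by (simp add: sum_of_terms)
  moreover have "?G \<in> carrier (poly_ring (lattice_points P))"
    using A by (auto intro!: poly_ring_closed)
  ultimately show ?thesis by blast
qed

lemma push_in_monoid_algebra:
  assumes fin: "finite (lattice_points P)" and "\<And>i. i \<in> I \<Longrightarrow> u i \<in> weight_monoid P"
    and g: "g \<in> carrier (poly_ring I)"
  shows "push (mon_weight u) g \<in> monoid_algebra P"
proof -
  have "mon_weight u \<alpha> \<in> weight_monoid P" if "\<alpha> \<in> supp g" for \<alpha>
    using that g assms(2) by (intro mon_weight_in_monoid[OF fin]) (auto simp: poly_ring_carrier_iff)
  thus ?thesis using supp_push[of "mon_weight u" g] by (auto simp: monoid_algebra_def)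
qed

lemma generator_in_weight_monoid:
  "finite (lattice_points P) \<Longrightarrow> \<eta> \<in> lattice_points P \<Longrightarrow> (1, \<eta>) \<in> weight_monoid P"
  unfolding weight_monoid_eq by (rule image_eqI[of _ _ "trm \<eta> 1"]) (auto simp: mon_weight_term)

lemma push_cone_weight_closed:
  "finite (lattice_points P) \<Longrightarrow> G \<in> carrier (poly_ring (lattice_points P))
    \<Longrightarrow> push cone_weight G \<in> monoid_algebra P"
  by (rule push_in_monoid_algebra) (auto intro: generator_in_weight_monoid)

lemma monoid_algebra_add:
  "d \<in> monoid_algebra P \<Longrightarrow> e \<in> monoid_algebra P \<Longrightarrow> d + e \<in> monoid_algebra P"
  using keys_add[of d e] by (auto simp: monoid_algebra_def)

lemma monoid_algebra_0: "0 \<in> monoid_algebra P"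
  by (simp add: monoid_algebra_def)

lemma monoid_algebra_uminus: "d \<in> monoid_algebra P \<Longrightarrow> - d \<in> monoid_algebra P"
  by (simp add: monoid_algebra_def in_keys_iff subset_iff)

lemma monoid_algebra_sum:
  "(\<And>b. b \<in> B \<Longrightarrow> d b \<in> monoid_algebra P) \<Longrightarrow> sum d B \<in> monoid_algebra P"
  by (induction B rule: infinite_finite_induct) (auto simp: monoid_algebra_0 monoid_algebra_add)

lemma monoid_algebra_term: "w \<in> weight_monoid P \<Longrightarrow> trm w c \<in> monoid_algebra P"
  by (auto simp: monoid_algebra_def split: if_splits)

lemma monoid_algebra_restr: "d \<in> monoid_algebra P \<Longrightarrow> restr Q d \<in> monoid_algebra P"
  by (auto simp: monoid_algebra_def)

lemma monoid_algebra_mult: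
  assumes "finite (lattice_points P)" "d \<in> monoid_algebra P" "e \<in> monoid_algebra P"
  shows "d * e \<in> monoid_algebra P"
proof -
  have "u + w \<in> weight_monoid P" if "u \<in> supp d" "w \<in> supp e" for u w
    using that assms by (intro weight_monoid_add) (auto simp: monoid_algebra_def)
  thus ?thesis using keys_mult[of d e] by (auto simp: monoid_algebra_def)
qed

lemma cone_fun_torus_point:
  fixes s :: "'k::field_char_0 \<times> ('k^'n)"
  assumes fin: "finite (lattice_points P)" and d: "d \<in> monoid_algebra P" and s: "s \<in> ext_torus"
  shows "cone_fun P d (torus_point P s) = char_sum d s"
proof -
  obtain G where G: "G \<in> carrier (poly_ring (lattice_points P))" "push cone_weight G = d"
    using monoid_algebra_lift[OF fin d] by blast
  show ?thesis using cone_fun_push[OF fin G(1)] peval_torus_point[OF G(1) s] torus_point_in_cone[OF s] G(2)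
    by (simp add: on_cone_def)
qed

text \<open>Restricting to the torus leaves a sum of characters, so independence of characters applies.\<close>

lemma cone_fun_inj:
  fixes d e :: "int \<times> (int^'n) \<Rightarrow>\<^sub>0 'k::field_char_0"
  assumes fin: "finite (lattice_points P)" and "d \<in> monoid_algebra P" "e \<in> monoid_algebra P"
    and "cone_fun P d = cone_fun P e"
  shows "d = e"
proof -
  have "char_sum (d - e) s = 0" if "s \<in> ext_torus" for s
    using cone_fun_torus_point[OF fin assms(2) that] cone_fun_torus_point[OF fin assms(3) that] assms(4)
    by (simp add: char_sum_diff)
  hence "d - e = 0" by (rule char_sum_eq_0_imp)
  thus ?thesis by simp
qed

lemma cone_fun_0 [simp]: "cone_fun P 0 = (\<lambda>v. 0)"
  by (auto simp: cone_fun_def on_cone_def)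

lemma cone_fun_add: "cone_fun P (d + e) = (\<lambda>v. cone_fun P d v + cone_fun P e v)"
proof
  fix v
  have "(\<Sum>w\<in>supp (d + e). coef (d + e) w * basis_fun P w v)
      = (\<Sum>w\<in>supp d. coef d w * basis_fun P w v) + (\<Sum>w\<in>supp e. coef e w * basis_fun P w v)"
    by (rule supp_sum_add) (auto simp: algebra_simps)
  thus "cone_fun P (d + e) v = cone_fun P d v + cone_fun P e v"
    by (simp add: cone_fun_def on_cone_def)
qed

lemma cone_fun_term: "cone_fun P (trm w c) = (\<lambda>v. c * basis_fun P w v)"
proof
  fix v
  have "(\<Sum>u\<in>supp (trm w c). coef (trm w c) u * basis_fun P u v) = c * basis_fun P w v"
    by (rule supp_sum_term) auto
  thus "cone_fun P (trm w c) v = c * basis_fun P w v"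
    by (auto simp: cone_fun_def on_cone_def basis_fun_def)
qed

lemma cone_fun_mult:
  fixes d e :: "int \<times> (int^'n) \<Rightarrow>\<^sub>0 'k::field_char_0"
  assumes fin: "finite (lattice_points P)" and d: "d \<in> monoid_algebra P" and e: "e \<in> monoid_algebra P"
  shows "cone_fun P (d * e) = (\<lambda>v. cone_fun P d v * cone_fun P e v)"
proof -
  obtain G where G: "G \<in> carrier (poly_ring (lattice_points P))" "push cone_weight G = d"
    using monoid_algebra_lift[OF fin d] by blast
  obtain H where H: "H \<in> carrier (poly_ring (lattice_points P))" "push cone_weight H = e"
    using monoid_algebra_lift[OF fin e] by blast
  have "d * e = push cone_weight (G * H)" using G H by (simp add: push_mult mon_weight_add)
  hence "cone_fun P (d * e) = on_cone P (peval (G * H))"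
    using cone_fun_push[OF fin poly_ring_mult_closed[OF G(1) H(1)]] by simp
  thus ?thesis using cone_fun_push[OF fin G(1)] cone_fun_push[OF fin H(1)] G H
    by (auto simp: on_cone_def peval_mult fun_eq_iff)
qed

lemma cone_fun_1:
  assumes "finite (lattice_points P)"
  shows "cone_fun P (1 :: int \<times> (int^'n) \<Rightarrow>\<^sub>0 'k::field_char_0) = on_cone P (\<lambda>v. 1)"
proof -
  have "push cone_weight 1 = (1 :: int \<times> (int^'n) \<Rightarrow>\<^sub>0 'k)"
    using push_term[of cone_weight 0 "1::'k"] by simp
  thus ?thesis using cone_fun_push[OF assms poly_ring_1_closed, where 'k = 'k]
    by (simp add: on_cone_def cong: if_cong)
qed

lemma cone_fun_smult: "cone_fun P (trm 0 c * d) = (\<lambda>v. c * cone_fun P d v)"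
  if "finite (lattice_points P)" "d \<in> monoid_algebra P" for d :: "int \<times> (int^'n) \<Rightarrow>\<^sub>0 'k::field_char_0"
proof -
  have "trm 0 c \<in> monoid_algebra P" using that by (intro monoid_algebra_term weight_monoid_0)
  moreover have "basis_fun P 0 v = (1::'k)" if "v \<in> affine_cone P" for v
  proof -
    have "basis_fun P 0 v = cone_fun P (trm 0 1) v" by (simp only: cone_fun_term mult_1)
    also have "\<dots> = 1"
      using cone_fun_1[OF \<open>finite _\<close>, where 'k = 'k] \<open>v \<in> _\<close> by (simp add: on_cone_def)
    finally show ?thesis .
  qed
  moreover have "cone_fun P d v = 0" if "v \<notin> affine_cone P" for v
    using that by (simp add: cone_fun_def on_cone_def)
  ultimately show ?thesis using cone_fun_mult[of P "trm 0 c" d] that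
    by (auto simp: cone_fun_term fun_eq_iff)
qed

lemma cone_ring_carrier:
  fixes P :: "(real^'n) set"
  assumes fin: "finite (lattice_points P)"
  shows "carrier (cone_ring P :: ('k::field_char_0, ('n, 'k) cfun) module) = cone_fun P ` monoid_algebra P"
proof
  show "carrier (cone_ring P :: ('k, ('n, 'k) cfun) module) \<subseteq> cone_fun P ` monoid_algebra P"
  proof
    fix x :: "('n, 'k) cfun" assume "x \<in> carrier (cone_ring P)"
    then obtain G :: "(int^'n, 'k) mpoly"
      where "G \<in> carrier (poly_ring (lattice_points P))" "x = on_cone P (peval G)"
      by (auto simp: cone_ring_def)
    thus "x \<in> cone_fun P ` monoid_algebra P"
      using cone_fun_push[OF fin] push_cone_weight_closed[OF fin] by (metis image_eqI)
  qed
  show "cone_fun P ` monoid_algebra P \<subseteq> carrier (cone_ring P :: ('k, ('n, 'k) cfun) module)"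
  proof
    fix x :: "('n, 'k) cfun" assume "x \<in> cone_fun P ` monoid_algebra P"
    then obtain G :: "(int^'n, 'k) mpoly"
      where "G \<in> carrier (poly_ring (lattice_points P))" "x = cone_fun P (push cone_weight G)"
      using monoid_algebra_lift[OF fin] by blast
    thus "x \<in> carrier (cone_ring P)" using cone_fun_push[OF fin] by (auto simp: cone_ring_def)
  qed
qed

lemma cone_ring_simps [simp]:
  "mult (cone_ring P) = (\<lambda>g h v. g v * h v)" "one (cone_ring P) = on_cone P (\<lambda>v. 1)"
  "zero (cone_ring P) = (\<lambda>v. 0)" "add (cone_ring P) = (\<lambda>g h v. g v + h v)"
  "smult (cone_ring P) = (\<lambda>c g v. c * g v)"
  by (simp_all add: cone_ring_def)

lemma cring_cone_ring: "cring (cone_ring P :: ('k::field_char_0, ('n::finite, 'k) cfun) module)"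
proof (rule cring_hom_image[OF cring_poly_ring])
  let ?h = "\<lambda>G :: (int^'n, 'k) mpoly. on_cone P (peval G)"
  show carrier: "carrier (cone_ring P :: ('k, ('n, 'k) cfun) module)
      = ?h ` carrier (poly_ring (lattice_points P))"
    by (auto simp: cone_ring_def)
  show "?h \<in> ring_hom (poly_ring (lattice_points P)) (cone_ring P)"
  proof (rule ring_hom_memI)
    show "?h G \<in> carrier (cone_ring P)" if "G \<in> carrier (poly_ring (lattice_points P))" for G
      unfolding carrier using that by (rule imageI)
  qed (auto simp: on_cone_def peval_add peval_mult fun_eq_iff)
qed (simp add: on_cone_def fun_eq_iff)

lemma cone_ring_finsum:
  fixes d :: "'b \<Rightarrow> int \<times> (int^'n) \<Rightarrow>\<^sub>0 'k::field_char_0"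
  assumes fin: "finite (lattice_points P)" and "\<And>b. b \<in> B \<Longrightarrow> d b \<in> monoid_algebra P"
  shows "(\<Oplus>\<^bsub>cone_ring P\<^esub>b\<in>B. cone_fun P (d b)) = cone_fun P (sum d B)"
proof -
  interpret cring "cone_ring P :: ('k, ('n, 'k) cfun) module" by (rule cring_cone_ring)
  show ?thesis using assms(2)
  proof (induction B rule: infinite_finite_induct)
    case (insert x F)
    have "(\<Oplus>\<^bsub>cone_ring P\<^esub>b\<in>insert x F. cone_fun P (d b))
        = cone_fun P (d x) \<oplus>\<^bsub>cone_ring P\<^esub> (\<Oplus>\<^bsub>cone_ring P\<^esub>b\<in>F. cone_fun P (d b))"
      using insert by (subst finsum_insert) (auto simp: Pi_def cone_ring_carrier[OF fin])
    thus ?case using insert by (simp add: cone_fun_add)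
  qed (auto simp: finsum_infinite)
qed

section \<open>Eigenfunctions and weight components\<close>

lemma basis_fun_act:
  fixes v :: "int^'n \<Rightarrow> 'k::field_char_0"
  assumes fin: "finite (lattice_points P)" and u: "u \<in> weight_monoid P" and s: "s \<in> ext_torus"
  shows "basis_fun P u (ext_act s v) = ext_char u s * basis_fun P u v"
proof -
  obtain \<alpha> where "supp \<alpha> \<subseteq> lattice_points P" "u = cone_weight \<alpha>"
    using u by (auto simp: weight_monoid_eq[OF fin])
  thus ?thesis
    by (simp add: basis_fun_eq[OF fin] on_cone_def ext_act_cone_iff[OF s] peval_term ext_act_monomial[OF s])
qed

lemma cone_fun_eq_0_iff:
  fixes d :: "int \<times> (int^'n) \<Rightarrow>\<^sub>0 'k::field_char_0"
  assumes "finite (lattice_points P)" "d \<in> monoid_algebra P"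
  shows "cone_fun P d = (\<lambda>v. 0) \<longleftrightarrow> d = 0"
  using cone_fun_inj[OF assms monoid_algebra_0] by auto

lemma trm_eq_0_iff [simp]: "trm a c = 0 \<longleftrightarrow> c = 0"
  by (metis lookup_single_eq lookup_zero single_zero)

lemma trm_inj: "trm a c = trm b d \<Longrightarrow> c \<noteq> 0 \<Longrightarrow> a = b"
  by (metis lookup_single_eq lookup_single_not_eq)

lemma eigenfunction_basis:
  fixes c :: "'k::field_char_0" and P :: "(real^'n) set"
  assumes fin: "finite (lattice_points P)" and u: "u \<in> weight_monoid P" and c: "c \<noteq> 0"
  shows "eigenfunction P (cone_fun P (trm u c)) (- u)"
  unfolding eigenfunction_def
proof (intro conjI ballI)
  have d: "trm u c \<in> monoid_algebra P" using u by (rule monoid_algebra_term)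
  thus "cone_fun P (trm u c) \<in> carrier (cone_ring P)" by (simp add: cone_ring_carrier[OF fin])
  show "cone_fun P (trm u c) \<noteq> \<zero>\<^bsub>cone_ring P\<^esub>" using c by (simp add: cone_fun_eq_0_iff[OF fin d])
  fix s :: "'k \<times> ('k^'n)" assume s: "s \<in> ext_torus"
  show "ext_act_fun s (cone_fun P (trm u c)) = ext_char (- u) s \<odot>\<^bsub>cone_ring P\<^esub> cone_fun P (trm u c)"
    by (simp add: ext_act_fun_def cone_fun_term basis_fun_act[OF fin u ext_inverse_in_torus[OF s]]
        ext_char_ext_inverse ext_char_uminus[OF s] mult_ac)
qed

lemma ext_char_inj:
  fixes u w :: "int \<times> (int^'n)"
  assumes "\<And>s :: 'k::field_char_0 \<times> ('k^'n). s \<in> ext_torus \<Longrightarrow> ext_char u s = ext_char w s"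
  shows "u = w"
proof -
  have "trm u 1 - trm w (1::'k) = 0"
    using assms by (intro char_sum_eq_0_imp) (simp add: char_sum_diff char_sum_term)
  thus ?thesis using trm_inj[of u "1::'k" w 1] by simp
qed

text \<open>Comparing the two sides of the eigenvector equation on the torus, once as functions of the acting
  element and once as functions of the point, leaves only one possible weight in the support.\<close>

lemma eigenfunction_imp_basis:
  fixes g :: "('n::finite, 'k::field_char_0) cfun"
  assumes fin: "finite (lattice_points P)" and g: "eigenfunction P g w"
  shows "\<exists>c. c \<noteq> 0 \<and> - w \<in> weight_monoid P \<and> g = cone_fun P (trm (- w) c)"
proof -
  obtain d where d: "d \<in> monoid_algebra P" "g = cone_fun P d" "d \<noteq> 0"
  proof -
    have "g \<in> cone_fun P ` monoid_algebra P" "g \<noteq> (\<lambda>v. 0)"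
      using g by (simp_all add: eigenfunction_def cone_ring_carrier[OF fin])
    thus ?thesis using that cone_fun_0[of P] by blast
  qed
  have "u = - w" if u: "u \<in> supp d" for u
  proof -
    have "ext_char (- u) s = ext_char w s" if s: "s \<in> ext_torus" for s :: "'k \<times> ('k^'n)"
    proof -
      \<comment> \<open>for fixed \<open>s\<close>, the difference of the two sides as a sum of characters of the point\<close>
      define e where "e = (\<Sum>v\<in>supp d. trm v (coef d v * (ext_char (- v) s - ext_char w s)))"
      have "char_sum e t = 0" if t: "t \<in> ext_torus" for t :: "'k \<times> ('k^'n)"
      proof -
        have "cone_fun P d (ext_act (ext_inverse s) (torus_point P t)) = ext_char w s * cone_fun P d (torus_point P t)"
          using g s d(2) by (auto simp: eigenfunction_def ext_act_fun_def fun_eq_iff)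
        moreover have "cone_fun P d (ext_act (ext_inverse s) (torus_point P t))
            = (\<Sum>v\<in>supp d. coef d v * (ext_char (- v) s * basis_fun P v (torus_point P t)))"
          using d(1) torus_point_in_cone[OF t] s
          by (auto simp: cone_fun_def on_cone_def ext_act_cone_iff ext_inverse_in_torus basis_fun_act[OF fin]
              ext_char_ext_inverse ext_char_uminus monoid_algebra_def subset_iff intro!: sum.cong)
        moreover have "cone_fun P d (torus_point P t)
            = (\<Sum>v\<in>supp d. coef d v * basis_fun P v (torus_point P t))"
          using torus_point_in_cone[OF t] by (simp add: cone_fun_def on_cone_def)
        moreover have "basis_fun P v (torus_point P t) = ext_char v t" if "v \<in> supp d" for v
        proof -
          have "trm v (1::'k) \<in> monoid_algebra P"
            using that d(1) by (intro monoid_algebra_term) (auto simp: monoid_algebra_def)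
          from cone_fun_torus_point[OF fin this t] show ?thesis
            by (simp add: cone_fun_term char_sum_term)
        qed
        ultimately show ?thesis
          by (simp add: e_def char_sum_sum char_sum_term algebra_simps sum_subtractf sum_distrib_left)
      qed
      hence "e = 0" by (rule char_sum_eq_0_imp)
      moreover have "coef e u = coef d u * (ext_char (- u) s - ext_char w s)"
        using u by (simp add: e_def lookup_sum lookup_single when_def sum.delta')
      ultimately show ?thesis using u by (simp add: in_keys_iff)
    qed
    hence "- u = w" by (rule ext_char_inj)
    thus ?thesis by auto
  qed
  hence "supp d \<subseteq> {- w}" by blast
  hence dt: "d = trm (- w) (coef d (- w))"
    by (intro poly_mapping_eqI) (auto simp: lookup_single when_def in_keys_iff)
  hence c: "coef d (- w) \<noteq> 0" using d(3) by (metis single_zero)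
  hence "- w \<in> weight_monoid P" using d(1) by (auto simp: monoid_algebra_def in_keys_iff)
  thus ?thesis using dt c d(2) by metis
qed

lemma eigenfunction_weight_unique:
  fixes g :: "('n::finite, 'k::field_char_0) cfun"
  assumes fin: "finite (lattice_points P)" and "eigenfunction P g w" "eigenfunction P g w'"
  shows "w = w'"
proof -
  obtain c where c: "c \<noteq> 0" "- w \<in> weight_monoid P" "g = cone_fun P (trm (- w) c)"
    using eigenfunction_imp_basis[OF fin assms(2)] by blast
  obtain c' where c': "c' \<noteq> 0" "- w' \<in> weight_monoid P" "g = cone_fun P (trm (- w') c')"
    using eigenfunction_imp_basis[OF fin assms(3)] by blast
  have "trm (- w) c = trm (- w') c'"
    using c c' by (intro cone_fun_inj[OF fin]) (auto intro: monoid_algebra_term)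
  thus ?thesis using trm_inj c by fastforce
qed

lemma weight_of_eq:
  fixes g :: "('n::finite, 'k::field_char_0) cfun"
  assumes fin: "finite (lattice_points P)" and "eigenfunction P g w"
  shows "weight_of P g = w"
  unfolding weight_of_def using assms eigenfunction_weight_unique[OF fin] by blast

lemma weight_decomposition_cone_fun:
  fixes d :: "int \<times> (int^'n) \<Rightarrow>\<^sub>0 'k::field_char_0"
  assumes fin: "finite (lattice_points P)" and d: "d \<in> monoid_algebra P"
  shows "weight_decomposition P c (cone_fun P d) \<longleftrightarrow> c = (\<lambda>w. cone_fun P (trm (- w) (coef d (- w))))"
    (is "_ \<longleftrightarrow> c = ?c")
proof
  assume wd: "weight_decomposition P c (cone_fun P d)"
  define W where "W = {w. c w \<noteq> (\<lambda>v. 0)}"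
  have W: "finite W" "\<And>w. w \<in> W \<Longrightarrow> eigenfunction P (c w) w"
    "cone_fun P d = (\<Oplus>\<^bsub>cone_ring P\<^esub>w\<in>W. c w)"
    using wd by (auto simp: weight_decomposition_def W_def)
  have "\<forall>w\<in>W. \<exists>x. x \<noteq> 0 \<and> - w \<in> weight_monoid P \<and> c w = cone_fun P (trm (- w) x)"
    using W(2) eigenfunction_imp_basis[OF fin] by blast
  then obtain b where b: "\<And>w. w \<in> W \<Longrightarrow> b w \<noteq> 0 \<and> - w \<in> weight_monoid P \<and> c w = cone_fun P (trm (- w) (b w))"
    by metis
  have MA: "trm (- w) (b w) \<in> monoid_algebra P" if "w \<in> W" for w
    using b[OF that] by (intro monoid_algebra_term) auto
  interpret cring "cone_ring P :: ('k, ('n, 'k) cfun) module" by (rule cring_cone_ring)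
  have "(\<Oplus>\<^bsub>cone_ring P\<^esub>w\<in>W. c w) = (\<Oplus>\<^bsub>cone_ring P\<^esub>w\<in>W. cone_fun P (trm (- w) (b w)))"
    using b MA by (intro finsum_cong') (auto simp: cone_ring_carrier[OF fin])
  also have "\<dots> = cone_fun P (\<Sum>w\<in>W. trm (- w) (b w))" by (rule cone_ring_finsum[OF fin MA])
  finally have "d = (\<Sum>w\<in>W. trm (- w) (b w))"
    using W(3) d MA by (intro cone_fun_inj[OF fin]) (auto intro: monoid_algebra_sum)
  hence coef: "coef d (- w) = (if w \<in> W then b w else 0)" for w
    using W(1) by (simp add: lookup_sum lookup_single when_def sum.delta')
  show "c = ?c"
  proof
    fix w show "c w = ?c w"
    proof (cases "w \<in> W")
      case True thus ?thesis using b coef by simp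
    next
      case False thus ?thesis using coef[of w] by (simp add: W_def)
    qed
  qed
next
  assume c: "c = ?c"
  have MA: "trm (- w) (coef d (- w)) \<in> monoid_algebra P" for w
    using d by (cases "coef d (- w) = 0")
      (auto intro!: monoid_algebra_term simp: monoid_algebra_0 monoid_algebra_def in_keys_iff)
  have W: "{w. c w \<noteq> (\<lambda>v. 0)} = uminus ` supp d"
  proof -
    have "{w. c w \<noteq> (\<lambda>v. 0)} = {w. - w \<in> supp d}"
      unfolding c cone_fun_eq_0_iff[OF fin MA] by (simp add: in_keys_iff)
    also have "\<dots> = uminus ` supp d"
    proof (intro equalityI subsetI)
      fix w assume "w \<in> {w. - w \<in> supp d}"
      thus "w \<in> uminus ` supp d" by (intro image_eqI[of _ _ "- w"]) auto
    qed auto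
    finally show ?thesis .
  qed
  have eig: "eigenfunction P (c w) w" if "w \<in> uminus ` supp d" for w
  proof -
    have "- w \<in> supp d" using that by auto
    hence "- w \<in> weight_monoid P" "coef d (- w) \<noteq> 0" using d by (auto simp: monoid_algebra_def in_keys_iff)
    from eigenfunction_basis[OF fin this] show ?thesis by (simp add: c)
  qed
  have "(\<Oplus>\<^bsub>cone_ring P\<^esub>w\<in>uminus ` supp d. c w) = cone_fun P (\<Sum>w\<in>uminus ` supp d. trm (- w) (coef d (- w)))"
    unfolding c by (rule cone_ring_finsum[OF fin MA])
  also have "(\<Sum>w\<in>uminus ` supp d. trm (- w) (coef d (- w))) = d"
    by (subst sum.reindex) (auto simp: inj_on_def sum_of_terms)
  finally have "cone_fun P d = (\<Oplus>\<^bsub>cone_ring P\<^esub>w\<in>uminus ` supp d. c w)" ..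
  moreover have "\<forall>w. c w \<noteq> (\<lambda>v. 0) \<longrightarrow> eigenfunction P (c w) w"
    using eig unfolding W[symmetric] by blast
  ultimately show "weight_decomposition P c (cone_fun P d)"
    unfolding weight_decomposition_def cone_ring_simps W by (intro conjI) simp_all
qed

lemma weight_components_cone_fun:
  fixes d :: "int \<times> (int^'n) \<Rightarrow>\<^sub>0 'k::field_char_0"
  assumes fin: "finite (lattice_points P)" and d: "d \<in> monoid_algebra P"
  shows "weight_components P (cone_fun P d) = (\<lambda>w. cone_fun P (trm w (coef d w))) ` supp d"
proof -
  have MA: "trm w (coef d w) \<in> monoid_algebra P" for w
    using d by (cases "coef d w = 0")
      (auto intro!: monoid_algebra_term simp: monoid_algebra_0 monoid_algebra_def in_keys_iff)
  have "(THE c. weight_decomposition P c (cone_fun P d)) = (\<lambda>w. cone_fun P (trm (- w) (coef d (- w))))"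
    by (simp add: weight_decomposition_cone_fun[OF fin d])
  hence "weight_components P (cone_fun P d)
      = range (\<lambda>w. cone_fun P (trm (- w) (coef d (- w)))) - {\<lambda>v. 0}"
    by (simp add: weight_components_def)
  also have "range (\<lambda>w. cone_fun P (trm (- w) (coef d (- w)))) = range (\<lambda>w. cone_fun P (trm w (coef d w)))"
  proof -
    have "range (\<lambda>w. F (- w)) = range F" for F :: "int \<times> (int^'n) \<Rightarrow> ('n, 'k) cfun"
      by (auto simp: image_iff) (metis minus_minus)
    thus ?thesis .
  qed
  also have "\<dots> - {\<lambda>v. 0} = (\<lambda>w. cone_fun P (trm w (coef d w))) ` supp d"
    using cone_fun_eq_0_iff[OF fin MA] by (auto simp: in_keys_iff)
  finally show ?thesis .
qed

lemma weight_of_term: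
  fixes c :: "'k::field_char_0" and P :: "(real^'n) set"
  assumes fin: "finite (lattice_points P)" and "u \<in> weight_monoid P" "c \<noteq> 0"
  shows "weight_of P (cone_fun P (trm u c)) = - u"
  using weight_of_eq[OF fin eigenfunction_basis[OF assms]] .

section \<open>Maximal chains of faces and coordinates of weights\<close>

lemma maxchain_memI:
  assumes C: "subset.maxchain \<A> C" and X: "X \<in> \<A>" and comp: "\<And>Y. Y \<in> C \<Longrightarrow> Y \<subseteq> X \<or> X \<subseteq> Y"
  shows "X \<in> C"
proof (rule ccontr)
  assume "X \<notin> C"
  moreover have "subset.chain \<A> (insert X C)"
    using subset.maxchain_imp_chain[OF C] X comp by (auto simp: subset_chain_insert)
  ultimately show False using C by (auto simp: subset.maxchain_def)
qed

text \<open>Otherwise a facet of \<open>\<sigma>\<close> that contains the next smaller member of the chain could be inserted.\<close>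

lemma maxchain_faces_step:
  fixes P :: "(real^'n) set"
  assumes P: "polytope P" and C: "subset.maxchain (faces P) C" and \<sigma>: "\<sigma> \<in> C" and dim: "aff_dim \<sigma> > 0"
  shows "\<exists>\<tau>\<in>C. aff_dim \<tau> = aff_dim \<sigma> - 1"
proof -
  have chain: "subset.chain (faces P) C" using C by (rule subset.maxchain_imp_chain)
  have finC: "finite C"
    using chain finite_polytope_faces[OF P] by (auto simp: subset_chain_def faces_def intro: finite_subset)
  have face: "\<sigma> face_of P" using chain \<sigma> by (auto simp: subset_chain_def faces_def)
  have poly: "polytope \<sigma>" using face_of_polytope_polytope[OF P face] .
  define L where "L = {\<tau>\<in>C. \<tau> \<subset> \<sigma>}"
  have "\<exists>F. F facet_of \<sigma> \<and> \<Union>L \<subseteq> F"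
  proof (cases "L = {}")
    case True
    then show ?thesis using polytope_facet_exists[OF poly dim] by auto
  next
    case False
    have "subset.chain (faces P) L" using chain by (auto simp: L_def subset_chain_def)
    hence "\<Union>L \<in> L" using finC False by (intro Union_in_chain) (auto simp: L_def)
    hence 1: "\<Union>L \<in> faces P" "\<Union>L \<noteq> \<sigma>" "\<Union>L \<subseteq> \<sigma>" using chain by (auto simp: L_def subset_chain_def)
    from 1(1) have fP: "\<Union>L face_of P \<and> \<Union>L \<noteq> {}" unfolding faces_def mem_Collect_eq .
    from face_of_subset[OF conjunct1[OF fP] 1(3) face_of_imp_subset[OF face]] have f: "\<Union>L face_of \<sigma>" .
    from conjunct2[OF fP] obtain F where "F facet_of \<sigma>" "\<Union>L \<subseteq> F"
      by (rule face_of_polyhedron_subset_facet[OF polytope_imp_polyhedron[OF poly] f _ 1(2)])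
    thus ?thesis by (intro exI[of _ F] conjI)
  qed
  then obtain F where F: "F facet_of \<sigma>" "\<Union>L \<subseteq> F" by (elim exE conjE)
  have "F face_of P" using F face face_of_trans facet_of_imp_face_of by blast
  moreover have "F \<noteq> {}" using F by (auto simp: facet_of_def)
  ultimately have "F \<in> faces P" by (simp add: faces_def)
  hence "F \<in> C"
  proof (rule maxchain_memI[OF C])
    fix Y assume Y: "Y \<in> C"
    hence "Y \<subseteq> \<sigma> \<or> \<sigma> \<subseteq> Y" using chain \<sigma> by (auto simp: subset_chain_def)
    thus "Y \<subseteq> F \<or> F \<subseteq> Y" using F facet_of_imp_subset[OF F(1)] Y by (auto simp: L_def)
  qed
  thus ?thesis using F by (auto simp: facet_of_def)
qed

lemma maxchain_faces_card:
  fixes P :: "(real^'n) set"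
  assumes P: "polytope P" and C: "subset.maxchain (faces P) C" and dim: "aff_dim P = int N"
  shows "finite C" "card C \<ge> N + 1"
proof -
  have chain: "subset.chain (faces P) C" using C by (rule subset.maxchain_imp_chain)
  show finC: "finite C"
    using chain finite_polytope_faces[OF P] by (auto simp: subset_chain_def faces_def intro: finite_subset)
  have "P \<noteq> {}" using dim by auto
  have "P \<in> C"
  proof (rule maxchain_memI[OF C])
    show "P \<in> faces P" using \<open>P \<noteq> {}\<close> polytope_imp_convex[OF P] by (auto simp: faces_def face_of_refl)
    show "Y \<subseteq> P \<or> P \<subseteq> Y" if "Y \<in> C" for Y
      using that chain face_of_imp_subset by (auto simp: subset_chain_def faces_def)
  qed
  have "\<exists>\<sigma>\<in>C. aff_dim \<sigma> = int N - int k" if "k \<le> N" for k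
    using that
  proof (induction k)
    case 0 thus ?case using \<open>P \<in> C\<close> dim by auto
  next
    case (Suc k)
    then obtain \<sigma> where \<sigma>: "\<sigma> \<in> C" "aff_dim \<sigma> = int N - int k" by auto
    hence "aff_dim \<sigma> > 0" using Suc.prems by simp
    from maxchain_faces_step[OF P C \<sigma>(1) this] obtain \<tau> where "\<tau> \<in> C" "aff_dim \<tau> = aff_dim \<sigma> - 1" ..
    thus ?case using \<sigma>(2) by (intro bexI[of _ \<tau>]) auto
  qed
  hence "(\<lambda>k. int N - int k) ` {..N} \<subseteq> aff_dim ` C" by (force simp: image_iff)
  hence "card ((\<lambda>k. int N - int k) ` {..N}) \<le> card (aff_dim ` C)" using finC by (intro card_mono) auto
  also have "card ((\<lambda>k. int N - int k) ` {..N}) = N + 1" by (subst card_image) (auto simp: inj_on_def)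
  also have "card (aff_dim ` C) \<le> card C" using finC by (rule card_image_le)
  finally show "card C \<ge> N + 1" .
qed

lemma affine_indexed_sum:
  fixes V :: "'a::real_vector set"
  assumes V: "affine V" and Z: "finite Z" "Z \<noteq> {}" and sum: "sum u Z = 1" and p: "\<And>z. z \<in> Z \<Longrightarrow> p z \<in> V"
  shows "(\<Sum>z\<in>Z. u z *\<^sub>R p z) \<in> V"
proof -
  from Z obtain z0 where z0: "z0 \<in> Z" by blast
  let ?W = "(\<lambda>x. x - p z0) ` V"
  have W: "subspace ?W" using affine_diffs_subspace_subtract[OF V p[OF z0]] .
  have "(\<Sum>z\<in>Z. u z *\<^sub>R (p z - p z0)) \<in> ?W"
    using p by (intro subspace_sum[OF W] subspace_mul[OF W]) auto
  moreover have "(\<Sum>z\<in>Z. u z *\<^sub>R (p z - p z0)) = (\<Sum>z\<in>Z. u z *\<^sub>R p z) - p z0"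
    by (simp add: scaleR_diff_right sum_subtractf scaleR_left.sum[symmetric] sum)
  ultimately show ?thesis by auto
qed

text \<open>A point in the relative interior of a face does not lie in the affine hull of a smaller face;
  so the largest face occurring in a relation leads to a contradiction.\<close>

lemma chain_points_independent:
  fixes P :: "(real^'n) set"
  assumes P: "polytope P" and chain: "subset.chain (faces P) C" and finC: "finite C"
    and pt: "\<And>\<sigma>. \<sigma> \<in> C \<Longrightarrow> pt \<sigma> \<in> rel_interior \<sigma>"
    and s0: "(\<Sum>\<sigma>\<in>C. b \<sigma>) = 0" and s1: "(\<Sum>\<sigma>\<in>C. b \<sigma> *\<^sub>R pt \<sigma>) = 0"
  shows "\<forall>\<sigma>\<in>C. b \<sigma> = 0"
proof (rule ccontr)
  assume nz: "\<not> (\<forall>\<sigma>\<in>C. b \<sigma> = 0)"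
  define Z where "Z = {\<sigma>\<in>C. b \<sigma> \<noteq> 0}"
  have Z: "Z \<noteq> {}" "finite Z" "subset.chain (faces P) Z" "Z \<subseteq> C"
    using nz finC chain by (auto simp: Z_def subset_chain_def)
  \<comment> \<open>the union of a finite chain is its largest member\<close>
  define \<sigma> where "\<sigma> = \<Union>Z"
  have \<sigma>: "\<sigma> \<in> Z" unfolding \<sigma>_def using Z by (intro Union_in_chain)
  define Y where "Y = Z - {\<sigma>}"
  have finY: "finite Y" using Z by (simp add: Y_def)
  have sZ: "(\<Sum>\<tau>\<in>Z. b \<tau>) = 0" "(\<Sum>\<tau>\<in>Z. b \<tau> *\<^sub>R pt \<tau>) = 0"
  proof -
    have "(\<Sum>\<tau>\<in>Z. b \<tau>) = (\<Sum>\<tau>\<in>C. b \<tau>)"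
      by (rule sum.mono_neutral_left[OF finC Z(4)]) (simp add: Z_def)
    thus "(\<Sum>\<tau>\<in>Z. b \<tau>) = 0" by (simp only: s0)
    have "(\<Sum>\<tau>\<in>Z. b \<tau> *\<^sub>R pt \<tau>) = (\<Sum>\<tau>\<in>C. b \<tau> *\<^sub>R pt \<tau>)"
      by (rule sum.mono_neutral_left[OF finC Z(4)]) (simp add: Z_def)
    thus "(\<Sum>\<tau>\<in>Z. b \<tau> *\<^sub>R pt \<tau>) = 0" by (simp only: s1)
  qed
  hence sY: "(\<Sum>\<tau>\<in>Y. b \<tau>) = - b \<sigma>" "(\<Sum>\<tau>\<in>Y. b \<tau> *\<^sub>R pt \<tau>) = - (b \<sigma> *\<^sub>R pt \<sigma>)"
    using sum.remove[OF Z(2) \<sigma>, of b] sum.remove[OF Z(2) \<sigma>, of "\<lambda>\<tau>. b \<tau> *\<^sub>R pt \<tau>"]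
    unfolding Y_def by (simp_all add: eq_neg_iff_add_eq_0 add.commute)
  have b\<sigma>: "b \<sigma> \<noteq> 0" using \<sigma> by (simp add: Z_def)
  hence "Y \<noteq> {}" using sY by auto
  define \<rho> where "\<rho> = \<Union>Y"
  have "subset.chain (faces P) Y" using Z by (auto simp: Y_def subset_chain_def)
  hence \<rho>: "\<rho> \<in> Y" unfolding \<rho>_def using finY \<open>Y \<noteq> {}\<close> by (intro Union_in_chain)
  have f: "\<rho> face_of P" "\<sigma> face_of P" "\<rho> \<noteq> \<sigma>" "\<rho> \<subseteq> \<sigma>"
    using \<rho> \<sigma> Z by (auto simp: Y_def subset_chain_def faces_def \<sigma>_def)
  have \<rho>\<sigma>: "\<rho> face_of \<sigma>" by (rule face_of_subset[OF f(1) f(4) face_of_imp_subset[OF f(2)]])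
  have pin: "pt \<tau> \<in> affine hull \<rho>" if "\<tau> \<in> Y" for \<tau>
  proof -
    have "pt \<tau> \<in> \<tau>" using pt[of \<tau>] that Z(4) rel_interior_subset by (auto simp: Y_def)
    thus ?thesis using that by (auto simp: \<rho>_def intro: hull_inc)
  qed
  have "(\<Sum>\<tau>\<in>Y. (- b \<tau> / b \<sigma>) *\<^sub>R pt \<tau>) \<in> affine hull \<rho>"
  proof (rule affine_indexed_sum[OF affine_affine_hull finY \<open>Y \<noteq> {}\<close> _ pin])
    show "(\<Sum>\<tau>\<in>Y. - b \<tau> / b \<sigma>) = 1"
      using b\<sigma> sY(1) by (simp add: sum_divide_distrib[symmetric] sum_negf)
  qed
  also have "(\<Sum>\<tau>\<in>Y. (- b \<tau> / b \<sigma>) *\<^sub>R pt \<tau>) = (- 1 / b \<sigma>) *\<^sub>R (\<Sum>\<tau>\<in>Y. b \<tau> *\<^sub>R pt \<tau>)"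
    by (simp add: scaleR_right.sum)
  also have "\<dots> = pt \<sigma>" using b\<sigma> sY(2) by simp
  finally have "pt \<sigma> \<in> affine hull \<rho> \<inter> rel_interior \<sigma>" using pt \<sigma> Z by auto
  moreover have "convex \<sigma>" using face_of_imp_convex[OF f(2)] .
  ultimately show False using affine_hull_face_of_disjoint_rel_interior[OF _ \<rho>\<sigma> f(3)] by blast
qed

text \<open>All that the coordinates along chains need from a stratification: up to a positive factor, the
  negated weight of \<open>f\<^sub>\<sigma>\<close> is a point of \<open>{1} \<times> \<sigma>\<^sup>o\<close>.\<close>

definition facewise_weights :: "(real^'n) set \<Rightarrow> ((real^'n) set \<Rightarrow> int \<times> (int^'n)) \<Rightarrow> bool" where
  "facewise_weights P \<mu> \<longleftrightarrow> (\<forall>\<sigma>\<in>faces P. \<exists>D>0. \<exists>x\<in>rel_interior \<sigma>.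
     real_of_int (- fst (\<mu> \<sigma>)) = D \<and> real_vec (- snd (\<mu> \<sigma>)) = D *\<^sub>R x)"

lemma facewise_weights_independent:
  fixes P :: "(real^'n) set" and a :: "(real^'n) set \<Rightarrow> rat"
  assumes P: "polytope P" and chain: "subset.chain (faces P) C" and finC: "finite C"
    and \<mu>: "facewise_weights P \<mu>"
    and s0: "(\<Sum>\<sigma>\<in>C. a \<sigma> * rat_of_int (fst (\<mu> \<sigma>))) = 0"
    and s1: "\<And>i. (\<Sum>\<sigma>\<in>C. a \<sigma> * rat_of_int (snd (\<mu> \<sigma>) $ i)) = 0"
  shows "\<forall>\<sigma>\<in>C. a \<sigma> = 0"
proof -
  define D where "D \<sigma> = real_of_int (- fst (\<mu> \<sigma>))" for \<sigma>
  have "\<forall>\<sigma>\<in>C. \<exists>x. D \<sigma> > 0 \<and> x \<in> rel_interior \<sigma> \<and> real_vec (- snd (\<mu> \<sigma>)) = D \<sigma> *\<^sub>R x"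
  proof
    fix \<sigma> assume "\<sigma> \<in> C"
    hence "\<sigma> \<in> faces P" using chain by (auto simp: subset_chain_def)
    thus "\<exists>x. D \<sigma> > 0 \<and> x \<in> rel_interior \<sigma> \<and> real_vec (- snd (\<mu> \<sigma>)) = D \<sigma> *\<^sub>R x"
      using \<mu> unfolding facewise_weights_def D_def by blast
  qed
  from bchoice[OF this] obtain pt where D': "\<forall>\<sigma>\<in>C. D \<sigma> > 0 \<and> pt \<sigma> \<in> rel_interior \<sigma> \<and>
     real_vec (- snd (\<mu> \<sigma>)) = D \<sigma> *\<^sub>R pt \<sigma>" ..
  have D: "\<And>\<sigma>. \<sigma> \<in> C \<Longrightarrow> D \<sigma> > 0" "\<And>\<sigma>. \<sigma> \<in> C \<Longrightarrow> pt \<sigma> \<in> rel_interior \<sigma>"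
    "\<And>\<sigma>. \<sigma> \<in> C \<Longrightarrow> real_of_int (fst (\<mu> \<sigma>)) = - D \<sigma>"
    "\<And>\<sigma>. \<sigma> \<in> C \<Longrightarrow> real_vec (- snd (\<mu> \<sigma>)) = D \<sigma> *\<^sub>R pt \<sigma>"
    using D' by (auto simp: D_def)
  let ?b = "\<lambda>\<sigma>. of_rat (a \<sigma>) * D \<sigma>"
  have "(\<Sum>\<sigma>\<in>C. ?b \<sigma>) = - of_rat (\<Sum>\<sigma>\<in>C. a \<sigma> * rat_of_int (fst (\<mu> \<sigma>)))"
    using D(3) by (simp add: of_rat_sum of_rat_mult sum_negf[symmetric])
  hence b0: "(\<Sum>\<sigma>\<in>C. ?b \<sigma>) = 0" using s0 by simp
  have "(\<Sum>\<sigma>\<in>C. ?b \<sigma> *\<^sub>R pt \<sigma>) = 0"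
  proof (rule vec_eq_iff[THEN iffD2], intro allI)
    fix i
    have "D \<sigma> * pt \<sigma> $ i = - real_of_int (snd (\<mu> \<sigma>) $ i)" if "\<sigma> \<in> C" for \<sigma>
      using arg_cong[OF D(4)[OF that], of "\<lambda>x. x $ i"] by (simp add: real_vec_def)
    hence "(\<Sum>\<sigma>\<in>C. ?b \<sigma> *\<^sub>R pt \<sigma>) $ i = - of_rat (\<Sum>\<sigma>\<in>C. a \<sigma> * rat_of_int (snd (\<mu> \<sigma>) $ i))"
      by (simp add: of_rat_sum of_rat_mult sum_negf[symmetric] mult.assoc)
    thus "(\<Sum>\<sigma>\<in>C. ?b \<sigma> *\<^sub>R pt \<sigma>) $ i = 0 $ i" using s1 by simp
  qed
  hence "\<forall>\<sigma>\<in>C. ?b \<sigma> = 0" by (intro chain_points_independent[OF P chain finC D(2) b0])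
  thus ?thesis using D(1) by (metis less_irrefl mult_eq_0_iff of_rat_eq_0_iff)
qed

text \<open>A maximal chain has \<open>n + 1\<close> members, so independence over the rationals gives a basis.\<close>

lemma chain_coords_ex1:
  fixes P :: "(real^'n) set"
  assumes P: "polytope P" "aff_dim P = int CARD('n)" and C: "subset.maxchain (faces P) C"
    and \<mu>: "facewise_weights P \<mu>"
  shows "\<exists>!a :: (real^'n) set \<Rightarrow> rat. (\<forall>\<sigma>. \<sigma> \<notin> C \<longrightarrow> a \<sigma> = 0) \<and>
     rat_of_int (fst w) = (\<Sum>\<sigma>\<in>C. a \<sigma> * rat_of_int (fst (\<mu> \<sigma>))) \<and>
     (\<forall>i. rat_of_int (snd w $ i) = (\<Sum>\<sigma>\<in>C. a \<sigma> * rat_of_int (snd (\<mu> \<sigma>) $ i)))"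
proof -
  have chain: "subset.chain (faces P) C" using C by (rule subset.maxchain_imp_chain)
  note cC = maxchain_faces_card[OF P(1) C P(2)]
  note ind = facewise_weights_independent[OF P(1) chain cC(1) \<mu>]
  \<comment> \<open>one index type for the \<open>n + 1\<close> coordinates of \<open>\<int> \<times> M\<close>: \<open>None\<close> is the degree\<close>
  define vec :: "int \<times> (int^'n) \<Rightarrow> rat ^ 'n option"
    where "vec u = (\<chi> i. case i of None \<Rightarrow> rat_of_int (fst u) | Some j \<Rightarrow> rat_of_int (snd u $ j))" for u
  have vec: "(\<Sum>\<sigma>\<in>C. a \<sigma> *s vec (\<mu> \<sigma>)) = vec u \<longleftrightarrow>
      rat_of_int (fst u) = (\<Sum>\<sigma>\<in>C. a \<sigma> * rat_of_int (fst (\<mu> \<sigma>))) \<and>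
      (\<forall>i. rat_of_int (snd u $ i) = (\<Sum>\<sigma>\<in>C. a \<sigma> * rat_of_int (snd (\<mu> \<sigma>) $ i)))" for a u
    unfolding vec_eq_iff vec_def split_option_all by (auto simp: eq_commute)
  have vec0: "vec 0 = 0" by (auto simp: vec_def vec_eq_iff split: option.splits)
  have ind': "\<forall>\<sigma>\<in>C. a \<sigma> = 0" if "(\<Sum>\<sigma>\<in>C. a \<sigma> *s vec (\<mu> \<sigma>)) = 0" for a
  proof -
    have "(\<Sum>\<sigma>\<in>C. a \<sigma> *s vec (\<mu> \<sigma>)) = vec 0" using that vec0 by simp
    hence "(\<Sum>\<sigma>\<in>C. a \<sigma> * rat_of_int (fst (\<mu> \<sigma>))) = 0"
       "\<And>i. (\<Sum>\<sigma>\<in>C. a \<sigma> * rat_of_int (snd (\<mu> \<sigma>) $ i)) = 0"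
      unfolding vec by auto
    thus ?thesis by (rule ind)
  qed
  let ?v = "\<lambda>\<sigma>. vec (\<mu> \<sigma>)"
  have inj: "inj_on ?v C"
  proof (rule inj_onI, rule ccontr)
    fix \<sigma> \<tau> assume st: "\<sigma> \<in> C" "\<tau> \<in> C" "?v \<sigma> = ?v \<tau>" "\<sigma> \<noteq> \<tau>"
    let ?a = "\<lambda>\<rho>. if \<rho> = \<sigma> then 1 else if \<rho> = \<tau> then - 1 else (0 :: rat)"
    have "(\<Sum>\<rho>\<in>C. ?a \<rho> *s ?v \<rho>) = (\<Sum>\<rho>\<in>{\<sigma>, \<tau>}. ?a \<rho> *s ?v \<rho>)"
      using st cC(1) by (intro sum.mono_neutral_right) auto
    also have "\<dots> = 0" using st by simp
    finally show False using ind'[of ?a] st by auto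
  qed
  have "vec.independent (?v ` C)"
  proof (rule vec.independent_if_scalars_zero)
    show "finite (?v ` C)" using cC by simp
    fix f x assume f: "(\<Sum>x\<in>?v ` C. f x *s x) = 0" and x: "x \<in> ?v ` C"
    have "(\<Sum>\<sigma>\<in>C. f (?v \<sigma>) *s ?v \<sigma>) = 0" using f by (simp add: sum.reindex[OF inj] o_def)
    from ind'[OF this] x show "f x = 0" by auto
  qed
  moreover have "vec.dim (UNIV :: (rat ^ 'n option) set) \<le> card (?v ` C)"
    using cC(2) by (simp only: vec_dim_card card_image[OF inj]) simp
  ultimately have span: "UNIV \<subseteq> vec.span (?v ` C)" by (intro vec.card_ge_dim_independent) auto
  have "vec w \<in> vec.span (?v ` C)" using span by blast
  then obtain u where "vec w = (\<Sum>x\<in>?v ` C. u x *s x)" using cC(1) by (auto simp: vec.span_finite)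
  hence u: "(\<Sum>\<sigma>\<in>C. u (?v \<sigma>) *s ?v \<sigma>) = vec w" by (simp add: sum.reindex[OF inj] o_def)
  show ?thesis
    unfolding vec[symmetric]
  proof (rule ex1I)
    let ?a = "\<lambda>\<sigma>. if \<sigma> \<in> C then u (?v \<sigma>) else 0"
    show "(\<forall>\<sigma>. \<sigma> \<notin> C \<longrightarrow> ?a \<sigma> = 0) \<and> (\<Sum>\<sigma>\<in>C. ?a \<sigma> *s ?v \<sigma>) = vec w" using u by simp
  next
    fix a :: "(real^'n) set \<Rightarrow> rat"
    assume a: "(\<forall>\<sigma>. \<sigma> \<notin> C \<longrightarrow> a \<sigma> = 0) \<and> (\<Sum>\<sigma>\<in>C. a \<sigma> *s ?v \<sigma>) = vec w"
    have "(\<Sum>\<sigma>\<in>C. (a \<sigma> - u (?v \<sigma>)) *s ?v \<sigma>) = 0"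
      using a u by (simp add: vec.scale_left_diff_distrib sum_subtractf)
    from ind'[OF this] show "a = (\<lambda>\<sigma>. if \<sigma> \<in> C then u (?v \<sigma>) else 0)" using a by auto
  qed
qed

lemma chain_coords_unique:
  fixes P :: "(real^'n) set"
  assumes "polytope P" "aff_dim P = int CARD('n)" "subset.maxchain (faces P) C" "facewise_weights P \<mu>"
    and "\<And>\<sigma>. \<sigma> \<notin> C \<Longrightarrow> a \<sigma> = 0" "rat_of_int (fst w) = (\<Sum>\<sigma>\<in>C. a \<sigma> * rat_of_int (fst (\<mu> \<sigma>)))"
     "\<And>i. rat_of_int (snd w $ i) = (\<Sum>\<sigma>\<in>C. a \<sigma> * rat_of_int (snd (\<mu> \<sigma>) $ i))"
  shows "chain_coords \<mu> C w = a"
  unfolding chain_coords_def using assms(5-7) by (intro the1_equality[OF chain_coords_ex1[OF assms(1-4)]]) auto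

lemma chain_coords_properties:
  fixes P :: "(real^'n) set"
  assumes "polytope P" "aff_dim P = int CARD('n)" "subset.maxchain (faces P) C" "facewise_weights P \<mu>"
  shows "\<sigma> \<notin> C \<Longrightarrow> chain_coords \<mu> C w \<sigma> = 0"
    and "rat_of_int (fst w) = (\<Sum>\<sigma>\<in>C. chain_coords \<mu> C w \<sigma> * rat_of_int (fst (\<mu> \<sigma>)))"
    and "rat_of_int (snd w $ i) = (\<Sum>\<sigma>\<in>C. chain_coords \<mu> C w \<sigma> * rat_of_int (snd (\<mu> \<sigma>) $ i))"
  using theI'[OF chain_coords_ex1[OF assms, of w]] unfolding chain_coords_def[symmetric] by auto

lemma chain_coords_add:
  fixes P :: "(real^'n) set"
  assumes "polytope P" "aff_dim P = int CARD('n)" "subset.maxchain (faces P) C" "facewise_weights P \<mu>"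
  shows "chain_coords \<mu> C (u + w) = (\<lambda>\<sigma>. chain_coords \<mu> C u \<sigma> + chain_coords \<mu> C w \<sigma>)"
proof (rule chain_coords_unique[OF assms])
  note p = chain_coords_properties[OF assms]
  show "chain_coords \<mu> C u \<sigma> + chain_coords \<mu> C w \<sigma> = 0" if "\<sigma> \<notin> C" for \<sigma>
    using p(1)[OF that] by simp
  show "rat_of_int (fst (u + w))
      = (\<Sum>\<sigma>\<in>C. (chain_coords \<mu> C u \<sigma> + chain_coords \<mu> C w \<sigma>) * rat_of_int (fst (\<mu> \<sigma>)))"
    by (simp only: fst_add of_int_add distrib_right sum.distrib p(2)[symmetric])
  show "rat_of_int (snd (u + w) $ i)
      = (\<Sum>\<sigma>\<in>C. (chain_coords \<mu> C u \<sigma> + chain_coords \<mu> C w \<sigma>) * rat_of_int (snd (\<mu> \<sigma>) $ i))" for i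
    by (simp only: snd_add vector_add_component of_int_add distrib_right sum.distrib p(3)[symmetric])
qed

lemma chain_coords_0:
  fixes P :: "(real^'n) set"
  assumes "polytope P" "aff_dim P = int CARD('n)" "subset.maxchain (faces P) C" "facewise_weights P \<mu>"
  shows "chain_coords \<mu> C 0 = (\<lambda>\<sigma>. 0)"
  by (intro chain_coords_unique[OF assms]) simp_all

section \<open>The lexicographic order\<close>

lemma lex_less_irrefl: "\<not> lex_less r a a"
  by (auto simp: lex_less_def)

lemma lex_less_trans:
  assumes r: "linear_order_on A r" and ab: "lex_less r a b" and bc: "lex_less r b c"
  shows "lex_less r a c"
proof -
  have tr: "trans r" and as: "antisym r"
    using r by (auto simp: linear_order_on_def partial_order_on_def preorder_on_def)
  have tot: "(x, y) \<in> r \<or> (y, x) \<in> r" if "x \<in> Field r" "y \<in> Field r" "x \<noteq> y" for x y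
  proof -
    have sub: "r \<subseteq> A \<times> A" and tot: "total_on A r"
      using r by (simp_all add: linear_order_on_def partial_order_on_def preorder_on_def)
    have "x \<in> A" "y \<in> A" using that(1,2) sub unfolding Field_def by blast+
    thus ?thesis using tot that(3) unfolding total_on_def by blast
  qed
  obtain \<sigma> where \<sigma>: "\<sigma> \<in> Field r" "a \<sigma> < b \<sigma>" "\<And>\<tau>. (\<sigma>, \<tau>) \<in> r \<Longrightarrow> \<tau> \<noteq> \<sigma> \<Longrightarrow> a \<tau> = b \<tau>"
    using ab by (auto simp: lex_less_def)
  obtain \<rho> where \<rho>: "\<rho> \<in> Field r" "b \<rho> < c \<rho>" "\<And>\<tau>. (\<rho>, \<tau>) \<in> r \<Longrightarrow> \<tau> \<noteq> \<rho> \<Longrightarrow> b \<tau> = c \<tau>"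
    using bc by (auto simp: lex_less_def)
  consider "\<sigma> = \<rho>" | "(\<sigma>, \<rho>) \<in> r" "\<sigma> \<noteq> \<rho>" | "(\<rho>, \<sigma>) \<in> r" "\<sigma> \<noteq> \<rho>"
    using tot[OF \<sigma>(1) \<rho>(1)] by blast
  thus ?thesis
  proof cases
    case 1
    thus ?thesis using \<sigma> \<rho> unfolding lex_less_def by (intro bexI[of _ \<sigma>]) auto
  next
    case 2
    have "a \<tau> = c \<tau>" if "(\<rho>, \<tau>) \<in> r" "\<tau> \<noteq> \<rho>" for \<tau>
      using that 2 \<sigma>(3)[of \<tau>] \<rho>(3)[of \<tau>] transD[OF tr 2(1)] antisymD[OF as 2(1)] by metis
    thus ?thesis using 2 \<sigma>(3)[of \<rho>] \<rho>(1,2) unfolding lex_less_def by (intro bexI[of _ \<rho>]) auto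
  next
    case 3
    have "a \<tau> = c \<tau>" if "(\<sigma>, \<tau>) \<in> r" "\<tau> \<noteq> \<sigma>" for \<tau>
      using that 3 \<sigma>(3)[of \<tau>] \<rho>(3)[of \<tau>] transD[OF tr 3(1)] antisymD[OF as 3(1)] by metis
    thus ?thesis using 3 \<rho>(3)[of \<sigma>] \<sigma>(1,2) unfolding lex_less_def by (intro bexI[of _ \<sigma>]) auto
  qed
qed

text \<open>Incomparable vectors could only differ off the finite set \<open>A\<close>, so both are required to vanish
  there.\<close>

lemma lex_less_total:
  assumes r: "linear_order_on A r" and A: "finite A"
    and a: "\<And>\<sigma>. \<sigma> \<notin> A \<Longrightarrow> a \<sigma> = 0" and b: "\<And>\<sigma>. \<sigma> \<notin> A \<Longrightarrow> b \<sigma> = 0" and ne: "a \<noteq> b"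
  shows "lex_less r a b \<or> lex_less r b a"
proof -
  have tr: "trans r" and as: "antisym r" and rf: "\<And>x. x \<in> A \<Longrightarrow> (x, x) \<in> r" and sub: "r \<subseteq> A \<times> A"
    and tot: "\<And>x y. x \<in> A \<Longrightarrow> y \<in> A \<Longrightarrow> x \<noteq> y \<Longrightarrow> (x, y) \<in> r \<or> (y, x) \<in> r"
    using r by (auto simp: linear_order_on_def partial_order_on_def preorder_on_def total_on_def refl_on_def)
  have max: "\<exists>m\<in>D. \<forall>x\<in>D. (x, m) \<in> r" if "finite D" "D \<noteq> {}" "D \<subseteq> A" for D
    using that
  proof (induction D rule: finite_ne_induct)
    case (singleton x) thus ?case using rf by auto
  next
    case (insert x D)
    then obtain m where m: "m \<in> D" "\<forall>y\<in>D. (y, m) \<in> r" by auto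
    have "(x, m) \<in> r \<or> (m, x) \<in> r" using tot[of x m] rf[of x] m insert by auto
    thus ?case
    proof
      assume "(m, x) \<in> r"
      hence "\<forall>y\<in>insert x D. (y, x) \<in> r" using m transD[OF tr] rf insert.prems by blast
      thus ?thesis by blast
    qed (use m in blast)
  qed
  define D where "D = {\<sigma>\<in>A. a \<sigma> \<noteq> b \<sigma>}"
  have "D \<noteq> {}" using ne a b by (fastforce simp: D_def fun_eq_iff)
  then obtain m where m: "m \<in> D" "\<forall>x\<in>D. (x, m) \<in> r" using max[of D] A by (auto simp: D_def)
  have eq: "a \<tau> = b \<tau>" if "(m, \<tau>) \<in> r" "\<tau> \<noteq> m" for \<tau>
    using that m(2) sub antisymD[OF as that(1)] by (auto simp: D_def)
  have "m \<in> Field r" using m(1) rf by (auto simp: D_def Field_def)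
  moreover have "a m < b m \<or> b m < a m" using m(1) by (auto simp: D_def)
  ultimately show ?thesis using eq unfolding lex_less_def by metis
qed

lemma lex_less_add: "lex_less r a b \<Longrightarrow> lex_less r (\<lambda>\<sigma>. a \<sigma> + c \<sigma>) (\<lambda>\<sigma>. b \<sigma> + c \<sigma>)"
  by (auto simp: lex_less_def)

lemma lex_le_refl [simp]: "lex_le r a a" by (simp add: lex_le_def)

lemma lex_le_trans:
  "linear_order_on A r \<Longrightarrow> lex_le r a b \<Longrightarrow> lex_le r b c \<Longrightarrow> lex_le r a c"
  by (auto simp: lex_le_def intro: lex_less_trans)

lemma lex_less_le_trans:
  "linear_order_on A r \<Longrightarrow> lex_less r a b \<Longrightarrow> lex_le r b c \<Longrightarrow> lex_less r a c"
  by (auto simp: lex_le_def intro: lex_less_trans)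

lemma lex_le_antisym: "linear_order_on A r \<Longrightarrow> lex_le r a b \<Longrightarrow> lex_le r b a \<Longrightarrow> a = b"
  by (auto simp: lex_le_def dest: lex_less_trans lex_less_irrefl[THEN notE])

lemma lex_le_add: "lex_le r a b \<Longrightarrow> lex_le r (\<lambda>\<sigma>. a \<sigma> + c \<sigma>) (\<lambda>\<sigma>. b \<sigma> + c \<sigma>)"
  by (auto simp: lex_le_def lex_less_add)

lemma lex_le_add_mono:
  assumes r: "linear_order_on A r" and "lex_le r a b" "lex_le r c d"
  shows "lex_le r (\<lambda>\<sigma>. a \<sigma> + c \<sigma>) (\<lambda>\<sigma>. b \<sigma> + d \<sigma>)"
  using lex_le_trans[OF r lex_le_add[OF assms(2), of c] lex_le_add[OF assms(3), of b, unfolded add.commute[of _ "b _"]]]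
  by simp

lemma lex_less_le_add_mono:
  assumes r: "linear_order_on A r" and "lex_less r a b" "lex_le r c d"
  shows "lex_less r (\<lambda>\<sigma>. a \<sigma> + c \<sigma>) (\<lambda>\<sigma>. b \<sigma> + d \<sigma>)"
proof -
  have "lex_le r (\<lambda>\<sigma>. b \<sigma> + c \<sigma>) (\<lambda>\<sigma>. b \<sigma> + d \<sigma>)"
    using lex_le_add[OF assms(3), of b] by (simp add: add.commute)
  thus ?thesis using lex_less_le_trans[OF r lex_less_add[OF assms(2)]] by blast
qed

lemma lex_min_eqI:
  assumes r: "linear_order_on A r" and "a \<in> B" "\<And>b. b \<in> B \<Longrightarrow> lex_le r a b"
  shows "lex_min r B = a"
  unfolding lex_min_def using assms by (intro the_equality) (auto intro: lex_le_antisym[OF r])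

lemma lex_min_exists:
  assumes r: "linear_order_on A r" and A: "finite A" and B: "finite B" "B \<noteq> {}"
    and van: "\<And>b \<sigma>. b \<in> B \<Longrightarrow> \<sigma> \<notin> A \<Longrightarrow> b \<sigma> = 0"
  shows "\<exists>a\<in>B. \<forall>b\<in>B. lex_le r a b"
  using B van
proof (induction B rule: finite_ne_induct)
  case (insert x B)
  then obtain a where a: "a \<in> B" "\<forall>b\<in>B. lex_le r a b" by auto
  have "lex_le r x a \<or> lex_le r a x"
    using lex_less_total[OF r A, of x a] insert.prems a(1) by (auto simp: lex_le_def)
  thus ?case
  proof
    assume "lex_le r x a"
    hence "lex_le r x b" if "b \<in> insert x B" for b
      using a(2) lex_le_trans[OF r, of x a b] that by auto
    thus ?thesis by auto
  next
    assume "lex_le r a x"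
    hence "\<forall>b\<in>insert x B. lex_le r a b" using a(2) by simp
    thus ?thesis using a(1) by auto
  qed
qed auto

lemma lex_min_properties:
  assumes r: "linear_order_on A r" and A: "finite A" and B: "finite B" "B \<noteq> {}"
    and van: "\<And>b \<sigma>. b \<in> B \<Longrightarrow> \<sigma> \<notin> A \<Longrightarrow> b \<sigma> = 0"
  shows "lex_min r B \<in> B" and "\<And>b. b \<in> B \<Longrightarrow> lex_le r (lex_min r B) b"
proof -
  have "\<exists>a\<in>B. \<forall>b\<in>B. lex_le r a b" by (rule lex_min_exists[OF r A B]) (rule van)
  then obtain a where a: "a \<in> B" "\<forall>b\<in>B. lex_le r a b" by (elim bexE)
  have "lex_min r B = a" using a(2) by (intro lex_min_eqI[OF r a(1)]) simp
  thus "lex_min r B \<in> B" and "\<And>b. b \<in> B \<Longrightarrow> lex_le r (lex_min r B) b" using a by simp_all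
qed

section \<open>The quasi-valuation\<close>

lemma finite_lattice_points:
  fixes P :: "(real^'n) set"
  assumes "bounded P"
  shows "finite (lattice_points P)"
proof -
  obtain B where B: "\<And>x. x \<in> P \<Longrightarrow> norm x \<le> B" using assms by (auto simp: bounded_iff)
  have "finite ((\<lambda>v i. v $ i) ` lattice_points P)"
  proof (rule finite_subset)
    show "(\<lambda>v i. v $ i) ` lattice_points P \<subseteq> PiE UNIV (\<lambda>_. {- \<lceil>B\<rceil>..\<lceil>B\<rceil>})"
    proof safe
      fix \<eta> :: "int^'n" and i assume "\<eta> \<in> lattice_points P"
      hence "norm (real_vec \<eta>) \<le> B" using B by (simp add: lattice_points_def)
      hence "\<bar>real_of_int (\<eta> $ i)\<bar> \<le> B"
        using component_le_norm_cart[of "real_vec \<eta>" i] by (simp add: real_vec_def)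
      thus "\<eta> $ i \<in> {- \<lceil>B\<rceil>..\<lceil>B\<rceil>}" by (auto simp: abs_le_iff) linarith+
    qed auto
    show "finite (PiE (UNIV::'n set) (\<lambda>_. {- \<lceil>B\<rceil>..\<lceil>B\<rceil>}))" by (rule finite_PiE) auto
  qed
  thus ?thesis by (rule finite_imageD) (auto simp: inj_on_def vec_eq_iff fun_eq_iff)
qed

locale seshadri =
  fixes P :: "(real^'n) set" and r :: "(real^'n) set rel"
    and X :: "(real^'n) set \<Rightarrow> (int^'n \<Rightarrow> 'k::field_char_0) set set"
    and f :: "(real^'n) set \<Rightarrow> ('n, 'k) cfun"
  assumes full_dim: "full_dim_normal_lattice_polytope P"
    and refines: "refines_face_order P r"
    and strat: "combinatorial_seshadri_stratification P X f"
begin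

lemma polytope: "polytope P"
  using full_dim by (auto simp: full_dim_normal_lattice_polytope_def lattice_polytope_def polytope_def)

lemma aff_dim: "aff_dim P = int CARD('n)"
  using full_dim by (simp add: full_dim_normal_lattice_polytope_def)

lemma fin: "finite (lattice_points P)"
  using finite_lattice_points polytope_imp_bounded[OF polytope] .

lemma lattice_points_nonempty: "lattice_points P \<noteq> {}"
proof -
  obtain F where F: "P = convex hull (real_vec ` F)"
    using full_dim by (auto simp: full_dim_normal_lattice_polytope_def lattice_polytope_def)
  have "P \<noteq> {}" using aff_dim by auto
  then obtain \<eta> where "\<eta> \<in> F" using F by auto
  hence "real_vec \<eta> \<in> P" unfolding F by (intro hull_inc) auto
  thus ?thesis by (auto simp: lattice_points_def)
qed

lemma face_order: "linear_order_on (faces P) r"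
  using refines by (simp add: refines_face_order_def)

lemma finite_faces: "finite (faces P)"
  using finite_polytope_faces[OF polytope] by (auto simp: faces_def intro: finite_subset)

abbreviation \<mu> :: "(real^'n) set \<Rightarrow> int \<times> (int^'n)" where
  "\<mu> \<equiv> \<lambda>\<sigma>. weight_of P (f \<sigma>)"

lemma facewise: "facewise_weights P \<mu>"
  unfolding facewise_weights_def
proof
  fix \<sigma> assume \<sigma>: "\<sigma> \<in> faces P"
  obtain u where u: "eigenfunction P (f \<sigma>) u" "fun_degree P (f \<sigma>) \<ge> 1"
    "(real_of_int (- fst u), real_vec (- snd u)) /\<^sub>R real (fun_degree P (f \<sigma>)) \<in> {1} \<times> rel_interior \<sigma>"
    using bspec[OF strat[unfolded combinatorial_seshadri_stratification_def] \<sigma>] by (elim conjE exE)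
  define D where "D = real (fun_degree P (f \<sigma>))"
  have D: "D > 0" using u(2) by (simp add: D_def)
  have "inverse D * real_of_int (- fst u) = 1" "inverse D *\<^sub>R real_vec (- snd u) \<in> rel_interior \<sigma>"
    using u(3) by (auto simp: D_def)
  hence "real_of_int (- fst (\<mu> \<sigma>)) = D" "inverse D *\<^sub>R real_vec (- snd (\<mu> \<sigma>)) \<in> rel_interior \<sigma>"
    using D by (auto simp: weight_of_eq[OF fin u(1)] field_simps)
  thus "\<exists>D>0. \<exists>x\<in>rel_interior \<sigma>. real_of_int (- fst (\<mu> \<sigma>)) = D \<and> real_vec (- snd (\<mu> \<sigma>)) = D *\<^sub>R x"
    using D by (intro exI[of _ D] conjI bexI[of _ "inverse D *\<^sub>R real_vec (- snd (\<mu> \<sigma>))"]) auto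
qed

abbreviation chains :: "(real^'n) set set set" where
  "chains \<equiv> {C. subset.maxchain (faces P) C}"

lemma finite_chains: "finite chains"
proof -
  have "chains \<subseteq> Pow (faces P)" by (auto simp: subset.maxchain_def subset.chain_def)
  thus ?thesis using finite_faces by (auto intro: finite_subset)
qed

lemma chains_nonempty: "chains \<noteq> {}"
  using subset.Hausdorff by auto

lemma coords_vanish: "C \<in> chains \<Longrightarrow> \<sigma> \<notin> faces P \<Longrightarrow> chain_coords \<mu> C w \<sigma> = 0"
  using chain_coords_properties(1)[OF polytope aff_dim _ facewise, of C \<sigma> w]
  by (auto simp: subset.maxchain_def subset.chain_def)

text \<open>The value of the basis element of weight \<open>w\<close>; the torus acts on it with weight \<open>- w\<close>.\<close>

definition mval :: "int \<times> (int^'n) \<Rightarrow> 'n qvec" where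
  "mval w = lex_min r ((\<lambda>C. chain_coords \<mu> C (- w)) ` chains)"

lemma mval_attained: "\<exists>C\<in>chains. mval w = chain_coords \<mu> C (- w)"
  and mval_le: "C \<in> chains \<Longrightarrow> lex_le r (mval w) (chain_coords \<mu> C (- w))"
proof -
  note m = lex_min_properties[OF face_order finite_faces, of "(\<lambda>C. chain_coords \<mu> C (- w)) ` chains"]
  have p: "lex_min r ((\<lambda>C. chain_coords \<mu> C (- w)) ` chains) \<in> (\<lambda>C. chain_coords \<mu> C (- w)) ` chains"
    using finite_chains chains_nonempty by (intro m(1)) (auto simp: coords_vanish)
  thus "\<exists>C\<in>chains. mval w = chain_coords \<mu> C (- w)" unfolding mval_def by blast
  assume "C \<in> chains"
  thus "lex_le r (mval w) (chain_coords \<mu> C (- w))"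
    unfolding mval_def using finite_chains by (intro m(2)) (auto simp: coords_vanish)
qed

lemma mval_vanish: "\<sigma> \<notin> faces P \<Longrightarrow> mval w \<sigma> = 0"
  using mval_attained[of w] by (auto simp: coords_vanish)

lemma mval_0: "mval 0 = (\<lambda>\<sigma>. 0)"
  using mval_attained[of 0] chain_coords_0[OF polytope aff_dim _ facewise] by auto

text \<open>Each chain gives an additive function on weights, and a minimum of additive functions is
  superadditive.\<close>

lemma mval_superadditive: "lex_le r (\<lambda>\<sigma>. mval u \<sigma> + mval w \<sigma>) (mval (u + w))"
proof -
  obtain C where C: "C \<in> chains" "mval (u + w) = chain_coords \<mu> C (- (u + w))"
    using mval_attained by blast
  have "mval (u + w) = (\<lambda>\<sigma>. chain_coords \<mu> C (- u) \<sigma> + chain_coords \<mu> C (- w) \<sigma>)"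
    using C chain_coords_add[OF polytope aff_dim _ facewise, of C "- u" "- w"] by (simp add: add.commute)
  thus ?thesis using lex_le_add_mono[OF face_order mval_le[OF C(1)] mval_le[OF C(1)]] by simp
qed

text \<open>The minimum over chains and the minimum over weight components can be interchanged.\<close>

lemma quasi_valuation_cone_fun:
  assumes d: "d \<in> monoid_algebra P" "d \<noteq> 0"
  shows "quasi_valuation P r f (cone_fun P d) = lex_min r (mval ` supp d)"
proof -
  have ne: "supp d \<noteq> {}" using d by simp
  have img: "(\<lambda>h. chain_coords \<mu> C (weight_of P h)) ` weight_components P (cone_fun P d)
      = (\<lambda>w. chain_coords \<mu> C (- w)) ` supp d" for C
    unfolding weight_components_cone_fun[OF fin d(1)] image_image
    using d(1) by (intro image_cong refl arg_cong2[of _ _ _ _ "chain_coords \<mu>"])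
      (auto simp: weight_of_term[OF fin] monoid_algebra_def in_keys_iff)
  let ?c = "\<lambda>C. lex_min r ((\<lambda>w. chain_coords \<mu> C (- w)) ` supp d)"
  have c: "?c C \<in> (\<lambda>w. chain_coords \<mu> C (- w)) ` supp d"
    "\<And>w. w \<in> supp d \<Longrightarrow> lex_le r (?c C) (chain_coords \<mu> C (- w))" if "C \<in> chains" for C
  proof -
    note m = lex_min_properties[OF face_order finite_faces, of "(\<lambda>w. chain_coords \<mu> C (- w)) ` supp d"]
    show "?c C \<in> (\<lambda>w. chain_coords \<mu> C (- w)) ` supp d"
      using ne that by (intro m(1)) (auto simp: coords_vanish)
    show "lex_le r (?c C) (chain_coords \<mu> C (- w))" if "w \<in> supp d" for w
      using \<open>C \<in> chains\<close> that by (intro m(2)) (auto simp: coords_vanish)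
  qed
  have "quasi_valuation P r f (cone_fun P d) = lex_min r (?c ` chains)"
    unfolding quasi_valuation_def chain_valuation_def img by (rule arg_cong[of _ _ "lex_min r"]) auto
  also have "\<dots> = lex_min r (mval ` supp d)"
  proof (rule lex_min_eqI[OF face_order])
    note m = lex_min_properties[OF face_order finite_faces, of "mval ` supp d"]
    have m1: "lex_min r (mval ` supp d) \<in> mval ` supp d"
      and m2: "\<And>w. w \<in> supp d \<Longrightarrow> lex_le r (lex_min r (mval ` supp d)) (mval w)"
    proof -
      show "lex_min r (mval ` supp d) \<in> mval ` supp d"
        using ne by (intro m(1)) (auto simp: mval_vanish)
      show "lex_le r (lex_min r (mval ` supp d)) (mval w)" if "w \<in> supp d" for w
        using that by (intro m(2)) (auto simp: mval_vanish)
    qed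
    show le: "lex_le r (lex_min r (mval ` supp d)) b" if "b \<in> ?c ` chains" for b
    proof -
      obtain C where C: "C \<in> chains" "b = ?c C" using \<open>b \<in> ?c ` chains\<close> by blast
      then obtain w where w: "w \<in> supp d" "b = chain_coords \<mu> C (- w)" using c(1)[of C] by auto
      show ?thesis unfolding w(2) by (rule lex_le_trans[OF face_order m2[OF w(1)] mval_le[OF C(1)]])
    qed
    obtain w where w: "w \<in> supp d" "lex_min r (mval ` supp d) = mval w" using m1 by blast
    obtain C where C: "C \<in> chains" "mval w = chain_coords \<mu> C (- w)" using mval_attained by blast
    have "lex_le r (?c C) (lex_min r (mval ` supp d))" using c(2)[OF C(1) w(1)] w(2) C(2) by simp
    hence "lex_min r (mval ` supp d) = ?c C" using le C(1) by (intro lex_le_antisym[OF face_order]) auto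
    thus "lex_min r (mval ` supp d) \<in> ?c ` chains" using C(1) by blast
  qed
  finally show ?thesis .
qed

end

section \<open>The associated graded ring\<close>

context seshadri
begin

abbreviation \<Gamma> :: "'n qvec set" where "\<Gamma> \<equiv> val_image P r f"

text \<open>The two filtrations, transported to the monoid algebra. There they are spanned by basis elements,
  because the quasi-valuation is a minimum over the support.\<close>

definition part_ge :: "'n qvec \<Rightarrow> (int \<times> (int^'n) \<Rightarrow>\<^sub>0 'k) set" where
  "part_ge a = {d\<in>monoid_algebra P. \<forall>w\<in>supp d. lex_le r a (mval w)}"

definition part_gt :: "'n qvec \<Rightarrow> (int \<times> (int^'n) \<Rightarrow>\<^sub>0 'k) set" where
  "part_gt a = {d\<in>monoid_algebra P. \<forall>w\<in>supp d. lex_less r a (mval w)}"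

abbreviation vadd :: "'n qvec \<Rightarrow> 'n qvec \<Rightarrow> 'n qvec" where
  "vadd a b \<equiv> (\<lambda>\<sigma>. a \<sigma> + b \<sigma>)"

lemma lex_min_mval:
  assumes "finite B" "B \<noteq> {}"
  shows "lex_min r (mval ` B) \<in> mval ` B" "\<And>w. w \<in> B \<Longrightarrow> lex_le r (lex_min r (mval ` B)) (mval w)"
proof -
  note m = lex_min_properties[OF face_order finite_faces, of "mval ` B"]
  show "lex_min r (mval ` B) \<in> mval ` B" using assms by (intro m(1)) (auto simp: mval_vanish)
  show "lex_le r (lex_min r (mval ` B)) (mval w)" if "w \<in> B" for w
    using assms that by (intro m(2)) (auto simp: mval_vanish)
qed

lemma cone_fun_filtration:
  assumes d: "d \<in> monoid_algebra P"
  shows "cone_fun P d \<in> filt_ge P r f a \<longleftrightarrow> d \<in> part_ge a"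
    and "cone_fun P d \<in> filt_gt P r f a \<longleftrightarrow> d \<in> part_gt a"
proof -
  have "lex_le r a (quasi_valuation P r f (cone_fun P d)) \<longleftrightarrow> (\<forall>w\<in>supp d. lex_le r a (mval w))"
    and "lex_less r a (quasi_valuation P r f (cone_fun P d)) \<longleftrightarrow> (\<forall>w\<in>supp d. lex_less r a (mval w))"
    if "d \<noteq> 0"
  proof -
    have ne: "supp d \<noteq> {}" using that by simp
    show "lex_le r a (quasi_valuation P r f (cone_fun P d)) \<longleftrightarrow> (\<forall>w\<in>supp d. lex_le r a (mval w))"
      using lex_min_mval[OF finite_keys ne] lex_le_trans[OF face_order]
      by (auto simp: quasi_valuation_cone_fun[OF d that])
    show "lex_less r a (quasi_valuation P r f (cone_fun P d)) \<longleftrightarrow> (\<forall>w\<in>supp d. lex_less r a (mval w))"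
      using lex_min_mval[OF finite_keys ne] lex_less_le_trans[OF face_order]
      by (auto simp: quasi_valuation_cone_fun[OF d that])
  qed
  thus "cone_fun P d \<in> filt_ge P r f a \<longleftrightarrow> d \<in> part_ge a"
    and "cone_fun P d \<in> filt_gt P r f a \<longleftrightarrow> d \<in> part_gt a"
    using d by (cases "d = 0", auto simp: filt_ge_def filt_gt_def part_ge_def part_gt_def
        cone_ring_carrier[OF fin] cone_fun_eq_0_iff[OF fin d] intro!: image_eqI[OF _ monoid_algebra_0])+
qed

lemma filt_ge_eq: "filt_ge P r f a = cone_fun P ` part_ge a"
  using cone_fun_filtration(1)
  by (auto simp: filt_ge_def cone_ring_carrier[OF fin] part_ge_def image_iff)

lemma filt_gt_eq: "filt_gt P r f a = cone_fun P ` part_gt a"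
  using cone_fun_filtration(2)
  by (auto simp: filt_gt_def cone_ring_carrier[OF fin] part_gt_def image_iff)

lemma quasi_valuation_basis:
  assumes "w \<in> weight_monoid P"
  shows "quasi_valuation P r f (cone_fun P (trm w 1)) = mval w"
proof -
  have "quasi_valuation P r f (cone_fun P (trm w 1)) = lex_min r {mval w}"
    using quasi_valuation_cone_fun[OF monoid_algebra_term[OF assms, of 1]] by simp
  also have "\<dots> = mval w" by (rule lex_min_eqI[OF face_order]) auto
  finally show ?thesis .
qed

lemma val_image_eq: "\<Gamma> = mval ` weight_monoid P"
proof
  show "\<Gamma> \<subseteq> mval ` weight_monoid P"
  proof
    fix a assume "a \<in> \<Gamma>"
    then obtain d where d: "d \<in> monoid_algebra P" "cone_fun P d \<noteq> (\<lambda>v. 0)"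
      "a = quasi_valuation P r f (cone_fun P d)"
      by (auto simp: val_image_def cone_ring_carrier[OF fin])
    hence "d \<noteq> 0" by auto
    hence "a \<in> mval ` supp d"
      using d lex_min_mval(1)[of "supp d"] by (simp add: quasi_valuation_cone_fun)
    thus "a \<in> mval ` weight_monoid P" using d(1) by (auto simp: monoid_algebra_def)
  qed
  show "mval ` weight_monoid P \<subseteq> \<Gamma>"
  proof
    fix a assume "a \<in> mval ` weight_monoid P"
    then obtain w where w: "w \<in> weight_monoid P" "a = mval w" by blast
    have "trm w (1::'k) \<in> monoid_algebra P" using w by (intro monoid_algebra_term)
    hence "cone_fun P (trm w (1::'k)) \<in> carrier (cone_ring P) - {\<zero>\<^bsub>cone_ring P\<^esub>}"
      by (simp add: cone_ring_carrier[OF fin] cone_fun_eq_0_iff[OF fin])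
    thus "a \<in> \<Gamma>" unfolding val_image_def w(2) quasi_valuation_basis[OF w(1), symmetric]
      by (rule imageI)
  qed
qed

lemma part_gt_0: "0 \<in> part_gt a" by (simp add: part_gt_def monoid_algebra_0)

lemma part_gt_add: "d \<in> part_gt a \<Longrightarrow> e \<in> part_gt a \<Longrightarrow> d + e \<in> part_gt a"
  using keys_add[of d e] unfolding part_gt_def by (auto simp: monoid_algebra_add)

lemma part_gt_uminus: "d \<in> part_gt a \<Longrightarrow> - d \<in> part_gt a"
  unfolding part_gt_def by (auto simp: monoid_algebra_uminus in_keys_iff)

lemma part_gt_diff: "d \<in> part_gt a \<Longrightarrow> e \<in> part_gt a \<Longrightarrow> d - e \<in> part_gt a"
  using part_gt_add[of d a "- e"] part_gt_uminus[of e a] by simp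

lemma part_gt_sum: "(\<And>b. b \<in> B \<Longrightarrow> d b \<in> part_gt a) \<Longrightarrow> sum d B \<in> part_gt a"
  by (induction B rule: infinite_finite_induct) (auto simp: part_gt_0 part_gt_add)

lemma part_gt_subset_ge: "part_gt a \<subseteq> part_ge a"
  by (auto simp: part_gt_def part_ge_def lex_le_def)

lemma part_ge_add: "d \<in> part_ge a \<Longrightarrow> e \<in> part_ge a \<Longrightarrow> d + e \<in> part_ge a"
  using keys_add[of d e] unfolding part_ge_def by (auto simp: monoid_algebra_add)

lemma part_ge_closed: "d \<in> part_ge a \<Longrightarrow> d \<in> monoid_algebra P"
  by (simp add: part_ge_def)

lemma part_gt_closed: "d \<in> part_gt a \<Longrightarrow> d \<in> monoid_algebra P"
  by (simp add: part_gt_def)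

text \<open>The superadditivity of \<open>mval\<close> makes the graded multiplication independent of representatives.\<close>

lemma part_gt_mult_ge:
  assumes "d \<in> part_gt a" "e \<in> part_ge b"
  shows "d * e \<in> part_gt (vadd a b)"
  unfolding part_gt_def
proof (intro CollectI conjI ballI)
  show "d * e \<in> monoid_algebra P"
    using assms part_gt_closed part_ge_closed monoid_algebra_mult[OF fin] by blast
  fix w assume "w \<in> supp (d * e)"
  then obtain u v where uv: "w = u + v" "u \<in> supp d" "v \<in> supp e" using keys_mult[of d e] by blast
  have "lex_less r (vadd a b) (vadd (mval u) (mval v))"
    using assms uv by (intro lex_less_le_add_mono[OF face_order]) (auto simp: part_gt_def part_ge_def)
  thus "lex_less r (vadd a b) (mval w)"
    unfolding uv(1) by (rule lex_less_le_trans[OF face_order _ mval_superadditive])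
qed

lemma part_ge_mult_gt:
  assumes "d \<in> part_ge a" "e \<in> part_gt b"
  shows "d * e \<in> part_gt (vadd a b)"
  using part_gt_mult_ge[OF assms(2,1)] by (simp add: mult.commute add.commute)

lemma part_gt_smult: "d \<in> part_gt a \<Longrightarrow> trm 0 c * d \<in> part_gt a"
proof -
  assume d: "d \<in> part_gt a"
  have "trm 0 c \<in> part_ge (\<lambda>\<sigma>. 0)"
    by (auto simp: part_ge_def mval_0 monoid_algebra_0 intro!: monoid_algebra_term weight_monoid_0[OF fin] split: if_splits)
  from part_ge_mult_gt[OF this d] show ?thesis by simp
qed

text \<open>The coset of \<open>\<Sum> d\<^sub>w f\<^sub>w\<close> modulo the functions of value greater than \<open>a\<close>.\<close>

definition gt_coset :: "'n qvec \<Rightarrow> (int \<times> (int^'n) \<Rightarrow>\<^sub>0 'k) \<Rightarrow> ('n, 'k) cfun set" where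
  "gt_coset a d = (\<lambda>x. cone_fun P (x + d)) ` part_gt a"

lemma coset_eq: "filt_gt P r f a +>\<^bsub>cone_ring P\<^esub> cone_fun P d = gt_coset a d"
  by (auto simp: a_r_coset_def r_coset_def filt_gt_eq gt_coset_def cone_fun_add)

lemma filt_gt_coset: "filt_gt P r f a = gt_coset a 0"
  by (simp add: gt_coset_def filt_gt_eq)

lemma gt_coset_eq_iff:
  assumes "d \<in> monoid_algebra P" "e \<in> monoid_algebra P"
  shows "gt_coset a d = gt_coset a e \<longleftrightarrow> d - e \<in> part_gt a"
proof
  assume "gt_coset a d = gt_coset a e"
  moreover have "cone_fun P (0 + d) \<in> gt_coset a d" unfolding gt_coset_def using part_gt_0 by (rule imageI)
  ultimately obtain x where x: "x \<in> part_gt a" "cone_fun P d = cone_fun P (x + e)"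
    by (auto simp: gt_coset_def)
  hence "d = x + e" using assms by (intro cone_fun_inj[OF fin]) (auto intro: monoid_algebra_add part_gt_closed)
  thus "d - e \<in> part_gt a" using x by simp
next
  have sub: "gt_coset a d \<subseteq> gt_coset a e" if "d - e \<in> part_gt a" for d e
  proof
    fix u assume "u \<in> gt_coset a d"
    then obtain x where x: "x \<in> part_gt a" "u = cone_fun P (x + d)" by (auto simp: gt_coset_def)
    have "x + (d - e) \<in> part_gt a" using x that by (intro part_gt_add)
    moreover have "u = cone_fun P ((x + (d - e)) + e)" using x by simp
    ultimately show "u \<in> gt_coset a e" unfolding gt_coset_def by (intro image_eqI)
  qed
  assume "d - e \<in> part_gt a"
  moreover from this have "e - d \<in> part_gt a" using part_gt_uminus by fastforce
  ultimately show "gt_coset a d = gt_coset a e" using sub by blast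
qed

lemma gt_coset_add: "gt_coset a d <+>\<^bsub>cone_ring P\<^esub> gt_coset a e = gt_coset a (d + e)"
proof
  show "gt_coset a d <+>\<^bsub>cone_ring P\<^esub> gt_coset a e \<subseteq> gt_coset a (d + e)"
  proof
    fix u assume "u \<in> gt_coset a d <+>\<^bsub>cone_ring P\<^esub> gt_coset a e"
    then obtain x y where xy: "x \<in> part_gt a" "y \<in> part_gt a"
      "u = (\<lambda>v. cone_fun P (x + d) v + cone_fun P (y + e) v)"
      by (auto simp: set_add_def set_mult_def gt_coset_def)
    hence "u = cone_fun P ((x + y) + (d + e))" by (simp add: cone_fun_add algebra_simps)
    thus "u \<in> gt_coset a (d + e)" using part_gt_add[OF xy(1,2)] unfolding gt_coset_def by (intro image_eqI)
  qed
  show "gt_coset a (d + e) \<subseteq> gt_coset a d <+>\<^bsub>cone_ring P\<^esub> gt_coset a e"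
  proof
    fix u assume "u \<in> gt_coset a (d + e)"
    then obtain x where x: "x \<in> part_gt a" "u = cone_fun P (x + (d + e))" by (auto simp: gt_coset_def)
    have "u = (\<lambda>v. cone_fun P (x + d) v + cone_fun P (0 + e) v)"
      using x by (simp add: cone_fun_add[symmetric] algebra_simps)
    moreover have "cone_fun P (x + d) \<in> gt_coset a d" "cone_fun P (0 + e) \<in> gt_coset a e"
      unfolding gt_coset_def by (rule imageI[OF x(1)], rule imageI[OF part_gt_0])
    ultimately show "u \<in> gt_coset a d <+>\<^bsub>cone_ring P\<^esub> gt_coset a e"
      unfolding set_add_def set_mult_def by (intro UN_I) simp_all
  qed
qed

subsection \<open>Presenting the graded ring by polynomials\<close>

definition mon_val :: "('i \<Rightarrow> int \<times> (int^'n)) \<Rightarrow> ('i \<Rightarrow>\<^sub>0 nat) \<Rightarrow> 'n qvec" where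
  "mon_val u \<alpha> = (\<lambda>\<sigma>. \<Sum>i\<in>supp \<alpha>. of_nat (coef \<alpha> i) * mval (u i) \<sigma>)"

lemma mon_val_add: "mon_val u (\<alpha> + \<beta>) = vadd (mon_val u \<alpha>) (mon_val u \<beta>)"
proof
  fix \<sigma>
  show "mon_val u (\<alpha> + \<beta>) \<sigma> = mon_val u \<alpha> \<sigma> + mon_val u \<beta> \<sigma>"
    unfolding mon_val_def by (rule supp_sum_add) (auto simp: algebra_simps)
qed

lemma mon_val_0: "mon_val u 0 = (\<lambda>\<sigma>. 0)" by (simp add: mon_val_def)

lemma mon_val_var: "mon_val u (trm i 1) = mval (u i)"
  by (simp add: mon_val_def)

text \<open>The defect of additivity on a monomial. The monomials with equality are the ones that survive in the
  graded ring.\<close>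

lemma mon_val_le: "lex_le r (mon_val u \<alpha>) (mval (mon_weight u \<alpha>))"
proof -
  have scale: "lex_le r (\<lambda>\<sigma>. of_nat n * mval w \<sigma>) (mval (int n * fst w, int n *s snd w))" for n w
  proof (induction n)
    case 0 thus ?case using mval_0 by (simp add: zero_prod_def[symmetric])
  next
    case (Suc n)
    have "(int (Suc n) * fst w, int (Suc n) *s snd w) = w + (int n * fst w, int n *s snd w)"
      by (simp add: prod_eq_iff algebra_simps vector_sadd_rdistrib)
    moreover have "(\<lambda>\<sigma>. of_nat (Suc n) * mval w \<sigma>) = vadd (mval w) (\<lambda>\<sigma>. of_nat n * mval w \<sigma>)"
      by (simp add: algebra_simps)
    ultimately show ?case
      using lex_le_trans[OF face_order lex_le_add_mono[OF face_order lex_le_refl Suc] mval_superadditive]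
      by simp
  qed
  have "lex_le r (\<lambda>\<sigma>. \<Sum>i\<in>B. of_nat (coef \<alpha> i) * mval (u i) \<sigma>)
      (mval (\<Sum>i\<in>B. (int (coef \<alpha> i) * fst (u i), int (coef \<alpha> i) *s snd (u i))))" if "finite B" for B
    using that
  proof (induction B rule: finite_induct)
    case empty thus ?case by (simp add: mval_0)
  next
    case (insert i B)
    show ?case
      using lex_le_trans[OF face_order lex_le_add_mono[OF face_order scale insert.IH] mval_superadditive] insert
      by simp
  qed
  thus ?thesis by (simp add: mon_val_def mon_weight_def)
qed

text \<open>The terms whose formal value is \<open>a\<close>, evaluated in the monoid algebra. Terms of formal value \<open>a\<close> but
  larger true value are kept here; they disappear modulo \<open>part_gt a\<close>.\<close>

definition value_part :: "('i \<Rightarrow> int \<times> (int^'n)) \<Rightarrow> 'n qvec \<Rightarrow> ('i, 'k) mpoly \<Rightarrow> int \<times> (int^'n) \<Rightarrow>\<^sub>0 'k" where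
  "value_part u a g = push (mon_weight u) (restr (\<lambda>\<alpha>. mon_val u \<alpha> = a) g)"

text \<open>The homomorphism from polynomials to the graded ring that sends each variable to the class of its
  basis element. It is defined by a formula because finite products in the graded ring can
  only be computed once the ring laws are established.\<close>

definition graded_map :: "('i \<Rightarrow> int \<times> (int^'n)) \<Rightarrow> ('i, 'k) mpoly \<Rightarrow> 'n qvec \<Rightarrow> ('n, 'k) cfun set" where
  "graded_map u g = (\<lambda>a\<in>\<Gamma>. gt_coset a (value_part u a g))"

lemma value_part_add: "value_part u a (g + h) = value_part u a g + value_part u a h"
  by (simp add: value_part_def restr_add push_add)

lemma value_part_0 [simp]: "value_part u a 0 = 0" by (simp add: value_part_def)

lemma value_part_sum: "value_part u a (sum g B) = (\<Sum>b\<in>B. value_part u a (g b))"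
  by (simp add: value_part_def restr_sum push_sum)

lemma value_part_term: "value_part u a (trm \<alpha> c) = (if mon_val u \<alpha> = a then trm (mon_weight u \<alpha>) c else 0)"
  by (simp add: value_part_def restr_trm)

lemma value_part_eq_0: "a \<notin> mon_val u ` supp g \<Longrightarrow> value_part u a g = 0"
proof -
  assume "a \<notin> mon_val u ` supp g"
  hence "supp (restr (\<lambda>\<alpha>. mon_val u \<alpha> = a) g) = {}" by auto
  hence "restr (\<lambda>\<alpha>. mon_val u \<alpha> = a) g = 0" by (simp only: keys_eq_empty)
  thus ?thesis by (simp add: value_part_def)
qed

lemma value_part_in_ge:
  assumes u: "u \<in> I \<rightarrow> weight_monoid P" and g: "g \<in> carrier (poly_ring I)"
  shows "value_part u a g \<in> part_ge a"
  unfolding part_ge_def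
proof (intro CollectI conjI ballI)
  show "value_part u a g \<in> monoid_algebra P"
    unfolding value_part_def using u g by (intro push_in_monoid_algebra[OF fin, of I]) (auto intro: poly_ring_closed)
  fix w assume "w \<in> supp (value_part u a g)"
  then obtain \<alpha> where "w = mon_weight u \<alpha>" "mon_val u \<alpha> = a"
    unfolding value_part_def using supp_push[of "mon_weight u" "restr (\<lambda>\<alpha>. mon_val u \<alpha> = a) g"] by auto
  thus "lex_le r a (mval w)" using mon_val_le by blast
qed

text \<open>When \<open>a\<close> is not a value of the quasi-valuation, no term of formal value \<open>a\<close> can attain it.\<close>

lemma value_part_in_gt_outside:
  assumes u: "u \<in> I \<rightarrow> weight_monoid P" and g: "g \<in> carrier (poly_ring I)" and a: "a \<notin> \<Gamma>"
  shows "value_part u a g \<in> part_gt a"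
  unfolding part_gt_def
proof (intro CollectI conjI ballI)
  have ge: "value_part u a g \<in> part_ge a" by (rule value_part_in_ge[OF u g])
  thus MA: "value_part u a g \<in> monoid_algebra P" by (rule part_ge_closed)
  fix w assume w: "w \<in> supp (value_part u a g)"
  hence "w \<in> weight_monoid P" using MA unfolding monoid_algebra_def by blast
  hence "a \<noteq> mval w" using a unfolding val_image_eq by blast
  moreover have "lex_le r a (mval w)" using ge w unfolding part_ge_def by blast
  ultimately show "lex_less r a (mval w)" unfolding lex_le_def by blast
qed

lemma graded_map_support:
  assumes u: "u \<in> I \<rightarrow> weight_monoid P" and g: "g \<in> carrier (poly_ring I)"
  shows "a \<in> gr_support P r f (graded_map u g) \<longleftrightarrow> value_part u a g \<notin> part_gt a"
proof -
  have "gt_coset a (value_part u a g) = gt_coset a 0 \<longleftrightarrow> value_part u a g \<in> part_gt a"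
    using gt_coset_eq_iff[OF part_ge_closed[OF value_part_in_ge[OF u g]] monoid_algebra_0] by simp
  thus ?thesis using value_part_in_gt_outside[OF u g]
    by (auto simp: gr_support_def graded_map_def filt_gt_coset)
qed

lemma gr_ring_simps:
  "zero (gr_ring P r f) = (\<lambda>a\<in>\<Gamma>. filt_gt P r f a)"
  "add (gr_ring P r f) = (\<lambda>F G. \<lambda>a\<in>\<Gamma>. F a <+>\<^bsub>cone_ring P\<^esub> G a)"
  "one (gr_ring P r f) = gr_class P r f \<one>\<^bsub>cone_ring P\<^esub>"
  "smult (gr_ring P r f) = (\<lambda>c F. \<lambda>a\<in>\<Gamma>. \<Union>u\<in>F a. filt_gt P r f a +>\<^bsub>cone_ring P\<^esub> (c \<odot>\<^bsub>cone_ring P\<^esub> u))"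
  by (simp_all add: gr_ring_def)

lemma graded_map_support_finite:
  assumes u: "u \<in> I \<rightarrow> weight_monoid P" and g: "g \<in> carrier (poly_ring I)"
  shows "gr_support P r f (graded_map u g) \<subseteq> mon_val u ` supp g"
  using graded_map_support[OF u g] value_part_eq_0[of _ u g] part_gt_0 by force

lemma graded_map_closed:
  assumes u: "u \<in> I \<rightarrow> weight_monoid P" and g: "g \<in> carrier (poly_ring I)"
  shows "graded_map u g \<in> carrier (gr_ring P r f)"
proof -
  have "gt_coset a (value_part u a g) \<in> {filt_gt P r f a +>\<^bsub>cone_ring P\<^esub> g |g. g \<in> filt_ge P r f a}" for a
  proof (intro CollectI exI conjI)
    show "gt_coset a (value_part u a g) = filt_gt P r f a +>\<^bsub>cone_ring P\<^esub> cone_fun P (value_part u a g)"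
      by (rule coset_eq[symmetric])
    show "cone_fun P (value_part u a g) \<in> filt_ge P r f a"
      unfolding filt_ge_eq by (intro imageI value_part_in_ge[OF u g])
  qed
  moreover have "finite (gr_support P r f (graded_map u g))"
    using graded_map_support_finite[OF u g] by (rule finite_subset) auto
  ultimately show ?thesis by (auto simp: gr_ring_def graded_map_def)
qed

lemma graded_map_add: "graded_map u (g + h) = graded_map u g \<oplus>\<^bsub>gr_ring P r f\<^esub> graded_map u h"
  unfolding gr_ring_simps graded_map_def by (intro restrict_ext) (simp add: value_part_add gt_coset_add)

lemma graded_map_0: "graded_map u 0 = \<zero>\<^bsub>gr_ring P r f\<^esub>"
  unfolding gr_ring_simps graded_map_def by (intro restrict_ext) (simp add: filt_gt_coset)

lemma gr_class_basis:
  assumes "w \<in> weight_monoid P"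
  shows "gr_class P r f (cone_fun P (trm w 1)) = (\<lambda>a\<in>\<Gamma>. gt_coset a (if mval w = a then trm w 1 else 0))"
  unfolding gr_class_def quasi_valuation_basis[OF assms]
  by (intro restrict_ext) (auto simp: coset_eq simp flip: filt_gt_coset)

lemma graded_map_var:
  assumes "u i \<in> weight_monoid P"
  shows "graded_map u (trm (trm i 1) 1) = gr_class P r f (basis_fun P (u i))"
proof -
  have "mon_weight u (trm i 1) = u i" by (simp add: mon_weight_term)
  moreover have "basis_fun P (u i) = cone_fun P (trm (u i) (1::'k))" by (simp add: cone_fun_term)
  ultimately show ?thesis
    using gr_class_basis[OF assms] by (simp only: graded_map_def value_part_term mon_val_var)
qed

lemma graded_map_1: "graded_map u 1 = \<one>\<^bsub>gr_ring P r f\<^esub>"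
proof -
  have "\<one>\<^bsub>cone_ring P\<^esub> = cone_fun P (trm 0 (1::'k))" using cone_fun_1[OF fin, where 'k = 'k] by simp
  moreover have "value_part u a 1 = (if mval 0 = a then trm 0 1 else 0)" for a
    using value_part_term[of u a 0 1] by (simp add: mon_val_0 mval_0)
  ultimately show ?thesis
    using gr_class_basis[OF weight_monoid_0[OF fin]] by (simp only: gr_ring_simps graded_map_def)
qed

lemma graded_map_smult: "graded_map u (trm \<alpha> c) = c \<odot>\<^bsub>gr_ring P r f\<^esub> graded_map u (trm \<alpha> 1)"
  if "u \<in> I \<rightarrow> weight_monoid P" "supp \<alpha> \<subseteq> I"
proof -
  have MA: "value_part u a (trm \<alpha> x) \<in> monoid_algebra P" for a x
    using that by (intro part_ge_closed[OF value_part_in_ge[of u I]] poly_ring_term_closed)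
  have scale: "value_part u a (trm \<alpha> c) = trm 0 c * value_part u a (trm \<alpha> 1)" for a
    by (simp add: value_part_term mult_single)
  have "(\<Union>h\<in>gt_coset a (value_part u a (trm \<alpha> 1)). filt_gt P r f a +>\<^bsub>cone_ring P\<^esub> (c \<odot>\<^bsub>cone_ring P\<^esub> h))
      = gt_coset a (value_part u a (trm \<alpha> c))" for a
  proof -
    have "filt_gt P r f a +>\<^bsub>cone_ring P\<^esub> (c \<odot>\<^bsub>cone_ring P\<^esub> h) = gt_coset a (value_part u a (trm \<alpha> c))"
      if h: "h \<in> gt_coset a (value_part u a (trm \<alpha> 1))" for h
    proof -
      obtain x where x: "x \<in> part_gt a" "h = cone_fun P (x + value_part u a (trm \<alpha> 1))"
        using h by (auto simp: gt_coset_def)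
      have xMA: "x + value_part u a (trm \<alpha> 1) \<in> monoid_algebra P"
        by (rule monoid_algebra_add[OF part_gt_closed[OF x(1)] MA])
      have c0: "trm 0 c \<in> monoid_algebra P" by (intro monoid_algebra_term weight_monoid_0[OF fin])
      have "c \<odot>\<^bsub>cone_ring P\<^esub> h = cone_fun P (trm 0 c * (x + value_part u a (trm \<alpha> 1)))"
        using cone_fun_smult[OF fin xMA] x(2) by simp
      hence "filt_gt P r f a +>\<^bsub>cone_ring P\<^esub> (c \<odot>\<^bsub>cone_ring P\<^esub> h)
          = gt_coset a (trm 0 c * (x + value_part u a (trm \<alpha> 1)))" by (simp only: coset_eq)
      also have "\<dots> = gt_coset a (value_part u a (trm \<alpha> c))"
        unfolding scale
      proof (rule gt_coset_eq_iff[THEN iffD2])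
        show "trm 0 c * (x + value_part u a (trm \<alpha> 1)) - trm 0 c * value_part u a (trm \<alpha> 1) \<in> part_gt a"
          using part_gt_smult[OF x(1), of c] by (simp add: distrib_left)
      qed (rule monoid_algebra_mult[OF fin c0 xMA], rule monoid_algebra_mult[OF fin c0 MA])
      finally show ?thesis .
    qed
    moreover have "gt_coset a (value_part u a (trm \<alpha> 1)) \<noteq> {}" using part_gt_0 by (auto simp: gt_coset_def)
    ultimately show ?thesis by auto
  qed
  thus ?thesis unfolding gr_ring_simps graded_map_def by (intro restrict_ext) simp
qed

text \<open>Formal values are additive on monomials, so multiplication is graded by them.\<close>

lemma value_part_mult:
  "value_part u e (g * h) = (\<Sum>ab\<in>{ab\<in>mon_val u ` supp g \<times> mon_val u ` supp h. e = vadd (fst ab) (snd ab)}.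
     value_part u (fst ab) g * value_part u (snd ab) h)"
proof -
  let ?A = "mon_val u ` supp g" and ?B = "mon_val u ` supp h"
  let ?g = "\<lambda>a. restr (\<lambda>\<alpha>. mon_val u \<alpha> = a) g" and ?h = "\<lambda>b. restr (\<lambda>\<alpha>. mon_val u \<alpha> = b) h"
  have single: "restr (\<lambda>\<alpha>. mon_val u \<alpha> = e) (?g a * ?h b) = (if e = vadd a b then ?g a * ?h b else 0)" for a b
  proof -
    have ab: "mon_val u \<gamma> = vadd a b" if \<gamma>: "\<gamma> \<in> supp (?g a * ?h b)" for \<gamma>
    proof -
      obtain \<alpha> \<beta> where "\<gamma> = \<alpha> + \<beta>" "\<alpha> \<in> supp (?g a)" "\<beta> \<in> supp (?h b)"
        using keys_mult[of "?g a" "?h b"] \<gamma> by blast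
      thus ?thesis by (simp add: mon_val_add)
    qed
    show ?thesis
    proof (rule poly_mapping_eqI)
      fix \<gamma>
      show "coef (restr (\<lambda>\<alpha>. mon_val u \<alpha> = e) (?g a * ?h b)) \<gamma>
          = coef (if e = vadd a b then ?g a * ?h b else 0) \<gamma>"
        using ab[of \<gamma>] by (cases "\<gamma> \<in> supp (?g a * ?h b)") (auto simp: coef_restr in_keys_iff)
    qed
  qed
  have "g * h = (\<Sum>a\<in>?A. ?g a) * (\<Sum>b\<in>?B. ?h b)" by (simp add: sum_restr)
  also have "\<dots> = (\<Sum>ab\<in>?A \<times> ?B. ?g (fst ab) * ?h (snd ab))"
    by (simp add: sum_product sum.cartesian_product case_prod_beta)
  finally have "restr (\<lambda>\<alpha>. mon_val u \<alpha> = e) (g * h)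
      = (\<Sum>ab\<in>?A \<times> ?B. if e = vadd (fst ab) (snd ab) then ?g (fst ab) * ?h (snd ab) else 0)"
    by (simp add: restr_sum single)
  also have "\<dots> = (\<Sum>ab\<in>{ab\<in>?A \<times> ?B. e = vadd (fst ab) (snd ab)}. ?g (fst ab) * ?h (snd ab))"
    by (subst sum.inter_filter) auto
  finally show ?thesis by (simp add: value_part_def push_sum push_mult mon_weight_add)
qed

text \<open>The product in the graded ring runs over the supports only and uses arbitrary representatives. Both
  deviations from \<open>value_part_mult\<close> lie in \<open>part_gt e\<close>: changing a representative changes the product
  by an element of the smaller filtration step, and a pair outside the supports has a factor there.\<close>

lemma graded_map_mult:
  assumes u: "u \<in> I \<rightarrow> weight_monoid P"
    and g: "g \<in> carrier (poly_ring I)" and h: "h \<in> carrier (poly_ring I)"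
  shows "graded_map u (g * h) = graded_map u g \<otimes>\<^bsub>gr_ring P r f\<^esub> graded_map u h"
proof -
  interpret R: cring "cone_ring P :: ('k, ('n, 'k) cfun) module" by (rule cring_cone_ring)
  have ge: "value_part u a x \<in> part_ge a" if "x \<in> carrier (poly_ring I)" for a x
    by (rule value_part_in_ge[OF u that])
  have rep: "\<exists>d. y = cone_fun P d \<and> d \<in> part_ge a \<and> d - value_part u a x \<in> part_gt a"
    if "y \<in> gt_coset a (value_part u a x)" "x \<in> carrier (poly_ring I)" for y a x
  proof -
    obtain z where "z \<in> part_gt a" "y = cone_fun P (z + value_part u a x)"
      using \<open>y \<in> gt_coset a (value_part u a x)\<close> by (auto simp: gt_coset_def)
    thus ?thesis using part_gt_subset_ge ge[OF that(2), of a]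
      by (intro exI[of _ "z + value_part u a x"]) (auto intro: part_ge_add)
  qed
  let ?F = "gr_support P r f (graded_map u g)" and ?G = "gr_support P r f (graded_map u h)"
  have "(\<Union>y\<in>Pi \<Gamma> (graded_map u g). \<Union>z\<in>Pi \<Gamma> (graded_map u h). filt_gt P r f e +>\<^bsub>cone_ring P\<^esub>
            (\<Oplus>\<^bsub>cone_ring P\<^esub>ab\<in>{ab\<in>?F \<times> ?G. e = vadd (fst ab) (snd ab)}.
              y (fst ab) \<otimes>\<^bsub>cone_ring P\<^esub> z (snd ab)))
      = gt_coset e (value_part u e (g * h))" for e
  proof -
    let ?T = "{ab\<in>?F \<times> ?G. e = vadd (fst ab) (snd ab)}"
    let ?T' = "{ab\<in>mon_val u ` supp g \<times> mon_val u ` supp h. e = vadd (fst ab) (snd ab)}"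
    have T: "?T \<subseteq> ?T'" using graded_map_support_finite[OF u g] graded_map_support_finite[OF u h] by auto
    have finT': "finite ?T'" by (rule finite_subset[of _ "mon_val u ` supp g \<times> mon_val u ` supp h"]) auto
    have "filt_gt P r f e +>\<^bsub>cone_ring P\<^esub>
            (\<Oplus>\<^bsub>cone_ring P\<^esub>ab\<in>?T. y (fst ab) \<otimes>\<^bsub>cone_ring P\<^esub> z (snd ab)) = gt_coset e (value_part u e (g * h))"
      if y: "y \<in> Pi \<Gamma> (graded_map u g)" and z: "z \<in> Pi \<Gamma> (graded_map u h)" for y z
    proof -
      have "\<forall>a\<in>\<Gamma>. \<exists>d. y a = cone_fun P d \<and> d \<in> part_ge a \<and> d - value_part u a g \<in> part_gt a"
        using Pi_mem[OF y] by (intro ballI rep[OF _ g]) (simp add: graded_map_def)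
      from bchoice[OF this] obtain dy where dy:
        "\<forall>a\<in>\<Gamma>. y a = cone_fun P (dy a) \<and> dy a \<in> part_ge a \<and> dy a - value_part u a g \<in> part_gt a" ..
      have "\<forall>a\<in>\<Gamma>. \<exists>d. z a = cone_fun P d \<and> d \<in> part_ge a \<and> d - value_part u a h \<in> part_gt a"
        using Pi_mem[OF z] by (intro ballI rep[OF _ h]) (simp add: graded_map_def)
      from bchoice[OF this] obtain dz where dz:
        "\<forall>a\<in>\<Gamma>. z a = cone_fun P (dz a) \<and> dz a \<in> part_ge a \<and> dz a - value_part u a h \<in> part_gt a" ..
      have FG: "?F \<subseteq> \<Gamma>" "?G \<subseteq> \<Gamma>" by (auto simp: gr_support_def)
      have MA: "dy (fst ab) * dz (snd ab) \<in> monoid_algebra P" if "ab \<in> ?T" for ab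
      proof (rule monoid_algebra_mult[OF fin])
        have "fst ab \<in> \<Gamma>" "snd ab \<in> \<Gamma>" using that FG by auto
        thus "dy (fst ab) \<in> monoid_algebra P" "dz (snd ab) \<in> monoid_algebra P"
          using dy dz part_ge_closed by blast+
      qed
      have "(\<Oplus>\<^bsub>cone_ring P\<^esub>ab\<in>?T. y (fst ab) \<otimes>\<^bsub>cone_ring P\<^esub> z (snd ab))
          = (\<Oplus>\<^bsub>cone_ring P\<^esub>ab\<in>?T. cone_fun P (dy (fst ab) * dz (snd ab)))"
      proof (rule R.finsum_cong'[OF refl])
        show "(\<lambda>ab. cone_fun P (dy (fst ab) * dz (snd ab))) \<in> ?T \<rightarrow> carrier (cone_ring P)"
          using MA by (auto simp: cone_ring_carrier[OF fin])
        fix ab assume ab: "ab \<in> ?T"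
        have "fst ab \<in> \<Gamma>" "snd ab \<in> \<Gamma>" using ab FG by auto
        hence yz: "y (fst ab) = cone_fun P (dy (fst ab))" "z (snd ab) = cone_fun P (dz (snd ab))"
          "dy (fst ab) \<in> monoid_algebra P" "dz (snd ab) \<in> monoid_algebra P"
          using dy dz part_ge_closed by blast+
        show "y (fst ab) \<otimes>\<^bsub>cone_ring P\<^esub> z (snd ab) = cone_fun P (dy (fst ab) * dz (snd ab))"
          unfolding yz(1,2) cone_fun_mult[OF fin yz(3,4)] by simp
      qed
      also have "\<dots> = cone_fun P (\<Sum>ab\<in>?T. dy (fst ab) * dz (snd ab))"
        by (rule cone_ring_finsum[OF fin MA])
      finally have "filt_gt P r f e +>\<^bsub>cone_ring P\<^esub>
            (\<Oplus>\<^bsub>cone_ring P\<^esub>ab\<in>?T. y (fst ab) \<otimes>\<^bsub>cone_ring P\<^esub> z (snd ab))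
          = gt_coset e (\<Sum>ab\<in>?T. dy (fst ab) * dz (snd ab))" by (simp only: coset_eq)
      also have "\<dots> = gt_coset e (value_part u e (g * h))"
      proof (subst gt_coset_eq_iff)
        let ?p = "\<lambda>ab. value_part u (fst ab) g * value_part u (snd ab) h"
        have 1: "dy (fst ab) * dz (snd ab) - ?p ab \<in> part_gt e" if "ab \<in> ?T" for ab
        proof -
          have ab: "fst ab \<in> \<Gamma>" "snd ab \<in> \<Gamma>" "e = vadd (fst ab) (snd ab)" using that FG by auto
          have "(dy (fst ab) - value_part u (fst ab) g) * dz (snd ab) \<in> part_gt e"
            unfolding ab(3) using dy dz ab by (intro part_gt_mult_ge) auto
          moreover have "value_part u (fst ab) g * (dz (snd ab) - value_part u (snd ab) h) \<in> part_gt e"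
            unfolding ab(3) using dz ab ge[OF g] by (intro part_ge_mult_gt) auto
          ultimately have "(dy (fst ab) - value_part u (fst ab) g) * dz (snd ab)
              + value_part u (fst ab) g * (dz (snd ab) - value_part u (snd ab) h) \<in> part_gt e" by (rule part_gt_add)
          thus ?thesis by (simp add: algebra_simps)
        qed
        have 2: "?p ab \<in> part_gt e" if "ab \<in> ?T' - ?T" for ab
        proof -
          have ab: "e = vadd (fst ab) (snd ab)" "fst ab \<notin> ?F \<or> snd ab \<notin> ?G" using that by (cases ab, auto)+
          from ab(2) show ?thesis
          proof
            assume "fst ab \<notin> ?F"
            hence "value_part u (fst ab) g \<in> part_gt (fst ab)" using graded_map_support[OF u g] by blast
            thus ?thesis unfolding ab(1) using ge[OF h] by (intro part_gt_mult_ge)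
          next
            assume "snd ab \<notin> ?G"
            hence "value_part u (snd ab) h \<in> part_gt (snd ab)" using graded_map_support[OF u h] by blast
            thus ?thesis unfolding ab(1) using ge[OF g] by (intro part_ge_mult_gt)
          qed
        qed
        have "(\<Sum>ab\<in>?T'. ?p ab) = (\<Sum>ab\<in>?T' - ?T. ?p ab) + (\<Sum>ab\<in>?T. ?p ab)"
          by (rule sum.subset_diff[OF T finT'])
        hence "(\<Sum>ab\<in>?T. dy (fst ab) * dz (snd ab)) - value_part u e (g * h)
            = (\<Sum>ab\<in>?T. dy (fst ab) * dz (snd ab) - ?p ab) - (\<Sum>ab\<in>?T' - ?T. ?p ab)"
          by (simp add: value_part_mult sum_subtractf)
        also have "\<dots> \<in> part_gt e" by (rule part_gt_diff[OF part_gt_sum[OF 1] part_gt_sum[OF 2]])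
        finally show "(\<Sum>ab\<in>?T. dy (fst ab) * dz (snd ab)) - value_part u e (g * h) \<in> part_gt e" .
        show "(\<Sum>ab\<in>?T. dy (fst ab) * dz (snd ab)) \<in> monoid_algebra P" using MA by (rule monoid_algebra_sum)
        show "value_part u e (g * h) \<in> monoid_algebra P"
          using g h by (intro part_ge_closed[OF ge] poly_ring_mult_closed)
      qed
      finally show ?thesis .
    qed
    moreover have "Pi \<Gamma> (graded_map u x) \<noteq> {}" for x :: "('a, 'k) mpoly"
    proof -
      have "cone_fun P (0 + value_part u a x) \<in> gt_coset a (value_part u a x)" for a
        unfolding gt_coset_def by (rule imageI[OF part_gt_0])
      hence "(\<lambda>a. cone_fun P (0 + value_part u a x)) \<in> Pi \<Gamma> (graded_map u x)"
        by (intro Pi_I) (simp add: graded_map_def)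
      thus ?thesis by blast
    qed
    ultimately show ?thesis by auto
  qed
  thus ?thesis by (auto simp: gr_ring_def graded_map_def[of u "g * h"])
qed

text \<open>Taking all weights as generators shows that every element of the graded ring comes from a
  polynomial, so the ring laws descend.\<close>

lemma gr_ring_carrier:
  "carrier (gr_ring P r f) = graded_map (\<lambda>w. w) ` carrier (poly_ring (weight_monoid P))"
proof
  show "graded_map (\<lambda>w. w) ` carrier (poly_ring (weight_monoid P)) \<subseteq> carrier (gr_ring P r f)"
    using graded_map_closed[of "\<lambda>w. w" "weight_monoid P"] by auto
  show "carrier (gr_ring P r f) \<subseteq> graded_map (\<lambda>w. w) ` carrier (poly_ring (weight_monoid P))"
  proof
    fix F assume "F \<in> carrier (gr_ring P r f)"
    hence F: "\<And>a. a \<in> \<Gamma> \<Longrightarrow> \<exists>d\<in>part_ge a. F a = gt_coset a d" "F \<in> extensional \<Gamma>"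
      "finite (gr_support P r f F)"
      by (auto simp: gr_ring_def filt_ge_eq coset_eq PiE_def dest!: PiE_mem) (fastforce simp: coset_eq)
    from F(1) have "\<forall>a\<in>\<Gamma>. \<exists>d. d \<in> part_ge a \<and> F a = gt_coset a d" by blast
    from bchoice[OF this] obtain d where d: "\<forall>a\<in>\<Gamma>. d a \<in> part_ge a \<and> F a = gt_coset a (d a)" ..
    let ?s = "gr_support P r f F"
    define t where "t a = (\<Sum>w\<in>{w\<in>supp (d a). mval w = a}. trm (trm w (1::nat)) (coef (d a) w))" for a
    define g where "g = (\<Sum>a\<in>?s. t a)"
    have s: "?s \<subseteq> \<Gamma>" by (auto simp: gr_support_def)
    have g: "g \<in> carrier (poly_ring (weight_monoid P))"
      unfolding g_def t_def
    proof (intro poly_ring_sum_closed poly_ring_term_closed)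
      fix a w assume a: "a \<in> ?s" and w: "w \<in> {w\<in>supp (d a). mval w = a}"
      hence "d a \<in> monoid_algebra P" using s d part_ge_closed by blast
      hence "w \<in> weight_monoid P" using w unfolding monoid_algebra_def by blast
      thus "supp (trm w (1::nat)) \<subseteq> weight_monoid P" by simp
    qed
    have var: "value_part (\<lambda>w. w) b (trm (trm w 1) c) = (if mval w = b then trm w c else 0)" for b w c
      unfolding value_part_term mon_val_var by (simp add: mon_weight_term)
    have part_t: "value_part (\<lambda>w. w) b (t a) = (if a = b then restr (\<lambda>w. mval w = a) (d a) else 0)" for a b
      unfolding t_def value_part_sum var by (auto simp: restr_def intro!: sum.cong sum.neutral)
    have part_g: "value_part (\<lambda>w. w) b g = (if b \<in> ?s then restr (\<lambda>w. mval w = b) (d b) else 0)" for b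
      unfolding g_def value_part_sum part_t using F(3) by (simp add: sum.delta)
    have "graded_map (\<lambda>w. w) g = F"
    proof (rule extensionalityI[of _ \<Gamma>])
      show "graded_map (\<lambda>w. w) g \<in> extensional \<Gamma>" by (simp add: graded_map_def)
      show "F \<in> extensional \<Gamma>" by fact
      fix b assume b: "b \<in> \<Gamma>"
      show "graded_map (\<lambda>w. w) g b = F b"
      proof (cases "b \<in> ?s")
        case True
        have db: "d b \<in> part_ge b" using d b by blast
        have "restr (\<lambda>w. mval w = b) (d b) - d b = - restr (\<lambda>w. mval w \<noteq> b) (d b)"
          by (rule poly_mapping_eqI) (auto simp: lookup_minus coef_restr)
        moreover have "restr (\<lambda>w. mval w \<noteq> b) (d b) \<in> part_gt b"
          using db by (auto simp: part_ge_def part_gt_def lex_le_def monoid_algebra_restr)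
        ultimately have "restr (\<lambda>w. mval w = b) (d b) - d b \<in> part_gt b"
          using part_gt_uminus by simp
        hence "gt_coset b (restr (\<lambda>w. mval w = b) (d b)) = gt_coset b (d b)"
          using db by (subst gt_coset_eq_iff) (auto intro: monoid_algebra_restr part_ge_closed)
        thus ?thesis using True b d by (simp add: graded_map_def part_g)
      next
        case False
        hence "F b = gt_coset b 0" using b by (simp add: gr_support_def filt_gt_coset)
        thus ?thesis using False b by (simp add: graded_map_def part_g)
      qed
    qed
    thus "F \<in> graded_map (\<lambda>w. w) ` carrier (poly_ring (weight_monoid P))" using g by blast
  qed
qed

lemma graded_map_hom:
  assumes "u \<in> I \<rightarrow> weight_monoid P"
  shows "graded_map u \<in> ring_hom (poly_ring I) (gr_ring P r f)"
  using graded_map_closed[of u I] graded_map_mult[of u I] assms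
  by (intro ring_hom_memI) (auto simp: graded_map_add graded_map_1)

lemma cring_gr_ring: "cring (gr_ring P r f)"
  by (rule cring_hom_image[OF cring_poly_ring graded_map_hom[of "\<lambda>w. w" "weight_monoid P"]])
    (simp_all add: gr_ring_carrier graded_map_0[symmetric])

lemma alg_eval_gr_ring:
  assumes "finite I" "u \<in> I \<rightarrow> weight_monoid P" "g \<in> carrier (poly_ring I)"
  shows "alg_eval (gr_ring P r f) I (\<lambda>i. gr_class P r f (basis_fun P (u i))) g = graded_map u g"
  using assms by (intro alg_eval_hom cring_gr_ring graded_map_hom graded_map_smult[of _ I] graded_map_var[symmetric]) auto

lemma cone_fun_push_hom:
  assumes u: "u \<in> I \<rightarrow> weight_monoid P"
  shows "(\<lambda>g :: ('i, 'k) mpoly. cone_fun P (push (mon_weight u) g)) \<in> ring_hom (poly_ring I) (cone_ring P)"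
proof (rule ring_hom_memI)
  let ?h = "\<lambda>g :: ('i, 'k) mpoly. cone_fun P (push (mon_weight u) g)"
  have MA: "push (mon_weight u) g \<in> monoid_algebra P" if "g \<in> carrier (poly_ring I)"
    for g :: "('i, 'k) mpoly"
    using u that by (intro push_in_monoid_algebra[OF fin, of I]) auto
  have "push (mon_weight u) 1 = (1 :: int \<times> (int^'n) \<Rightarrow>\<^sub>0 'k)"
    using push_term[of "mon_weight u" 0 "1::'k"] by simp
  thus "?h \<one>\<^bsub>poly_ring I\<^esub> = \<one>\<^bsub>cone_ring P\<^esub>" by (simp add: cone_fun_1[OF fin])
  show "?h x \<in> carrier (cone_ring P)" if "x \<in> carrier (poly_ring I)" for x
    using MA[OF that] by (simp add: cone_ring_carrier[OF fin])
  show "?h (x \<otimes>\<^bsub>poly_ring I\<^esub> y) = ?h x \<otimes>\<^bsub>cone_ring P\<^esub> ?h y"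
    if "x \<in> carrier (poly_ring I)" "y \<in> carrier (poly_ring I)" for x y
    using cone_fun_mult[OF fin MA[OF that(1)] MA[OF that(2)]] by (simp add: push_mult mon_weight_add)
  show "?h (x \<oplus>\<^bsub>poly_ring I\<^esub> y) = ?h x \<oplus>\<^bsub>cone_ring P\<^esub> ?h y" for x y
    by (simp add: push_add cone_fun_add)
qed

lemma alg_eval_cone_ring:
  assumes I: "finite I" and u: "u \<in> I \<rightarrow> weight_monoid P" and g: "g \<in> carrier (poly_ring I)"
  shows "alg_eval (cone_ring P) I (\<lambda>i. basis_fun P (u i)) g
    = cone_fun P (push (mon_weight u) g :: int \<times> (int^'n) \<Rightarrow>\<^sub>0 'k)"
proof (rule alg_eval_hom[OF cring_cone_ring cone_fun_push_hom[OF u] I _ _ g])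
  let ?h = "\<lambda>g :: ('a, 'k) mpoly. cone_fun P (push (mon_weight u) g)"
  show "?h (trm \<alpha> c) = c \<odot>\<^bsub>cone_ring P\<^esub> ?h (trm \<alpha> 1)" for \<alpha> c by (simp add: cone_fun_term)
  show "basis_fun P (u i) = ?h (trm (trm i 1) 1)" for i
    by (simp add: cone_fun_term mon_weight_term)
qed

end

section \<open>The two kernels\<close>

locale presentation = seshadri P r X f
  for P :: "(real^'n) set" and r :: "(real^'n) set rel"
    and X :: "(real^'n) set \<Rightarrow> (int^'n \<Rightarrow> 'k::field_char_0) set set"
    and f :: "(real^'n) set \<Rightarrow> ('n, 'k) cfun" +
  fixes p :: nat and m :: "nat \<Rightarrow> nat" and \<eta> :: "nat \<Rightarrow> int^'n"
  assumes adm: "admissible_generators P r f p m \<eta>"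
begin

abbreviation gw :: "nat \<Rightarrow> int \<times> (int^'n)" where "gw \<equiv> \<lambda>i. (int (m i), \<eta> i)"

abbreviation K :: "(nat, 'k) mpoly set" where "K \<equiv> ker_theta P p m \<eta>"

abbreviation K0 :: "(nat, 'k) mpoly set" where "K0 \<equiv> ker_theta_bar P r f p m \<eta>"

lemma gw: "gw \<in> {..<p} \<rightarrow> weight_monoid P"
  using adm by (auto simp: admissible_generators_def)

lemma p_pos: "0 < p"
proof -
  have "0 < card (lattice_points P)" using fin lattice_points_nonempty by (simp add: card_gt_0_iff)
  thus ?thesis using adm by (auto simp: admissible_generators_def)
qed

lemma ker_theta_iff: "g \<in> K \<longleftrightarrow> g \<in> carrier (poly_ring {..<p}) \<and> push (mon_weight gw) g = 0"
proof -
  have "theta P p m \<eta> g = (\<lambda>v. 0) \<longleftrightarrow> push (mon_weight gw) g = 0"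
    if g: "g \<in> carrier (poly_ring {..<p})" for g :: "(nat, 'k) mpoly"
  proof -
    have MA: "push (mon_weight gw) g \<in> monoid_algebra P"
      using gw g by (intro push_in_monoid_algebra[OF fin, of "{..<p}"]) auto
    show ?thesis
      unfolding theta_def alg_eval_cone_ring[OF finite_lessThan gw g] cone_fun_eq_0_iff[OF fin MA] ..
  qed
  thus ?thesis by (auto simp: ker_theta_def a_kernel_def kernel_def)
qed

text \<open>The condition may be imposed for every vector \<open>a\<close>: outside the value set it holds automatically.\<close>

lemma ker_theta_bar_iff:
  "g \<in> K0 \<longleftrightarrow> g \<in> carrier (poly_ring {..<p}) \<and> (\<forall>a. value_part gw a g \<in> part_gt a)"
proof -
  have "theta_bar P r f p m \<eta> g = \<zero>\<^bsub>gr_ring P r f\<^esub> \<longleftrightarrow> (\<forall>a. value_part gw a g \<in> part_gt a)"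
    if g: "g \<in> carrier (poly_ring {..<p})" for g :: "(nat, 'k) mpoly"
  proof -
    have iff: "gt_coset a (value_part gw a g) = gt_coset a 0 \<longleftrightarrow> value_part gw a g \<in> part_gt a" for a
      using gt_coset_eq_iff[OF part_ge_closed[OF value_part_in_ge[OF gw g]] monoid_algebra_0] by simp
    have "theta_bar P r f p m \<eta> g = \<zero>\<^bsub>gr_ring P r f\<^esub> \<longleftrightarrow> graded_map gw g = graded_map gw 0"
      unfolding theta_bar_def alg_eval_gr_ring[OF finite_lessThan gw g] graded_map_0[of gw] ..
    also have "\<dots> \<longleftrightarrow> (\<forall>a\<in>\<Gamma>. gt_coset a (value_part gw a g) = gt_coset a 0)"
    proof
      assume eq: "graded_map gw g = graded_map gw 0"
      show "\<forall>a\<in>\<Gamma>. gt_coset a (value_part gw a g) = gt_coset a 0"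
      proof
        fix a assume "a \<in> \<Gamma>"
        thus "gt_coset a (value_part gw a g) = gt_coset a 0" using fun_cong[OF eq, of a] by (simp add: graded_map_def)
      qed
    next
      assume "\<forall>a\<in>\<Gamma>. gt_coset a (value_part gw a g) = gt_coset a 0"
      thus "graded_map gw g = graded_map gw 0" unfolding graded_map_def value_part_0 by (intro restrict_ext) blast
    qed
    also have "\<dots> \<longleftrightarrow> (\<forall>a. value_part gw a g \<in> part_gt a)"
      unfolding iff using value_part_in_gt_outside[OF gw g] by blast
    finally show ?thesis .
  qed
  thus ?thesis by (auto simp: ker_theta_bar_def a_kernel_def kernel_def)
qed

lemma a_kernel_cong:
  assumes "\<And>x. x \<in> carrier R \<Longrightarrow> h x = h' x"
  shows "a_kernel R S h = a_kernel R S h'"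
  using assms by (auto simp: a_kernel_def kernel_def)

lemma ideal_ker_theta: "ideal K (poly_ring {..<p})"
proof -
  have "ring_hom_ring (poly_ring {..<p}) (cone_ring P :: ('k, ('n, 'k) cfun) module)
      (\<lambda>g :: (nat, 'k) mpoly. cone_fun P (push (mon_weight gw) g))"
    by (intro ring_hom_ringI2 cone_fun_push_hom gw cring.axioms(1) cring_poly_ring cring_cone_ring)
  from ring_hom_ring.kernel_is_ideal[OF this] show ?thesis
    unfolding ker_theta_def theta_def
    by (subst a_kernel_cong[where h' = "\<lambda>g. cone_fun P (push (mon_weight gw) g)"])
      (auto intro!: alg_eval_cone_ring[OF finite_lessThan gw])
qed

lemma ideal_ker_theta_bar: "ideal K0 (poly_ring {..<p})"
proof -
  have "ring_hom_ring (poly_ring {..<p}) (gr_ring P r f) (graded_map gw)"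
    by (intro ring_hom_ringI2 graded_map_hom gw cring.axioms(1) cring_poly_ring cring_gr_ring)
  from ring_hom_ring.kernel_is_ideal[OF this] show ?thesis
    unfolding ker_theta_bar_def theta_bar_def
    by (subst a_kernel_cong[where h' = "graded_map gw"]) (auto intro!: alg_eval_gr_ring[OF finite_lessThan gw])
qed

lemma degree_restr: "push (mon_weight gw) (restr (\<lambda>\<alpha>. wdeg m \<alpha> = d) g)
    = restr (\<lambda>w. fst w = int d) (push (mon_weight gw) g)"
proof -
  have "(\<lambda>\<alpha>. wdeg m \<alpha> = d) = (\<lambda>\<alpha>. fst (mon_weight gw \<alpha>) = int d)"
    by (simp add: fst_mon_weight)
  thus ?thesis using push_restr[where h = "mon_weight gw" and g = g and Q = "\<lambda>w. fst w = int d"] by simp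
qed

lemma homogeneous_ker_theta: "homogeneous_ideal {..<p} m K"
  unfolding homogeneous_ideal_def select_terms_eq_restr
  using ideal_ker_theta by (auto simp: ker_theta_iff degree_restr poly_ring_restr_closed)

lemma value_part_degree_restr: "value_part gw a (restr (\<lambda>\<alpha>. wdeg m \<alpha> = d) g) = restr (\<lambda>w. fst w = int d) (value_part gw a g)"
proof -
  have "restr (\<lambda>\<alpha>. mon_val gw \<alpha> = a) (restr (\<lambda>\<alpha>. wdeg m \<alpha> = d) g)
      = restr (\<lambda>\<alpha>. wdeg m \<alpha> = d) (restr (\<lambda>\<alpha>. mon_val gw \<alpha> = a) g)"
    unfolding restr_restr by (simp add: conj_commute)
  thus ?thesis by (simp add: value_part_def degree_restr)
qed

lemma part_gt_restr: "d \<in> part_gt a \<Longrightarrow> restr Q d \<in> part_gt a"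
  by (simp add: part_gt_def monoid_algebra_restr)

lemma homogeneous_ker_theta_bar: "homogeneous_ideal {..<p} m K0"
  unfolding homogeneous_ideal_def select_terms_eq_restr
  using ideal_ker_theta_bar
  by (auto simp: ker_theta_bar_iff value_part_degree_restr poly_ring_restr_closed part_gt_restr)

subsection \<open>The initial ideal\<close>

lemma nu_exponent_eq:
  assumes "supp \<alpha> \<subseteq> {..<p}"
  shows "nu_exponent P r f m \<eta> \<alpha> = mon_val gw \<alpha>"
proof -
  have "quasi_valuation P r f (basis_fun P (gw i)) = mval (gw i)" if "i \<in> supp \<alpha>" for i
  proof -
    have "gw i \<in> weight_monoid P" using gw that assms by (auto dest: Pi_mem)
    from quasi_valuation_basis[OF this] show ?thesis by (simp add: cone_fun_term)
  qed
  thus ?thesis by (simp add: nu_exponent_def mon_val_def fun_eq_iff)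
qed

lemma nu_le_iff:
  assumes "supp \<alpha> \<subseteq> {..<p}" "supp \<beta> \<subseteq> {..<p}"
  shows "nu_le P r f m \<eta> \<beta> \<alpha> \<longleftrightarrow> wdeg m \<beta> < wdeg m \<alpha> \<or>
     (wdeg m \<beta> = wdeg m \<alpha> \<and> lex_le r (mon_val gw \<alpha>) (mon_val gw \<beta>))"
  by (simp add: nu_le_def nu_exponent_eq[OF assms(1)] nu_exponent_eq[OF assms(2)])

text \<open>Since the classes of the generators generate the graded ring, every weight is attained by a
  monomial on which the quasi-valuation is additive.\<close>

lemma sharp_monomial_exists:
  assumes w: "w \<in> weight_monoid P"
  shows "\<exists>\<beta>. supp \<beta> \<subseteq> {..<p} \<and> mon_weight gw \<beta> = w \<and> mon_val gw \<beta> = mval w"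
proof -
  define a where "a = mval w"
  have a: "a \<in> \<Gamma>" using w by (simp add: a_def val_image_eq)
  have MA: "trm w (1::'k) \<in> monoid_algebra P" using w by (rule monoid_algebra_term)
  let ?F = "graded_map (\<lambda>w. w) (trm (trm w 1) 1 :: (int \<times> (int^'n), 'k) mpoly)"
  have "?F \<in> carrier (gr_ring P r f)"
    unfolding gr_ring_carrier using w by (intro imageI poly_ring_term_closed) simp
  then obtain g :: "(nat, 'k) mpoly" where g: "g \<in> carrier (poly_ring {..<p})" "?F = theta_bar P r f p m \<eta> g"
    using adm unfolding admissible_generators_def by (metis (no_types, lifting) imageE)
  have "?F a = graded_map gw g a"
    unfolding g(2) theta_bar_def alg_eval_gr_ring[OF finite_lessThan gw g(1)] ..
  hence "gt_coset a (trm w 1) = gt_coset a (value_part gw a g)"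
    using a by (simp add: graded_map_def value_part_term mon_val_var mon_weight_term a_def del: One_nat_def)
  hence gt: "trm w 1 - value_part gw a g \<in> part_gt a"
    using gt_coset_eq_iff[OF MA part_ge_closed[OF value_part_in_ge[OF gw g(1)]]] by blast
  have "w \<in> supp (value_part gw a g)"
  proof (rule ccontr)
    assume "w \<notin> supp (value_part gw a g)"
    hence "w \<in> supp (trm w 1 - value_part gw a g)" by (simp add: in_keys_iff lookup_minus)
    hence "lex_less r a (mval w)" using gt by (simp add: part_gt_def)
    thus False by (simp add: a_def lex_less_irrefl)
  qed
  then obtain \<beta> where "\<beta> \<in> supp g" "mon_val gw \<beta> = a" "w = mon_weight gw \<beta>"
    unfolding value_part_def using supp_push[of "mon_weight gw" "restr (\<lambda>\<alpha>. mon_val gw \<alpha> = a) g"] by auto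
  thus ?thesis using g(1) by (auto simp: a_def poly_ring_carrier_iff intro!: exI[of _ \<beta>])
qed

text \<open>An initial form collects the terms of top degree \<open>d\<close> and least formal value \<open>a\<close>. The degree \<open>d\<close>
  component of a relation is again a relation, so the image of the initial form is minus the image of
  the remaining terms of degree \<open>d\<close>, and these have formal value above \<open>a\<close>.\<close>

lemma initial_form_in_ker_theta_bar:
  assumes g: "g \<in> K"
  shows "initial_form (nu_le P r f m \<eta>) g \<in> K0"
proof -
  let ?h = "initial_form (nu_le P r f m \<eta>) g"
  have gc: "g \<in> carrier (poly_ring {..<p})" using g by (simp add: ker_theta_iff)
  have sp: "supp \<alpha> \<subseteq> {..<p}" if "\<alpha> \<in> supp g" for \<alpha> using gc that by (simp add: poly_ring_carrier_iff)
  have h: "?h = restr (\<lambda>\<alpha>. \<forall>\<beta>\<in>supp g. nu_le P r f m \<eta> \<beta> \<alpha>) g"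
    by (simp add: initial_form_def select_terms_eq_restr)
  have "value_part gw a ?h \<in> part_gt a" for a
  proof (cases "\<exists>\<alpha>\<in>supp ?h. mon_val gw \<alpha> = a")
    case False
    hence "value_part gw a ?h = 0" by (intro value_part_eq_0) auto
    thus ?thesis by (simp add: part_gt_0)
  next
    case True
    then obtain \<alpha>0 where \<alpha>0: "\<alpha>0 \<in> supp g" "\<And>\<beta>. \<beta> \<in> supp g \<Longrightarrow> nu_le P r f m \<eta> \<beta> \<alpha>0" "mon_val gw \<alpha>0 = a"
      unfolding h by auto
    define d where "d = wdeg m \<alpha>0"
    define G where "G = restr (\<lambda>\<alpha>. wdeg m \<alpha> = d) g"
    have le: "wdeg m \<beta> < d \<or> (wdeg m \<beta> = d \<and> lex_le r a (mon_val gw \<beta>))" if "\<beta> \<in> supp g" for \<beta>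
      using \<alpha>0(2)[OF that] \<alpha>0(3) nu_le_iff[OF sp[OF \<alpha>0(1)] sp[OF that]] by (simp add: d_def)
    have top: "(\<forall>\<beta>\<in>supp g. nu_le P r f m \<eta> \<beta> \<alpha>) \<longleftrightarrow> wdeg m \<alpha> = d \<and> mon_val gw \<alpha> = a" if \<alpha>: "\<alpha> \<in> supp g" for \<alpha>
    proof
      assume "\<forall>\<beta>\<in>supp g. nu_le P r f m \<eta> \<beta> \<alpha>"
      hence "d < wdeg m \<alpha> \<or> d = wdeg m \<alpha> \<and> lex_le r (mon_val gw \<alpha>) a"
        using \<alpha>0(1,3) nu_le_iff[OF sp[OF \<alpha>] sp[OF \<alpha>0(1)]] by (simp add: d_def)
      thus "wdeg m \<alpha> = d \<and> mon_val gw \<alpha> = a"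
        using le[OF \<alpha>] lex_le_antisym[OF face_order, of a "mon_val gw \<alpha>"] by auto
    next
      assume "wdeg m \<alpha> = d \<and> mon_val gw \<alpha> = a"
      thus "\<forall>\<beta>\<in>supp g. nu_le P r f m \<eta> \<beta> \<alpha>" using le nu_le_iff[OF sp[OF \<alpha>] sp] by simp
    qed
    have hG: "restr (\<lambda>\<alpha>. mon_val gw \<alpha> = a) ?h = G - restr (\<lambda>\<alpha>. mon_val gw \<alpha> \<noteq> a) G"
    proof (rule poly_mapping_eqI)
      fix \<alpha>
      show "coef (restr (\<lambda>\<alpha>. mon_val gw \<alpha> = a) ?h) \<alpha> = coef (G - restr (\<lambda>\<alpha>. mon_val gw \<alpha> \<noteq> a) G) \<alpha>"
        using top[of \<alpha>] by (cases "\<alpha> \<in> supp g") (auto simp: h G_def coef_restr lookup_minus in_keys_iff)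
    qed
    have "push (mon_weight gw) G = 0" using g by (simp add: G_def degree_restr ker_theta_iff)
    hence "value_part gw a ?h = - push (mon_weight gw) (restr (\<lambda>\<alpha>. mon_val gw \<alpha> \<noteq> a) G)"
      unfolding value_part_def hG by (simp add: push_diff)
    moreover have "push (mon_weight gw) (restr (\<lambda>\<alpha>. mon_val gw \<alpha> \<noteq> a) G) \<in> part_gt a"
      unfolding part_gt_def
    proof (intro CollectI conjI ballI)
      show "push (mon_weight gw) (restr (\<lambda>\<alpha>. mon_val gw \<alpha> \<noteq> a) G) \<in> monoid_algebra P"
        unfolding G_def using gw gc
        by (intro push_in_monoid_algebra[OF fin, of "{..<p}"] poly_ring_restr_closed) auto
      fix w assume "w \<in> supp (push (mon_weight gw) (restr (\<lambda>\<alpha>. mon_val gw \<alpha> \<noteq> a) G))"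
      then obtain \<alpha> where \<alpha>: "w = mon_weight gw \<alpha>" "\<alpha> \<in> supp (restr (\<lambda>\<alpha>. mon_val gw \<alpha> \<noteq> a) G)"
        using supp_push[of "mon_weight gw"] by blast
      hence "\<alpha> \<in> supp g" "wdeg m \<alpha> = d" "mon_val gw \<alpha> \<noteq> a" by (auto simp: G_def)
      hence "lex_less r a (mon_val gw \<alpha>)" using le[of \<alpha>] by (auto simp: lex_le_def)
      thus "lex_less r a (mval w)" unfolding \<alpha>(1) by (rule lex_less_le_trans[OF face_order _ mon_val_le])
    qed
    ultimately show ?thesis using part_gt_uminus by simp
  qed
  moreover have "?h \<in> carrier (poly_ring {..<p})" unfolding h using gc by (rule poly_ring_restr_closed)
  ultimately show ?thesis by (simp add: ker_theta_bar_iff)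
qed

text \<open>An element of the kernel with a single degree and formal value \<open>a\<close> has an image in \<open>K[S]\<close> all of
  whose weights have value above \<open>a\<close>. Rewriting this image by sharp monomials and subtracting gives a relation;
  the subtracted terms have larger formal value, so they do not enter the initial form.\<close>

lemma bihomogeneous_is_initial_form:
  assumes g: "g \<in> K0" and g0: "g \<noteq> 0"
    and bihom: "\<And>\<alpha>. \<alpha> \<in> supp g \<Longrightarrow> wdeg m \<alpha> = d \<and> mon_val gw \<alpha> = a"
  shows "\<exists>h\<in>K - {0}. initial_form (nu_le P r f m \<eta>) h = g"
proof -
  have gc: "g \<in> carrier (poly_ring {..<p})" and gt: "value_part gw a g \<in> part_gt a"
    using g by (auto simp: ker_theta_bar_iff)
  define e where "e = push (mon_weight gw) g"
  have "restr (\<lambda>\<alpha>. mon_val gw \<alpha> = a) g = g"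
    by (rule poly_mapping_eqI) (use bihom in \<open>auto simp: coef_restr in_keys_iff\<close>)
  hence e: "e \<in> part_gt a" using gt by (simp add: value_part_def e_def)
  have fst_e: "fst w = int d" if w: "w \<in> supp e" for w
  proof -
    obtain \<alpha> where "w = mon_weight gw \<alpha>" "\<alpha> \<in> supp g"
      using w supp_push[of "mon_weight gw" g] unfolding e_def by blast
    thus ?thesis using bihom by (simp add: fst_mon_weight)
  qed
  have "\<forall>w\<in>supp e. \<exists>\<beta>. supp \<beta> \<subseteq> {..<p} \<and> mon_weight gw \<beta> = w \<and> mon_val gw \<beta> = mval w"
  proof
    fix w assume "w \<in> supp e"
    hence "w \<in> weight_monoid P" using part_gt_closed[OF e] unfolding monoid_algebra_def by blast
    thus "\<exists>\<beta>. supp \<beta> \<subseteq> {..<p} \<and> mon_weight gw \<beta> = w \<and> mon_val gw \<beta> = mval w" by (rule sharp_monomial_exists)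
  qed
  from bchoice[OF this] obtain b where b:
    "\<forall>w\<in>supp e. supp (b w) \<subseteq> {..<p} \<and> mon_weight gw (b w) = w \<and> mon_val gw (b w) = mval w" ..
  define t where "t = (\<Sum>w\<in>supp e. trm (b w) (coef e w))"
  have tc: "t \<in> carrier (poly_ring {..<p})"
    unfolding t_def using b by (intro poly_ring_sum_closed poly_ring_term_closed) blast
  have "push (mon_weight gw) t = (\<Sum>w\<in>supp e. trm w (coef e w))"
    unfolding t_def push_sum push_term using b by (intro sum.cong) auto
  hence push_t: "push (mon_weight gw) t = e" by (simp add: sum_of_terms)
  have t: "wdeg m \<alpha> = d" "lex_less r a (mon_val gw \<alpha>)" if \<alpha>: "\<alpha> \<in> supp t" for \<alpha>
  proof -
    have "supp t \<subseteq> (\<Union>w\<in>supp e. supp (trm (b w) (coef e w)))" unfolding t_def by (rule keys_sum)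
    then obtain w where w: "w \<in> supp e" "\<alpha> = b w" using \<alpha> by (auto split: if_splits)
    hence "int (wdeg m \<alpha>) = int d" using b fst_e[OF w(1)] fst_mon_weight[of m \<eta> \<alpha>] by metis
    thus "wdeg m \<alpha> = d" by simp
    show "lex_less r a (mon_val gw \<alpha>)" using w b e by (auto simp: part_gt_def)
  qed
  define h where "h = g - t"
  have hK: "h \<in> K"
    unfolding ker_theta_iff h_def using gc tc by (simp add: push_diff push_t poly_ring_diff_closed) (simp add: e_def)
  have disj: "coef t \<alpha> = 0" if "\<alpha> \<in> supp g" for \<alpha>
    using t(2)[of \<alpha>] bihom[OF that] lex_less_irrefl by (auto simp: in_keys_iff)
  obtain \<alpha>0 where \<alpha>0: "\<alpha>0 \<in> supp g" using g0 by (metis ex_in_conv keys_eq_empty)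
  have \<alpha>0h: "\<alpha>0 \<in> supp h" using \<alpha>0 disj[OF \<alpha>0] by (simp add: h_def in_keys_iff lookup_minus)
  have sph: "supp \<alpha> \<subseteq> {..<p}" if "\<alpha> \<in> supp h" for \<alpha>
    using hK that by (simp add: ker_theta_iff poly_ring_carrier_iff)
  have supp_h: "\<alpha> \<in> supp g \<or> \<alpha> \<in> supp t" if "\<alpha> \<in> supp h" for \<alpha>
    using that keys_diff[of g t] by (auto simp: h_def)
  have top: "(\<forall>\<beta>\<in>supp h. nu_le P r f m \<eta> \<beta> \<alpha>) \<longleftrightarrow> \<alpha> \<in> supp g" if \<alpha>: "\<alpha> \<in> supp h" for \<alpha>
  proof
    assume "\<forall>\<beta>\<in>supp h. nu_le P r f m \<eta> \<beta> \<alpha>"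
    hence n: "nu_le P r f m \<eta> \<alpha>0 \<alpha>" using \<alpha>0h by blast
    show "\<alpha> \<in> supp g"
    proof (rule ccontr)
      assume "\<alpha> \<notin> supp g"
      hence \<alpha>t: "\<alpha> \<in> supp t" using supp_h[OF \<alpha>] by blast
      hence "lex_le r (mon_val gw \<alpha>) a"
        using n nu_le_iff[OF sph[OF \<alpha>] sph[OF \<alpha>0h]] bihom[OF \<alpha>0] t(1)[OF \<alpha>t] by simp
      hence "lex_less r a a" using t(2)[OF \<alpha>t] lex_less_le_trans[OF face_order] by blast
      thus False using lex_less_irrefl by blast
    qed
  next
    assume \<alpha>g: "\<alpha> \<in> supp g"
    show "\<forall>\<beta>\<in>supp h. nu_le P r f m \<eta> \<beta> \<alpha>"
    proof
      fix \<beta> assume \<beta>: "\<beta> \<in> supp h"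
      from supp_h[OF \<beta>] have "wdeg m \<beta> = d \<and> lex_le r a (mon_val gw \<beta>)"
      proof
        assume "\<beta> \<in> supp g" thus ?thesis using bihom[of \<beta>] by simp
      next
        assume "\<beta> \<in> supp t" thus ?thesis using t[of \<beta>] by (simp add: lex_le_def)
      qed
      thus "nu_le P r f m \<eta> \<beta> \<alpha>" using bihom[OF \<alpha>g] nu_le_iff[OF sph[OF \<alpha>] sph[OF \<beta>]] by simp
    qed
  qed
  have "initial_form (nu_le P r f m \<eta>) h = g"
  proof (rule poly_mapping_eqI)
    fix \<alpha>
    show "coef (initial_form (nu_le P r f m \<eta>) h) \<alpha> = coef g \<alpha>"
    proof (cases "\<alpha> \<in> supp h")
      case True
      thus ?thesis using top[OF True] disj[of \<alpha>]
        by (cases "\<alpha> \<in> supp g")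
          (simp_all add: initial_form_def select_terms_eq_restr coef_restr h_def lookup_minus in_keys_iff)
    next
      case False
      moreover from this have "\<alpha> \<notin> supp g" using disj[of \<alpha>] by (auto simp: h_def in_keys_iff lookup_minus)
      ultimately show ?thesis by (simp add: initial_form_def select_terms_eq_restr coef_restr in_keys_iff)
    qed
  qed
  moreover have "h \<noteq> 0" using \<alpha>0h by auto
  ultimately show ?thesis using hK by blast
qed

text \<open>The kernel of \<open>\<theta>\<close> bar is homogeneous for degree and formal value together, so it is spanned by
  elements to which the previous lemma applies.\<close>

lemma initial_ideal_ker_theta: "initial_ideal {..<p} (nu_le P r f m \<eta>) K = K0"
proof
  interpret R: cring "poly_ring {..<p} :: (nat, 'k) mpoly ring" by (rule cring_poly_ring)
  let ?S = "initial_form (nu_le P r f m \<eta>) ` (K - {0})"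
  have S: "?S \<subseteq> K0" using initial_form_in_ker_theta_bar by blast
  have SR: "?S \<subseteq> carrier (poly_ring {..<p})" using S ideal.Icarr[OF ideal_ker_theta_bar] by blast
  show "initial_ideal {..<p} (nu_le P r f m \<eta>) K \<subseteq> K0"
    unfolding initial_ideal_def by (rule R.genideal_minimal[OF ideal_ker_theta_bar S])
  have idS: "ideal (genideal (poly_ring {..<p}) ?S) (poly_ring {..<p})" by (rule R.genideal_ideal[OF SR])
  show "K0 \<subseteq> initial_ideal {..<p} (nu_le P r f m \<eta>) K"
  proof
    fix g assume g: "g \<in> K0"
    let ?b = "\<lambda>\<alpha>. (wdeg m \<alpha>, mon_val gw \<alpha>)"
    have "restr (\<lambda>\<alpha>. ?b \<alpha> = c) g \<in> genideal (poly_ring {..<p}) ?S" for c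
    proof (cases "restr (\<lambda>\<alpha>. ?b \<alpha> = c) g = 0")
      case True
      thus ?thesis using additive_subgroup.zero_closed[OF ideal.axioms(1)[OF idS]] by simp
    next
      case False
      obtain d a where c: "c = (d, a)" by (cases c)
      have eq: "restr (\<lambda>\<alpha>. ?b \<alpha> = c) g = restr (\<lambda>\<alpha>. mon_val gw \<alpha> = a) (restr (\<lambda>\<alpha>. wdeg m \<alpha> = d) g)"
        unfolding restr_restr c by (simp add: conj_commute)
      have "value_part gw x (restr (\<lambda>\<alpha>. ?b \<alpha> = c) g) \<in> part_gt x" for x
      proof (cases "x = a")
        case True
        have "value_part gw a (restr (\<lambda>\<alpha>. ?b \<alpha> = c) g) = value_part gw a (restr (\<lambda>\<alpha>. wdeg m \<alpha> = d) g)"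
          unfolding eq value_part_def restr_restr by simp
        thus ?thesis using g True by (simp add: value_part_degree_restr ker_theta_bar_iff part_gt_restr)
      next
        case False
        have "value_part gw x (restr (\<lambda>\<alpha>. ?b \<alpha> = c) g) = 0"
          using False by (intro value_part_eq_0) (auto simp: c)
        thus ?thesis by (simp add: part_gt_0)
      qed
      hence "restr (\<lambda>\<alpha>. ?b \<alpha> = c) g \<in> K0"
        using g by (simp add: ker_theta_bar_iff poly_ring_restr_closed)
      from bihomogeneous_is_initial_form[OF this False, of d a]
      have "restr (\<lambda>\<alpha>. ?b \<alpha> = c) g \<in> ?S" by (force simp: c)
      thus ?thesis using R.genideal_self[OF SR] by blast
    qed
    hence "(\<Sum>c\<in>?b ` supp g. restr (\<lambda>\<alpha>. ?b \<alpha> = c) g) \<in> genideal (poly_ring {..<p}) ?S"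
      by (rule ideal_sum_closed[OF idS])
    also have "(\<Sum>c\<in>?b ` supp g. restr (\<lambda>\<alpha>. ?b \<alpha> = c) g) = g" by (rule sum_restr) auto
    finally show "g \<in> initial_ideal {..<p} (nu_le P r f m \<eta>) K" unfolding initial_ideal_def .
  qed
qed

section \<open>The variety of the presentation\<close>

text \<open>The values of the chosen generators at a point of the extended torus.\<close>

definition gen_point :: "'k \<times> ('k^'n) \<Rightarrow> nat \<Rightarrow> 'k" where
  "gen_point s = (\<lambda>i. if i < p then ext_char (gw i) s else 0)"

lemma peval_gen_point:
  assumes g: "g \<in> carrier (poly_ring {..<p})" and s: "s \<in> ext_torus"
  shows "peval g (gen_point s) = char_sum (push (mon_weight gw) g) s"
proof -
  have "(\<Prod>i\<in>supp \<alpha>. gen_point s i ^ coef \<alpha> i) = ext_char (mon_weight gw \<alpha>) s" if "\<alpha> \<in> supp g" for \<alpha>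
  proof -
    have "i < p" if "i \<in> supp \<alpha>" for i using g that \<open>\<alpha> \<in> supp g\<close> by (auto simp: poly_ring_carrier_iff)
    thus ?thesis by (simp add: ext_char_mon_weight[OF s] gen_point_def)
  qed
  thus ?thesis by (simp add: peval_def push_def char_sum_sum char_sum_term)
qed

lemma gen_point_in_variety:
  assumes s: "s \<in> ext_torus"
  shows "wpoint m (gen_point s) \<in> vanishing_locus {..<p} m K"
  unfolding vanishing_locus_def
proof (intro CollectI conjI ballI)
  have "gen_point s 0 \<noteq> 0" using p_pos ext_char_nonzero[OF s] by (simp add: gen_point_def)
  hence "gen_point s \<noteq> (\<lambda>i. 0)" by auto
  thus "wpoint m (gen_point s) \<in> wproj {..<p} m"
    unfolding wproj_def by (intro imageI) (auto simp: affine_space_def gen_point_def)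
  fix b g assume b: "b \<in> wpoint m (gen_point s)" and g: "g \<in> K"
  obtain \<xi> where \<xi>: "\<xi> \<noteq> 0" "b = (\<lambda>i. \<xi> ^ m i * gen_point s i)" using b by (auto simp: wpoint_def)
  let ?s = "(\<xi> * fst s, snd s)"
  have "?s \<in> ext_torus" using s \<xi> by (auto simp: ext_torus_def)
  moreover have "b = gen_point ?s"
    by (auto simp: \<xi>(2) gen_point_def ext_char_def power_mult_distrib)
  ultimately show "peval g b = 0" using g by (simp add: ker_theta_iff peval_gen_point)
qed

text \<open>Already the torus points detect membership in \<open>ker \<theta>\<close>.\<close>

lemma vanishing_ideal_variety:
  "vanishing_ideal {..<p} m (vanishing_locus {..<p} m K) = K"
proof (rule vanishing_ideal_vanishing_locus[OF homogeneous_ker_theta])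
  fix g :: "(nat, 'k) mpoly" and d
  assume g: "g \<in> carrier (poly_ring {..<p})" "\<forall>y\<in>vanishing_locus {..<p} m K. \<forall>a\<in>y. peval g a = 0"
  have "char_sum (push (mon_weight gw) g) s = 0" if "s \<in> ext_torus" for s
    using bspec[OF bspec[OF g(2) gen_point_in_variety[OF that]] wpoint_self]
    by (simp only: peval_gen_point[OF g(1) that])
  hence "push (mon_weight gw) g = 0" by (rule char_sum_eq_0_imp)
  thus "g \<in> K" using g(1) by (simp add: ker_theta_iff)
qed

text \<open>If both pieces of a decomposition were proper, each would satisfy an additional equation; the product
  of the two equations would vanish on the torus, where nonzero sums of characters have a common
  nonzero.\<close>

lemma variety_irreducible: "weighted_subvariety {..<p} m (vanishing_locus {..<p} m K)"
  unfolding weighted_subvariety_def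
proof (intro conjI allI impI)
  let ?Y = "vanishing_locus {..<p} m K"
  show "weighted_algebraic_set {..<p} m ?Y"
    unfolding weighted_algebraic_set_def using homogeneous_ker_theta by blast
  have "(1, \<chi> i. 1) \<in> (ext_torus :: ('k \<times> ('k^'n)) set)" by (simp add: ext_torus_def torus_def)
  thus "?Y \<noteq> {}" using gen_point_in_variety by blast
  fix Z1 Z2 :: "(nat \<Rightarrow> 'k) set set"
  assume Z: "weighted_algebraic_set {..<p} m Z1 \<and> weighted_algebraic_set {..<p} m Z2 \<and> ?Y = Z1 \<union> Z2"
  have sep: "\<exists>g\<in>carrier (poly_ring {..<p}). push (mon_weight gw) g \<noteq> 0 \<and> (\<forall>z\<in>Z. \<forall>a\<in>z. peval g a = 0)"
    if ZZ: "weighted_algebraic_set {..<p} m Z" "Z \<subseteq> ?Y" "?Y \<noteq> Z" for Z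
  proof -
    obtain J where J: "homogeneous_ideal {..<p} m J" "Z = vanishing_locus {..<p} m J"
      using ZZ(1) by (auto simp: weighted_algebraic_set_def)
    have Jc: "J \<subseteq> carrier (poly_ring {..<p})"
      using ideal.Icarr[OF conjunct1[OF J(1)[unfolded homogeneous_ideal_def]]] by (rule subsetI)
    have "\<not> J \<subseteq> K"
    proof
      assume JK: "J \<subseteq> K"
      have "?Y \<subseteq> Z"
      proof
        fix y assume "y \<in> ?Y"
        thus "y \<in> Z" using subsetD[OF JK] by (simp add: J(2) vanishing_locus_def)
      qed
      thus False using ZZ(2,3) by (simp add: subset_antisym)
    qed
    then obtain g where g: "g \<in> J" "g \<notin> K" unfolding subset_iff not_all not_imp by (elim exE conjE)
    hence "g \<in> carrier (poly_ring {..<p})" "push (mon_weight gw) g \<noteq> 0"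
      using subsetD[OF Jc g(1)] by (simp_all add: ker_theta_iff)
    moreover have "\<forall>z\<in>Z. \<forall>a\<in>z. peval g a = 0" using g(1) unfolding J(2) vanishing_locus_def by blast
    ultimately show ?thesis by blast
  qed
  show "?Y = Z1 \<or> ?Y = Z2"
  proof (rule ccontr)
    assume "\<not> (?Y = Z1 \<or> ?Y = Z2)"
    then obtain g1 g2 where g: "g1 \<in> carrier (poly_ring {..<p})" "push (mon_weight gw) g1 \<noteq> 0"
      "\<forall>z\<in>Z1. \<forall>a\<in>z. peval g1 a = 0" "g2 \<in> carrier (poly_ring {..<p})"
      "push (mon_weight gw) g2 \<noteq> 0" "\<forall>z\<in>Z2. \<forall>a\<in>z. peval g2 a = 0"
      using sep[of Z1] sep[of Z2] Z by blast
    obtain s where s: "s \<in> ext_torus" "char_sum (push (mon_weight gw) g1) s \<noteq> 0"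
      "char_sum (push (mon_weight gw) g2) s \<noteq> 0"
      using char_sum_common_nonzero[OF g(2,5)] by blast
    have "wpoint m (gen_point s) \<in> Z1 \<or> wpoint m (gen_point s) \<in> Z2"
      using gen_point_in_variety[OF s(1)] Z by blast
    hence "peval g1 (gen_point s) = 0 \<or> peval g2 (gen_point s) = 0"
      using g(3,6) wpoint_self by blast
    thus False using s peval_gen_point[OF g(1) s(1)] peval_gen_point[OF g(4) s(1)] by simp
  qed
qed

end

section \<open>The toric degeneration\<close>

theorem theorem5p16:
  fixes P :: "(real^'n) set"
    and r :: "(real^'n) set rel"
    and X :: "(real^'n) set \<Rightarrow> (int^'n \<Rightarrow> 'k::{alg_closed_field, field_char_0}) set set"
    and f :: "(real^'n) set \<Rightarrow> ('n, 'k) cfun"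
    and p :: nat and m :: "nat \<Rightarrow> nat" and \<eta> :: "nat \<Rightarrow> int^'n"
    and l :: "nat \<Rightarrow> int"
  assumes "full_dim_normal_lattice_polytope P"
    and "refines_face_order P r"
    and "combinatorial_seshadri_stratification P X f"
    and "admissible_generators P r f p m \<eta>"
    and "initial_ideal {..<p} (nu_le P r f m \<eta>) (ker_theta P p m \<eta> :: (nat, 'k) mpoly set)
           = initial_ideal {..<p} (weight_vector_le l) (ker_theta P p m \<eta>)"
  shows "toric_degeneration {..<p} m l
           (vanishing_locus {..<p} m (ker_theta P p m \<eta> :: (nat, 'k) mpoly set))
           (vanishing_locus {..<p} m (ker_theta_bar P r f p m \<eta>))"
proof -
  interpret presentation P r X f p m \<eta>
    using assms(1-4) by unfold_locales
  have "weighted_algebraic_set {..<p} m (vanishing_locus {..<p} m K0)"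
    unfolding weighted_algebraic_set_def using homogeneous_ker_theta_bar by blast
  thus ?thesis
    unfolding toric_degeneration_def vanishing_ideal_variety assms(5)[symmetric] initial_ideal_ker_theta
    using variety_irreducible by blast
qed

end
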